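(* There is a randomized polynomial-time algorithm that, given as input an $n$-vertex connected graph $G$ with $\mathrm{AC}(G)=1$, outputs with high probability a strategy for acquaintance in $G$ consisting of $O(\log n)$ rounds.
   Context: Acquaintance time: let $G=(V,E)$ be a finite, simple, undirected, connected graph, and place one agent on each vertex. Two agents are acquainted once they occupy the two endpoints of a common edge at some time (including the initial placement). In each round one chooses a matching $M$ of $G$ (any set of pairwise vertex-disjoint edges, not necessarily maximal), and for every edge of $M$ the two agents on its endpoints swap places; after each round, agents on adjacent vertices again become acquainted. A strategy is a finite sequence of matchings; a strategy for acquaintance is one after which every pair of agents has been acquainted. $\mathrm{AC}(G)$ is the minimum number of rounds in a strategy for acquaintance in $G$. *)

theory Defs
  imports "HOL-Probability.Probability" "Graph_Theory.Digraph_Component"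
begin

section \<open>Acquaintance time\<close>

text \<open>
  A finite simple undirected graph is a \<^locale>\<open>pair_graph\<close>: a finite loopless digraph without
  parallel arcs whose arc relation \<^const>\<open>parcs\<close> is symmetric. The name \<open>connected\<close> is written
  with its theory qualifier because HOL-Analysis has a topological notion of the same name.
\<close>

definition connected_graph :: "'a pair_pre_digraph \<Rightarrow> bool" where
  "connected_graph G \<longleftrightarrow> pair_graph G \<and> Digraph_Component.connected (with_proj G)"

definition edges :: "'a pair_pre_digraph \<Rightarrow> 'a set set" where
  "edges G = {{u, v} | u v. (u, v) \<in> parcs G}"

definition matching :: "'a pair_pre_digraph \<Rightarrow> 'a set set \<Rightarrow> bool" where
  "matching G M \<longleftrightarrow> M \<subseteq> edges G \<and> pairwise disjnt M"

definition swap :: "'a set set \<Rightarrow> 'a \<Rightarrow> 'a" where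
  "swap M v = (if \<exists>w. w \<noteq> v \<and> {v, w} \<in> M then THE w. w \<noteq> v \<and> {v, w} \<in> M else v)"

text \<open>
  Agents are named by their initial vertices; \<open>position Ms a\<close> is where agent \<open>a\<close> stands after
  the rounds in \<open>Ms\<close>, the head of the list being the first round.
\<close>

definition position :: "'a set set list \<Rightarrow> 'a \<Rightarrow> 'a" where
  "position Ms a = fold swap Ms a"

definition acquainted :: "'a pair_pre_digraph \<Rightarrow> 'a set set list \<Rightarrow> 'a \<Rightarrow> 'a \<Rightarrow> bool" where
  "acquainted G Ms a b \<longleftrightarrow>
     (\<exists>k\<le>length Ms. (position (take k Ms) a, position (take k Ms) b) \<in> parcs G)"

definition acquaintance_strategy :: "'a pair_pre_digraph \<Rightarrow> 'a set set list \<Rightarrow> bool" where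
  "acquaintance_strategy G Ms \<longleftrightarrow>
     (\<forall>M\<in>set Ms. matching G M) \<and>
     (\<forall>a\<in>pverts G. \<forall>b\<in>pverts G. a \<noteq> b \<longrightarrow> acquainted G Ms a b)"

text \<open>The value is \<open>\<infinity>\<close> when there is no strategy for acquaintance.\<close>

definition AC :: "'a pair_pre_digraph \<Rightarrow> enat" where
  "AC G = (INF Ms\<in>{Ms. acquaintance_strategy G Ms}. enat (length Ms))"


section \<open>Randomized algorithms\<close>

text \<open>
  The machine model is a random access machine with fair coins, programmed by structured commands.
  The memory consists of two-dimensional arrays of natural numbers, addressed by a name and two
  indices; a scalar variable \<open>x\<close> is the cell \<open>x[0,0]\<close>. Every assignment, test and coin
  flip takes one step.

  The only arithmetic operations are addition and truncated subtraction. In particular there is no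
  multiplication, which at unit cost could build numbers with exponentially many bits. A fixed
  program produces within \<open>t\<close> steps only numbers of \<open>O(t)\<close> bits more than its input, so polynomial
  time on this machine agrees with polynomial time on a probabilistic Turing machine.
\<close>

type_synonym state = "string \<Rightarrow> nat \<Rightarrow> nat \<Rightarrow> nat"

datatype expr =
    Const nat
  | Cell string expr expr
  | Plus expr expr
  | Minus expr expr

datatype test =
    Less expr expr
  | Neg test
  | Conj test test

datatype com =
    Skip
  | Assign string expr expr expr
  | Flip string
  | Seq com com
  | If test com com
  | While test com

primrec expr_val :: "expr \<Rightarrow> state \<Rightarrow> nat" where
  "expr_val (Const k) s = k"
| "expr_val (Cell x e1 e2) s = s x (expr_val e1 s) (expr_val e2 s)"
| "expr_val (Plus e1 e2) s = expr_val e1 s + expr_val e2 s"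
| "expr_val (Minus e1 e2) s = expr_val e1 s - expr_val e2 s"

primrec test_val :: "test \<Rightarrow> state \<Rightarrow> bool" where
  "test_val (Less e1 e2) s \<longleftrightarrow> expr_val e1 s < expr_val e2 s"
| "test_val (Neg b) s \<longleftrightarrow> \<not> test_val b s"
| "test_val (Conj b1 b2) s \<longleftrightarrow> test_val b1 s \<and> test_val b2 s"

definition update :: "state \<Rightarrow> string \<Rightarrow> nat \<Rightarrow> nat \<Rightarrow> nat \<Rightarrow> state" where
  "update s x i j k = s(x := (s x)(i := (s x i)(j := k)))"

text \<open>
  \<open>Assign x e1 e2 e\<close> stores the value of \<open>e\<close> in the cell \<open>x[e1,e2]\<close>. A program has
  halted when the remaining command is \<^const>\<open>Skip\<close>.
\<close>

primrec step :: "com \<Rightarrow> state \<Rightarrow> (com \<times> state) pmf" where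
  "step Skip s = return_pmf (Skip, s)"
| "step (Assign x e1 e2 e) s =
     return_pmf (Skip, update s x (expr_val e1 s) (expr_val e2 s) (expr_val e s))"
| "step (Flip x) s =
     map_pmf (\<lambda>b. (Skip, update s x 0 0 (if b then 1 else 0))) (bernoulli_pmf (1/2))"
| "step (Seq c1 c2) s =
     (if c1 = Skip then return_pmf (c2, s)
      else map_pmf (\<lambda>(c, s'). (Seq c c2, s')) (step c1 s))"
| "step (If b c1 c2) s = return_pmf (if test_val b s then c1 else c2, s)"
| "step (While b c) s = return_pmf (if test_val b s then Seq c (While b c) else Skip, s)"

primrec run :: "nat \<Rightarrow> com \<Rightarrow> state \<Rightarrow> (com \<times> state) pmf" where
  "run 0 c s = return_pmf (c, s)"
| "run (Suc t) c s = bind_pmf (step c s) (\<lambda>(c', s'). run t c' s')"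

definition halts_within :: "nat \<Rightarrow> com \<Rightarrow> state \<Rightarrow> bool" where
  "halts_within t c s \<longleftrightarrow> (\<forall>(c', s')\<in>set_pmf (run t c s). c' = Skip)"

definition final_state :: "nat \<Rightarrow> com \<Rightarrow> state \<Rightarrow> state pmf" where
  "final_state t c s = map_pmf snd (run t c s)"


section \<open>Input and output of a graph algorithm\<close>

text \<open>
  The input is a graph on the vertices \<open>0, \<dots>, n - 1\<close>, given by \<open>n\<close> and the adjacency
  matrix; all other cells are 0.
\<close>

definition input_state :: "nat pair_pre_digraph \<Rightarrow> state" where
  "input_state G = (\<lambda>x i j.
     if x = ''n'' \<and> i = 0 \<and> j = 0 then card (pverts G)
     else if x = ''adj'' \<and> (i, j) \<in> parcs G then 1
     else 0)"

text \<open>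
  The output is the number \<open>rounds\<close> and an array \<open>out\<close>: \<open>out[i,v]\<close> is the vertex matched with
  \<open>v\<close> in round \<open>i\<close>, and \<open>v\<close> itself if \<open>v\<close> is unmatched. The array is not trusted to
  describe matchings; \<^const>\<open>acquaintance_strategy\<close> checks that on the decoded edge sets.
\<close>

definition output_strategy :: "nat \<Rightarrow> state \<Rightarrow> nat set set list" where
  "output_strategy n s =
     map (\<lambda>i. {{v, s ''out'' i v} | v. v < n \<and> s ''out'' i v \<noteq> v}) [0..<s ''rounds'' 0 0]"

end

theory Submission
  imports Defs
begin

text \<open>
  Let \<open>\<sigma>\<close> be the one round that acquaints everybody: distinct \<open>u\<close> and \<open>v\<close> are adjacent, or
  \<open>\<sigma> u\<close> and \<open>\<sigma> v\<close> are. Hence the degrees of \<open>v\<close> and \<open>\<sigma> v\<close> add up to at least \<open>n - 1\<close>, so \<open>\<sigma>\<close>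
  matches the vertices of degree below \<open>(n - 1)/2\<close> (the low ones) into the others. The algorithm
  does not know \<open>\<sigma>\<close>, but finds such a matching \<open>\<mu>\<close> by an auction: unassigned low vertices bid for
  their cheapest high neighbour, raising its price by one.

  Then it repeats independent trials of four rounds. The first round uses a random subset of \<open>\<mu>\<close>, and
  takes any two given non-adjacent agents to high vertices \<open>x\<close> and \<open>y\<close> with probability at least
  \<open>1/4\<close>. The second round uses a random matching in which every edge appears with
  probability about \<open>1/n\<close>. Two non-adjacent high vertices have at least \<open>n/16\<close> common neighbours or
  at least \<open>n\<^sup>2/64\<close> edges between their neighbourhoods, because \<open>\<sigma>\<close> produces many edges across any
  balanced cut; so with constant probability this round makes the two agents adjacent. The last two
  rounds undo the first two. After \<open>O(log n)\<close> trials a given pair has failed to meet with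
  probability at most \<open>n\<^sup>-\<^sup>3\<close>, and a union bound over the pairs finishes the proof.
\<close>

section \<open>Weakest preexpectations\<close>

text \<open>Agents are lifted to high vertices because a low vertex may have too few neighbours for
  a random matching with edge probability about \<open>1/n\<close> to be of use. Undoing each trial
  sends everybody home, so the bound for one trial holds whatever happened before, and failure
  probabilities multiply. Only lower bounds on probabilities are needed, hence a calculus of weakest
  preexpectations: a good event is bounded from below by prescribing the coins of the few pairs near
  the two agents and leaving all other coins free, so the distribution of the greedy matching is
  never computed. The machine has fair coins and no multiplication. So \<open>1/n\<close> becomes
  \<open>2 ^ - b\<close> with \<open>16 * n \<le> 2 ^ b < 32 * n\<close>, and \<open>\<mu>\<close>
  comes from an auction, which needs only comparisons and increments. Running time is handled
  separately, by syntactic rules for counting loops; it turns the supremum over time in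
  \<open>wp\<close> into a probability at one fixed time.\<close>

definition wpt :: "nat \<Rightarrow> com \<Rightarrow> (state \<Rightarrow> ennreal) \<Rightarrow> state \<Rightarrow> ennreal" where
  "wpt t c f s = (\<integral>\<^sup>+p. (if fst p = Skip then f (snd p) else 0) \<partial>measure_pmf (run t c s))"

text \<open>Runs that have not halted contribute 0, so \<open>wpt\<close> increases with
  \<open>t\<close> and the supremum expresses total correctness: nontermination counts as
  failure.\<close>

definition wp :: "com \<Rightarrow> (state \<Rightarrow> ennreal) \<Rightarrow> state \<Rightarrow> ennreal" where
  "wp c f s = (SUP t. wpt t c f s)"

lemma wpt_0: "wpt 0 c f s = (if c = Skip then f s else 0)"
  by (simp add: wpt_def)

lemma wpt_Suc: "wpt (Suc t) c f s = (\<integral>\<^sup>+p. wpt t (fst p) f (snd p) \<partial>measure_pmf (step c s))"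
  by (simp add: wpt_def case_prod_beta)

lemma wpt_Skip [simp]: "wpt t Skip f s = f s"
  by (induction t) (simp_all add: wpt_0 wpt_Suc)

lemma wpt_le_Suc: "wpt t c f s \<le> wpt (Suc t) c f s"
proof (induction t arbitrary: c s)
  case 0
  show ?case by (cases "c = Skip") (auto simp: wpt_0)
next
  case (Suc t)
  show ?case
    unfolding wpt_Suc[of t c] wpt_Suc[of "Suc t" c] by (intro nn_integral_mono Suc)
qed

lemma wpt_mono_time: "t \<le> t' \<Longrightarrow> wpt t c f s \<le> wpt t' c f s"
  by (rule lift_Suc_mono_le[of "\<lambda>t. wpt t c f s"]) (rule wpt_le_Suc)

lemma incseq_wpt: "incseq (\<lambda>t. wpt t c f s)"
  by (simp add: incseq_def wpt_mono_time)

text \<open>One step shifts the time by one, which the supremum does not see; monotone convergence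
  moves the supremum under the integral.\<close>

lemma wp_step: "wp c f s = (\<integral>\<^sup>+p. wp (fst p) f (snd p) \<partial>measure_pmf (step c s))"
proof -
  have "wp c f s = (SUP t. wpt (Suc t) c f s)"
    unfolding wp_def
    by (intro antisym SUP_mono) (auto intro: wpt_le_Suc)
  also have "\<dots> = (\<integral>\<^sup>+p. wp (fst p) f (snd p) \<partial>measure_pmf (step c s))"
    unfolding wpt_Suc wp_def
    by (intro nn_integral_monotone_convergence_SUP[symmetric])
       (auto simp: incseq_def le_fun_def intro: wpt_mono_time)
  finally show ?thesis .
qed

lemma wp_Skip [simp]: "wp Skip f s = f s"
  by (simp add: wp_def)

lemma wp_Assign [simp]:
  "wp (Assign x e1 e2 e) f s = f (update s x (expr_val e1 s) (expr_val e2 s) (expr_val e s))"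
  by (subst wp_step) simp

lemma wp_Assign_fun:
  "wp (Assign x e1 e2 e) f = (\<lambda>s. f (update s x (expr_val e1 s) (expr_val e2 s) (expr_val e s)))"
  by (rule ext) simp

lemma wp_Flip: "wp (Flip x) f s = f (update s x 0 0 1) / 2 + f (update s x 0 0 0) / 2"
proof -
  have "ennreal (1/2) = inverse 2"
    by (metis ennreal_numeral inverse_ennreal inverse_eq_divide zero_less_numeral zero_le_numeral)
  moreover have "(1 - ennreal (1/2)) = ennreal (1/2)"
    using ennreal_minus[of "1/2" 1] by simp
  ultimately show ?thesis
    by (subst wp_step) (simp add: divide_ennreal_def ennreal_minus)
qed

lemma wp_If [simp]: "wp (If b c1 c2) f s = (if test_val b s then wp c1 f s else wp c2 f s)"
  by (subst wp_step) simp

text \<open>The additional step is the one that turns \<open>Seq Skip c2\<close> into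
  \<open>c2\<close>. Together with \<open>wpt_Seq_le\<close> this yields the two halves of
  \<open>wp_Seq\<close>.\<close>

lemma wpt_Seq_ge: "wpt t1 c1 (wpt t2 c2 f) s \<le> wpt (Suc (t1 + t2)) (Seq c1 c2) f s"
proof (induction t1 arbitrary: c1 s)
  case 0
  show ?case by (auto simp: wpt_0 wpt_Suc)
next
  case (Suc t1)
  show ?case
  proof (cases "c1 = Skip")
    case True
    then show ?thesis
      using wpt_mono_time[of t2 "Suc (t1 + t2)" c2 f s] by (simp add: wpt_Suc[of "Suc (t1 + t2)"])
  next
    case False
    then show ?thesis
      unfolding wpt_Suc[of t1] wpt_Suc[of "Suc t1 + t2"]
      by (simp add: case_prod_beta) (intro nn_integral_mono Suc)
  qed
qed

lemma wpt_Seq_le: "wpt t (Seq c1 c2) f s \<le> wpt t c1 (wpt t c2 f) s"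
proof (induction t arbitrary: c1 s)
  case 0
  show ?case by (simp add: wpt_0)
next
  case (Suc t)
  show ?case
  proof (cases "c1 = Skip")
    case True
    then show ?thesis
      using wpt_le_Suc[of t c2 f s] by (simp add: wpt_Suc[of t "Seq _ _"])
  next
    case False
    have "wpt t (fst p) (wpt t c2 f) (snd p) \<le> wpt t (fst p) (wpt (Suc t) c2 f) (snd p)" for p
      unfolding wpt_def[of t "fst p"] by (intro nn_integral_mono) (simp add: wpt_le_Suc)
    with False show ?thesis
      unfolding wpt_Suc[of t c1] wpt_Suc[of t "Seq _ _"]
      by (simp add: case_prod_beta) (intro nn_integral_mono order_trans[OF Suc])
  qed
qed

lemma wp_mono: "(\<And>s. f s \<le> g s) \<Longrightarrow> wp c f s \<le> wp c g s"
  unfolding wp_def wpt_def by (intro SUP_mono' nn_integral_mono) auto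

lemma wp_Seq [simp]: "wp (Seq c1 c2) f s = wp c1 (wp c2 f) s"
proof (rule antisym)
  have "wpt t (Seq c1 c2) f s \<le> wp c1 (wp c2 f) s" for t
  proof -
    have "wpt t (Seq c1 c2) f s \<le> wpt t c1 (wpt t c2 f) s"
      by (rule wpt_Seq_le)
    also have "\<dots> \<le> wpt t c1 (wp c2 f) s"
      unfolding wpt_def[of t c1] wp_def by (intro nn_integral_mono) (auto intro: SUP_upper)
    also have "\<dots> \<le> wp c1 (wp c2 f) s"
      unfolding wp_def[of c1] by (auto intro: SUP_upper)
    finally show ?thesis .
  qed
  then show "wp (Seq c1 c2) f s \<le> wp c1 (wp c2 f) s"
    unfolding wp_def[of "Seq _ _"] by (auto intro: SUP_least)
next
  have "wpt t c1 (wp c2 f) s \<le> wp (Seq c1 c2) f s" for t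
  proof -
    have "wpt t c1 (wp c2 f) s
        = (\<integral>\<^sup>+p. (SUP t2. if fst p = Skip then wpt t2 c2 f (snd p) else 0) \<partial>measure_pmf (run t c1 s))"
      unfolding wpt_def[of t c1] wp_def by (intro nn_integral_cong) simp
    also have "\<dots> = (SUP t2. wpt t c1 (wpt t2 c2 f) s)"
      unfolding wpt_def[of t c1]
      by (intro nn_integral_monotone_convergence_SUP)
         (auto simp: incseq_def le_fun_def intro: wpt_mono_time)
    also have "\<dots> \<le> wp (Seq c1 c2) f s"
      unfolding wp_def[of "Seq _ _"]
      by (intro SUP_mono) (metis UNIV_I wpt_Seq_ge)
    finally show ?thesis .
  qed
  then show "wp c1 (wp c2 f) s \<le> wp (Seq c1 c2) f s"
    unfolding wp_def[of c1] by (auto intro: SUP_least)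
qed

lemma wp_While:
  "wp (While b c) f s = (if test_val b s then wp c (wp (While b c) f) s else f s)"
  by (subst wp_step) simp

text \<open>Monotonicity in time lets the suprema be added. Linearity drives the loop rule
  \<open>tr_FOR_eventually\<close> and the sum over disjoint events.\<close>

lemma wp_add: "wp c (\<lambda>s. f s + g s) s = wp c f s + wp c g s"
proof -
  have "wpt t c (\<lambda>s. f s + g s) s = wpt t c f s + wpt t c g s" for t
    unfolding wpt_def by (subst nn_integral_add[symmetric]) (auto intro!: nn_integral_cong)
  then show ?thesis
    unfolding wp_def by (simp add: ennreal_SUP_add incseq_wpt)
qed

lemma wp_cmult: "wp c (\<lambda>s. a * f s) s = a * wp c f s"
proof -
  have "wpt t c (\<lambda>s. a * f s) s = a * wpt t c f s" for t
    unfolding wpt_def by (subst nn_integral_cmult[symmetric]) (auto intro!: nn_integral_cong)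
  then show ?thesis
    unfolding wp_def by (simp add: SUP_mult_left_ennreal)
qed

lemma wp_zero: "wp c (\<lambda>s. 0) s = 0"
  using wp_cmult[of c 0 "\<lambda>_. 0" s] by simp

lemma wp_sum: "finite I \<Longrightarrow> wp c (\<lambda>s. \<Sum>i\<in>I. f i s) s = (\<Sum>i\<in>I. wp c (f i) s)"
  by (induction I rule: finite_induct) (simp_all add: wp_add wp_zero)

text \<open>Whole arrays are tracked, not cells: a program that writes one row of \<open>out\<close>
  carries no frame information about the others, so later invariants mention them
  explicitly.\<close>

primrec wr :: "com \<Rightarrow> string set" where
  "wr Skip = {}"
| "wr (Assign x e1 e2 e) = {x}"
| "wr (Flip x) = {x}"
| "wr (Seq c1 c2) = wr c1 \<union> wr c2"
| "wr (If b c1 c2) = wr c1 \<union> wr c2"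
| "wr (While b c) = wr c"

lemma update_simps:
  "x \<noteq> y \<Longrightarrow> update s x i j k y = s y"
  "update s x i j k x = (s x)(i := (s x i)(j := k))"
  by (simp_all add: update_def)

lemma step_frame:
  "p \<in> set_pmf (step c s) \<Longrightarrow> wr (fst p) \<subseteq> wr c \<and> (\<forall>x. x \<notin> wr c \<longrightarrow> snd p x = s x)"
  by (induction c arbitrary: p)
     (auto simp: update_simps split: if_splits, (metis fst_conv snd_conv subset_iff)+)

lemma run_frame: "p \<in> set_pmf (run t c s) \<Longrightarrow> x \<notin> wr c \<Longrightarrow> snd p x = s x"
proof (induction t arbitrary: c s)
  case (Suc t)
  from Suc.prems(1) obtain q where q: "q \<in> set_pmf (step c s)" "p \<in> set_pmf (run t (fst q) (snd q))"
    by (auto simp: case_prod_beta)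
  with step_frame[OF q(1)] Suc.prems(2) Suc.IH[OF q(2)] show ?case
    by auto
qed simp

text \<open>States that differ from \<open>s\<close> outside \<open>wr c\<close> are reached with
  probability 0, so the postexpectation may be set to 0 there.\<close>

lemma wp_frame: "wp c f s = wp c (\<lambda>s'. if \<forall>x. x \<notin> wr c \<longrightarrow> s' x = s x then f s' else 0) s"
proof -
  have "wpt t c f s = wpt t c (\<lambda>s'. if \<forall>x. x \<notin> wr c \<longrightarrow> s' x = s x then f s' else 0) s" for t
    unfolding wpt_def
    by (intro nn_integral_cong_AE) (auto simp: AE_measure_pmf_iff dest: run_frame)
  then show ?thesis by (simp add: wp_def)
qed


section \<open>Probabilistic Hoare triples\<close>

text \<open>Only lower bounds are recorded; \<open>q = 1\<close> covers the deterministic parts and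
  the invariants that hold almost surely.\<close>

definition tr :: "(state \<Rightarrow> bool) \<Rightarrow> com \<Rightarrow> real \<Rightarrow> (state \<Rightarrow> bool) \<Rightarrow> bool" where
  "tr P c q Q \<longleftrightarrow> (\<forall>s. P s \<longrightarrow> ennreal q \<le> wp c (\<lambda>s'. of_bool (Q s')) s)"

lemma trI: "(\<And>s. P s \<Longrightarrow> ennreal q \<le> wp c (\<lambda>s'. of_bool (Q s')) s) \<Longrightarrow> tr P c q Q"
  by (simp add: tr_def)

lemma trD: "tr P c q Q \<Longrightarrow> P s \<Longrightarrow> ennreal q \<le> wp c (\<lambda>s'. of_bool (Q s')) s"
  by (simp add: tr_def)

lemma tr_conseq:
  assumes "tr P' c q' Q'" "\<And>s. P s \<Longrightarrow> P' s" "\<And>s. Q' s \<Longrightarrow> Q s" "q \<le> q'"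
  shows "tr P c q Q"
proof (rule trI)
  fix s assume "P s"
  have "ennreal q \<le> ennreal q'" using assms(4) by (rule ennreal_leI)
  also have "\<dots> \<le> wp c (\<lambda>s'. of_bool (Q' s')) s"
    using assms(1,2) \<open>P s\<close> by (auto intro: trD)
  also have "\<dots> \<le> wp c (\<lambda>s'. of_bool (Q s')) s"
    using assms(3) by (intro wp_mono) auto
  finally show "ennreal q \<le> wp c (\<lambda>s'. of_bool (Q s')) s" .
qed

lemma tr_Seq:
  assumes "tr P c1 q1 R" "tr R c2 q2 Q" "0 \<le> q2"
  shows "tr P (Seq c1 c2) (q1 * q2) Q"
proof (rule trI)
  fix s assume "P s"
  have "ennreal (q1 * q2) = ennreal q2 * ennreal q1"
    using assms(3) by (simp add: ennreal_mult'' mult.commute)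
  also have "\<dots> \<le> ennreal q2 * wp c1 (\<lambda>s'. of_bool (R s')) s"
    using trD[OF assms(1), OF \<open>P s\<close>] by (intro mult_left_mono zero_le)
  also have "\<dots> = wp c1 (\<lambda>s'. ennreal q2 * of_bool (R s')) s"
    by (simp add: wp_cmult)
  also have "\<dots> \<le> wp c1 (wp c2 (\<lambda>s'. of_bool (Q s'))) s"
    using assms(2) by (intro wp_mono) (auto simp: tr_def)
  finally show "ennreal (q1 * q2) \<le> wp (Seq c1 c2) (\<lambda>s'. of_bool (Q s')) s" by simp
qed

lemma tr_Seq1: "tr P c1 1 R \<Longrightarrow> tr R c2 q Q \<Longrightarrow> 0 \<le> q \<Longrightarrow> tr P (Seq c1 c2) q Q"
  using tr_Seq[of P c1 1 R c2 q Q] by simp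

lemma tr_frame:
  assumes "tr P c q Q" "\<And>s s'. R s \<Longrightarrow> (\<And>x. x \<notin> wr c \<Longrightarrow> s' x = s x) \<Longrightarrow> R s'"
  shows "tr (\<lambda>s. P s \<and> R s) c q (\<lambda>s. Q s \<and> R s)"
proof (rule trI)
  fix s assume s: "P s \<and> R s"
  have "ennreal q \<le> wp c (\<lambda>s'. of_bool (Q s')) s"
    using assms(1) s by (auto intro: trD)
  also have "\<dots> = wp c (\<lambda>s'. if \<forall>x. x \<notin> wr c \<longrightarrow> s' x = s x then of_bool (Q s') else 0) s"
    by (rule wp_frame)
  also have "\<dots> \<le> wp c (\<lambda>s'. of_bool (Q s' \<and> R s')) s"
    using assms(2) s by (intro wp_mono) (auto simp: of_bool_def)
  finally show "ennreal q \<le> wp c (\<lambda>s'. of_bool (Q s' \<and> R s')) s" .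
qed

text \<open>Bounds for mutually exclusive outcomes add, by linearity of \<open>wp\<close>. This is
  applied to the possible targets of two agents in the second round.\<close>

lemma tr_disjoint:
  assumes "finite I" "\<And>i. i \<in> I \<Longrightarrow> tr P c (q i) (Q i)" "\<And>i. i \<in> I \<Longrightarrow> 0 \<le> q i"
    and "\<And>i j s. i \<in> I \<Longrightarrow> j \<in> I \<Longrightarrow> Q i s \<Longrightarrow> Q j s \<Longrightarrow> i = j"
  shows "tr P c (\<Sum>i\<in>I. q i) (\<lambda>s. \<exists>i\<in>I. Q i s)"
proof (rule trI)
  fix s assume "P s"
  have "ennreal (\<Sum>i\<in>I. q i) = (\<Sum>i\<in>I. ennreal (q i))"
    using assms(3) by (simp add: sum_ennreal)
  also have "\<dots> \<le> (\<Sum>i\<in>I. wp c (\<lambda>s'. of_bool (Q i s')) s)"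
    using assms(2) \<open>P s\<close> by (intro sum_mono) (auto intro: trD)
  also have "\<dots> = wp c (\<lambda>s'. \<Sum>i\<in>I. of_bool (Q i s')) s"
    by (rule wp_sum[OF assms(1), symmetric])
  also have "\<dots> \<le> wp c (\<lambda>s'. of_bool (\<exists>i\<in>I. Q i s')) s"
  proof (rule wp_mono)
    fix s'
    show "(\<Sum>i\<in>I. of_bool (Q i s')) \<le> (of_bool (\<exists>i\<in>I. Q i s') :: ennreal)"
    proof (cases "\<exists>i\<in>I. Q i s'")
      case True
      then obtain i where i: "i \<in> I" "Q i s'" by blast
      then have "(\<Sum>j\<in>I. of_bool (Q j s')) = (\<Sum>j\<in>I. if j = i then 1 else 0 :: ennreal)"
        using assms(4) by (intro sum.cong) (auto simp: of_bool_def)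
      then show ?thesis using i assms(1) True by simp
    qed auto
  qed
  finally show "ennreal (\<Sum>i\<in>I. q i) \<le> wp c (\<lambda>s'. of_bool (\<exists>i\<in>I. Q i s')) s" .
qed

section \<open>Counting loops and the rules that bound their success probability\<close>

abbreviation V :: "string \<Rightarrow> expr" where
  "V x \<equiv> Cell x (Const 0) (Const 0)"

abbreviation Set :: "string \<Rightarrow> expr \<Rightarrow> com" where
  "Set x e \<equiv> Assign x (Const 0) (Const 0) e"

definition FOR_from :: "string \<Rightarrow> expr \<Rightarrow> com \<Rightarrow> com" where
  "FOR_from x e c = While (Less (V x) e) (Seq c (Set x (Plus (V x) (Const 1))))"

definition FOR :: "string \<Rightarrow> expr \<Rightarrow> com \<Rightarrow> com" where
  "FOR x e c = Seq (Set x (Const 0)) (FOR_from x e c)"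

lemma wr_FOR [simp]: "wr (FOR x e c) = insert x (wr c)"
  by (auto simp: FOR_def FOR_from_def)

lemma wp_FOR_from_stop: "\<not> s x 0 0 < expr_val e s \<Longrightarrow> wp (FOR_from x e c) f s = f s"
  unfolding FOR_from_def by (subst wp_While) simp

lemma wp_FOR_from_step:
  "s x 0 0 < expr_val e s \<Longrightarrow>
   wp (FOR_from x e c) f s = wp c (\<lambda>s. wp (FOR_from x e c) f (update s x 0 0 (Suc (s x 0 0)))) s"
  unfolding FOR_from_def by (subst wp_While) (simp add: wp_Assign_fun)

text \<open>
  In both loop rules the first assumption makes the invariant independent of the loop
  counter, so that the index of the invariant plays the role of the counter.
\<close>

lemma tr_FOR:
  assumes ins: "\<And>k s j. I k s \<Longrightarrow> I k (update s x 0 0 j)"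
    and e: "\<And>k s. I k s \<Longrightarrow> expr_val e s = m"
    and x: "x \<notin> wr c"
    and body: "\<And>k. k < m \<Longrightarrow> tr (\<lambda>s. I k s \<and> s x 0 0 = k) c (q k) (I (Suc k))"
    and q: "\<And>k. k < m \<Longrightarrow> 0 \<le> q k"
  shows "tr (I 0) (FOR x e c) (\<Prod>k<m. q k) (I m)"
proof -
  \<comment> \<open>Generalised to a loop entered at counter \<open>k\<close>; the induction runs
    from \<open>m\<close> downwards.\<close>
  have "ennreal (\<Prod>i\<in>{k..<m}. q i) \<le> wp (FOR_from x e c) (\<lambda>s. of_bool (I m s)) s"
    if "k \<le> m" "I k s" "s x 0 0 = k" for k s
    using that
  proof (induction k arbitrary: s rule: inc_induct)
    case base
    then show ?case using e[OF base(1)] by (simp add: wp_FOR_from_stop)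
  next
    case (step k)
    let ?r = "\<Prod>i\<in>{Suc k..<m}. q i"
    have r: "0 \<le> ?r" using q by (intro prod_nonneg) auto
    have b: "tr (\<lambda>s. (I k s \<and> s x 0 0 = k) \<and> s x 0 0 = k) c (q k)
               (\<lambda>s. I (Suc k) s \<and> s x 0 0 = k)"
      using body[OF step.hyps(2)] x by (intro tr_frame) auto
    have "(\<Prod>i\<in>{k..<m}. q i) = q k * ?r"
      using step.hyps by (simp add: prod.atLeast_Suc_lessThan)
    then have "ennreal (\<Prod>i\<in>{k..<m}. q i) = ennreal ?r * ennreal (q k)"
      using r by (simp add: ennreal_mult'' mult.commute)
    also have "\<dots> \<le> ennreal ?r * wp c (\<lambda>s. of_bool (I (Suc k) s \<and> s x 0 0 = k)) s"
      using step.prems by (intro mult_left_mono trD[OF b]) auto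
    also have "\<dots> = wp c (\<lambda>s. ennreal ?r * of_bool (I (Suc k) s \<and> s x 0 0 = k)) s"
      by (simp add: wp_cmult)
    also have "\<dots> \<le> wp c (\<lambda>s. wp (FOR_from x e c) (\<lambda>s. of_bool (I m s)) (update s x 0 0 (Suc (s x 0 0)))) s"
      using ins step.IH by (intro wp_mono) (auto simp: of_bool_def update_simps)
    also have "\<dots> = wp (FOR_from x e c) (\<lambda>s. of_bool (I m s)) s"
      using step.hyps step.prems e[of k s] by (subst wp_FOR_from_step) auto
    finally show ?case .
  qed
  from this[of 0] show ?thesis
    using ins[of 0] by (intro trI) (auto simp: FOR_def update_simps lessThan_atLeast0)
qed

lemma tr_FOR1:
  assumes "\<And>k s j. I k s \<Longrightarrow> I k (update s x 0 0 j)"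
    and "\<And>k s. I k s \<Longrightarrow> expr_val e s = m"
    and "x \<notin> wr c"
    and "\<And>k. k < m \<Longrightarrow> tr (\<lambda>s. I k s \<and> s x 0 0 = k) c 1 (I (Suc k))"
  shows "tr (I 0) (FOR x e c) 1 (I m)"
  using tr_FOR[of I x e m c "\<lambda>_. 1"] assms by simp

text \<open>Each iteration reaches \<open>S\<close> with probability at least \<open>p\<close> from
  every state of the invariant, hence whatever the earlier iterations did, and \<open>S\<close> is
  never lost. So all \<open>m\<close> iterations fail with probability at most
  \<open>(1 - p) ^ m\<close>.\<close>

lemma tr_FOR_eventually:
  assumes ins: "\<And>k s j. J k s \<Longrightarrow> J k (update s x 0 0 j)" "\<And>s j. S s \<Longrightarrow> S (update s x 0 0 j)"
    and e: "\<And>k s. J k s \<Longrightarrow> expr_val e s = m"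
    and x: "x \<notin> wr c"
    and inv: "\<And>k. k < m \<Longrightarrow> tr (\<lambda>s. J k s \<and> s x 0 0 = k) c 1 (J (Suc k))"
    and keep: "\<And>k. k < m \<Longrightarrow> tr (\<lambda>s. J k s \<and> S s \<and> s x 0 0 = k) c 1 (\<lambda>s. J (Suc k) s \<and> S s)"
    and win: "\<And>k. k < m \<Longrightarrow> tr (\<lambda>s. J k s \<and> s x 0 0 = k) c p (\<lambda>s. J (Suc k) s \<and> S s)"
    and p: "0 \<le> p" "p \<le> 1"
  shows "tr (J 0) (FOR x e c) (1 - (1 - p) ^ m) (\<lambda>s. J m s \<and> S s)"
proof -
  let ?W = "wp (FOR_from x e c) (\<lambda>s. of_bool (J m s \<and> S s))"
  let ?q = "\<lambda>k. 1 - (1 - p) ^ (m - k)"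
  have q: "0 \<le> ?q k" for k using p by (simp add: power_le_one)
  have main: "ennreal (?q k) \<le> ?W s \<and> (S s \<longrightarrow> 1 \<le> ?W s)"
    if "k \<le> m" "J k s" "s x 0 0 = k" for k s
    using that
  proof (induction k arbitrary: s rule: inc_induct)
    case base
    then show ?case using e[OF base(1)] by (simp add: wp_FOR_from_stop)
  next
    case (step k)
    let ?N = "\<lambda>s. J (Suc k) s \<and> s x 0 0 = k"
    have W: "?W s = wp c (\<lambda>s. ?W (update s x 0 0 (Suc (s x 0 0)))) s"
      using step.hyps step.prems e[of k s] by (subst wp_FOR_from_step) auto
    have "tr (\<lambda>s. (J k s \<and> s x 0 0 = k) \<and> s x 0 0 = k) c 1 ?N"
      using inv[OF step.hyps(2)] x by (intro tr_frame) auto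
    from trD[OF this, of s] have 1: "1 \<le> wp c (\<lambda>s. of_bool (?N s)) s"
      using step.prems by simp
    have "tr (\<lambda>s. (J k s \<and> s x 0 0 = k) \<and> s x 0 0 = k) c p
            (\<lambda>s. (J (Suc k) s \<and> S s) \<and> s x 0 0 = k)"
      using win[OF step.hyps(2)] x by (intro tr_frame) auto
    from trD[OF this, of s] have 2: "ennreal p \<le> wp c (\<lambda>s. of_bool (?N s \<and> S s)) s"
      using step.prems by (simp add: conj_ac)
    have "tr (\<lambda>s. (J k s \<and> S s \<and> s x 0 0 = k) \<and> s x 0 0 = k) c 1
            (\<lambda>s. (J (Suc k) s \<and> S s) \<and> s x 0 0 = k)"
      using keep[OF step.hyps(2)] x by (intro tr_frame) auto
    from trD[OF this, of s] have 3: "S s \<longrightarrow> 1 \<le> wp c (\<lambda>s. of_bool (?N s \<and> S s)) s"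
      using step.prems by (simp add: conj_ac)
    have ge: "ennreal (?q (Suc k)) \<le> ?W (update s' x 0 0 (Suc k))"
      "S s' \<Longrightarrow> 1 \<le> ?W (update s' x 0 0 (Suc k))" if "?N s'" for s'
      using that step.IH[of "update s' x 0 0 (Suc k)"] ins by (auto simp: update_simps)
    let ?a = "(1 - p) ^ (m - Suc k)"
    have a: "0 \<le> ?a" using p by simp
    \<comment> \<open>Every outcome of the body is worth at least \<open>?q (Suc k)\<close>, and one
      in \<open>S\<close> is worth 1, that is \<open>?a\<close> more. Weighting the two events in
      this way takes only linearity and no conditional probabilities.\<close>
    have "?q k = ?q (Suc k) * 1 + ?a * p"
    proof -
      have "m - k = Suc (m - Suc k)" using step.hyps by simp
      then show ?thesis by (simp add: algebra_simps)
    qed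
    then have "ennreal (?q k) = ennreal (?q (Suc k)) * 1 + ennreal ?a * ennreal p"
      using q[of "Suc k"] a p by (simp only: ennreal_plus ennreal_mult mult_1_right mult_nonneg_nonneg)
    also have "\<dots> \<le> ennreal (?q (Suc k)) * wp c (\<lambda>s. of_bool (?N s)) s
                  + ennreal ?a * wp c (\<lambda>s. of_bool (?N s \<and> S s)) s"
      using 1 2 by (intro add_mono mult_left_mono) auto
    also have "\<dots> = wp c (\<lambda>s. ennreal (?q (Suc k)) * of_bool (?N s) + ennreal ?a * of_bool (?N s \<and> S s)) s"
      by (simp add: wp_add wp_cmult)
    also have "\<dots> \<le> wp c (\<lambda>s. ?W (update s x 0 0 (Suc (s x 0 0)))) s"
    proof (rule wp_mono)
      fix s'
      have "ennreal (?q (Suc k)) + ennreal ?a = 1"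
        using q[of "Suc k"] a by (subst ennreal_plus[symmetric]) auto
      then show "ennreal (?q (Suc k)) * of_bool (?N s') + ennreal ?a * of_bool (?N s' \<and> S s')
           \<le> ?W (update s' x 0 0 (Suc (s' x 0 0)))"
        using ge[of s'] by (cases "?N s'"; cases "S s'") auto
    qed
    finally have A: "ennreal (?q k) \<le> ?W s" unfolding W .
    have "1 \<le> ?W s" if "S s"
    proof -
      have "1 \<le> wp c (\<lambda>s. of_bool (?N s \<and> S s)) s" using 3 that by simp
      also have "\<dots> \<le> wp c (\<lambda>s. ?W (update s x 0 0 (Suc (s x 0 0)))) s"
        using ge by (intro wp_mono) (auto simp: of_bool_def)
      finally show ?thesis unfolding W .
    qed
    with A show ?case by simp
  qed
  from main[of 0] show ?thesis
    using ins(1)[of 0] by (intro trI) (auto simp: FOR_def update_simps)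
qed

section \<open>Graphs of acquaintance time one\<close>

text \<open>\<open>\<sigma> v\<close> is where the agent that starts at \<open>v\<close> stands
  after the single round; the matching of that round appears as an involution.\<close>

locale one_round =
  fixes n :: nat and E :: "nat \<Rightarrow> nat \<Rightarrow> bool" and \<sigma> :: "nat \<Rightarrow> nat"
  assumes sym: "E u v \<Longrightarrow> E v u"
    and irrefl: "\<not> E v v"
    and bound: "E u v \<Longrightarrow> u < n"
    and \<sigma>_lt: "v < n \<Longrightarrow> \<sigma> v < n"
    and \<sigma>\<sigma>: "v < n \<Longrightarrow> \<sigma> (\<sigma> v) = v"
    and \<sigma>_edge: "v < n \<Longrightarrow> \<sigma> v \<noteq> v \<Longrightarrow> E v (\<sigma> v)"
    and meet: "u < n \<Longrightarrow> v < n \<Longrightarrow> u \<noteq> v \<Longrightarrow> E u v \<or> E (\<sigma> u) (\<sigma> v)"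
begin

definition nb :: "nat \<Rightarrow> nat set" where "nb v = {u. E v u}"

definition low :: "nat \<Rightarrow> bool" where "low v \<longleftrightarrow> v < n \<and> 2 * card (nb v) + 1 < n"

lemma nb_sub: "nb v \<subseteq> {..<n}"
  using sym bound by (auto simp: nb_def)

lemma finite_nb [simp]: "finite (nb v)"
  using nb_sub by (rule finite_subset) simp

lemma \<sigma>_inj: "u < n \<Longrightarrow> v < n \<Longrightarrow> \<sigma> u = \<sigma> v \<longleftrightarrow> u = v"
  by (metis \<sigma>\<sigma>)

text \<open>A vertex \<open>y\<close> other than \<open>v\<close> and not adjacent to it satisfies
  \<open>E (\<sigma> v) (\<sigma> y)\<close>, so it is the image under \<open>\<sigma>\<close> of a
  neighbour of \<open>\<sigma> v\<close>.\<close>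

lemma deg_sum: "v < n \<Longrightarrow> n \<le> Suc (card (nb v) + card (nb (\<sigma> v)))"
proof -
  assume v: "v < n"
  have "{..<n} - {v} \<subseteq> nb v \<union> \<sigma> ` nb (\<sigma> v)"
  proof
    fix y assume y: "y \<in> {..<n} - {v}"
    with meet[of v y] v have "E v y \<or> E (\<sigma> v) (\<sigma> y)" by auto
    then show "y \<in> nb v \<union> \<sigma> ` nb (\<sigma> v)"
      using y \<sigma>\<sigma>[of y] by (auto simp: nb_def intro: image_eqI[of _ _ "\<sigma> y"])
  qed
  then have "card ({..<n} - {v}) \<le> card (nb v \<union> \<sigma> ` nb (\<sigma> v))"
    by (intro card_mono) auto
  also have "\<dots> \<le> card (nb v) + card (nb (\<sigma> v))"
    by (meson add_left_mono card_Un_le card_image_le finite_nb order_trans)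
  finally show ?thesis using v by simp
qed

text \<open>A fixed point has its degree counted twice in \<open>deg_sum\<close>, so it is not low;
  two low vertices have too small a degree sum.\<close>

lemma low_\<sigma>: "low v \<Longrightarrow> E v (\<sigma> v) \<and> \<not> low (\<sigma> v)"
  using deg_sum[of v] \<sigma>_edge[of v] by (cases "\<sigma> v = v") (auto simp: low_def)

text \<open>
  Either \<open>x\<close> and \<open>y\<close> have many common neighbours, or their neighbourhoods are joined by many
  edges. In the latter case the two neighbourhoods are almost complementary; for pairs
  \<open>(p, q)\<close> that \<open>\<sigma>\<close> maps into \<open>nb x \<times> nb y\<close> (\<open>X\<close> below) or \<open>nb y \<times> nb x\<close> (\<open>Y\<close> below) one of
  \<open>pq\<close> and \<open>\<sigma>(p)\<sigma>(q)\<close> is an edge.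
\<close>

lemma close_or_dense:
  assumes xy: "x < n" "y < n" "\<not> low x" "\<not> low y" and n: "n \<ge> 1000"
  defines "W \<equiv> {(z, w). z \<in> nb x \<and> w \<in> nb y \<and> E z w}"
  shows "n ^ 2 \<le> 64 * card W \<or> n \<le> 16 * card (nb x \<inter> nb y)"
proof (rule disjCI)
  assume "\<not> n \<le> 16 * card (nb x \<inter> nb y)"
  then have small: "16 * real (card (nb x \<inter> nb y)) < n"
    by (metis not_le of_nat_less_iff of_nat_mult of_nat_numeral)
  let ?S = "nb x" and ?T = "nb y"
  have dS: "2 * real (card ?S) + 1 \<ge> n" and dT: "2 * real (card ?T) + 1 \<ge> n"
    using xy by (auto simp: low_def not_less simp flip: of_nat_Suc of_nat_mult of_nat_le_iff)
  have bd: "p < n" if "p \<in> nb v" for p v using that nb_sub by auto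
  have "card (?S \<union> ?T) + card (?S \<inter> ?T) = card ?S + card ?T"
    using card_Un_Int[of ?S ?T] by simp
  then have un: "real (card (?S \<union> ?T)) + real (card (?S \<inter> ?T)) = real (card ?S) + real (card ?T)"
    by (metis of_nat_add)
  have "card ({..<n} - (?S \<union> ?T)) = n - card (?S \<union> ?T)"
    using nb_sub by (subst card_Diff_subset) auto
  moreover have "card (?S \<union> ?T) \<le> n"
    using card_mono[of "{..<n}" "?S \<union> ?T"] nb_sub by auto
  ultimately have out: "real (card ({..<n} - (?S \<union> ?T))) = n - real (card (?S \<union> ?T))"
    by simp
  define S1 where "S1 = {p \<in> ?S. \<sigma> p \<in> ?T}"
  define S2 where "S2 = {p \<in> ?S. \<sigma> p \<in> ?S}"
  define T1 where "T1 = {p \<in> ?T. \<sigma> p \<in> ?S}"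
  define T2 where "T2 = {p \<in> ?T. \<sigma> p \<in> ?T}"
  have fin [simp]: "finite S1" "finite S2" "finite T1" "finite T2"
    by (simp_all add: S1_def S2_def T1_def T2_def)
  \<comment> \<open>As \<open>\<sigma>\<close> is an involution, the vertices that it sends outside
    \<open>?S \<union> ?T\<close> are images of that complement, so there are at most as many of
    them.\<close>
  have cover: "card R \<le> card R1 + card R2 + card ({..<n} - (?S \<union> ?T))"
    if "R = ?S \<and> R1 = S1 \<and> R2 = S2 \<or> R = ?T \<and> R1 = T1 \<and> R2 = T2" for R R1 R2
  proof -
    have "R \<subseteq> R1 \<union> R2 \<union> \<sigma> ` ({..<n} - (?S \<union> ?T))"
    proof
      fix p assume p: "p \<in> R"
      then have "p < n" using that bd by auto
      then show "p \<in> R1 \<union> R2 \<union> \<sigma> ` ({..<n} - (?S \<union> ?T))"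
        using that p \<sigma>_lt[of p] \<sigma>\<sigma>[of p]
        by (auto simp: S1_def S2_def T1_def T2_def intro!: image_eqI[of p \<sigma> "\<sigma> p"])
    qed
    moreover have "finite R1" "finite R2" using that by auto
    ultimately have "card R \<le> card (R1 \<union> R2 \<union> \<sigma> ` ({..<n} - (?S \<union> ?T)))"
      by (intro card_mono) auto
    also have "\<dots> \<le> card R1 + card R2 + card (\<sigma> ` ({..<n} - (?S \<union> ?T)))"
      by (meson add_mono card_Un_le order_refl order_trans)
    also have "\<dots> \<le> card R1 + card R2 + card ({..<n} - (?S \<union> ?T))"
      by (simp add: card_image_le)
    finally show ?thesis .
  qed
  have cS: "real (card ?S) \<le> real (card S1) + real (card S2) + real (card ({..<n} - (?S \<union> ?T)))"
    using cover[of ?S S1 S2] by (simp flip: of_nat_add)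
  have cT: "real (card ?T) \<le> real (card T1) + real (card T2) + real (card ({..<n} - (?S \<union> ?T)))"
    using cover[of ?T T1 T2] by (simp flip: of_nat_add)
  have ST1: "card S1 = card T1"
    by (rule bij_betw_same_card[of \<sigma>], rule bij_betw_byWitness[of _ \<sigma>])
       (auto simp: S1_def T1_def \<sigma>\<sigma> bd)
  have finW: "finite W"
    unfolding W_def by (rule finite_subset[of _ "?S \<times> ?T"]) auto
  \<comment> \<open>Each element of \<open>Z\<close> is charged to itself or to its image under the
    injective \<open>h\<close>, so an element of \<open>W\<close> is charged at most twice.\<close>
  have half: "card Z \<le> 2 * card W"
    if "finite Z" "\<And>e. e \<in> Z \<Longrightarrow> e \<in> W \<or> h e \<in> W" "inj_on h Z" for Z and h :: "nat \<times> nat \<Rightarrow> nat \<times> nat"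
  proof -
    have "Z \<subseteq> W \<union> {e \<in> Z. h e \<in> W}" using that by auto
    then have "card Z \<le> card (W \<union> {e \<in> Z. h e \<in> W})"
      using finW that(1) by (intro card_mono) auto
    also have "\<dots> \<le> card W + card {e \<in> Z. h e \<in> W}" by (rule card_Un_le)
    also have "card {e \<in> Z. h e \<in> W} = card (h ` {e \<in> Z. h e \<in> W})"
      using that(3) by (intro card_image[symmetric]) (auto elim: inj_on_subset)
    also have "\<dots> \<le> card W" using finW by (intro card_mono) auto
    finally show ?thesis by simp
  qed
  \<comment> \<open>\<open>meet\<close> speaks of distinct vertices; the diagonal pairs that it
    omits come from \<open>?S \<inter> ?T\<close>.\<close>
  have diag: "card A * card B \<le> card {(p, q). p \<in> A \<and> q \<in> B \<and> p \<noteq> q} + card (?S \<inter> ?T)"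
    if "A \<subseteq> ?S" "B \<subseteq> ?T" for A B
  proof -
    have f: "finite A" "finite B" using that by (auto intro: finite_subset)
    have "A \<times> B \<subseteq> {(p, q). p \<in> A \<and> q \<in> B \<and> p \<noteq> q} \<union> (\<lambda>p. (p, p)) ` (?S \<inter> ?T)"
      using that by auto
    moreover have fD: "finite {(p, q). p \<in> A \<and> q \<in> B \<and> p \<noteq> q}"
      using f by (auto intro: finite_subset[of _ "A \<times> B"])
    ultimately have "card (A \<times> B) \<le> card ({(p, q). p \<in> A \<and> q \<in> B \<and> p \<noteq> q} \<union> (\<lambda>p. (p, p)) ` (?S \<inter> ?T))"
      by (intro card_mono) auto
    also have "\<dots> \<le> card {(p, q). p \<in> A \<and> q \<in> B \<and> p \<noteq> q} + card ((\<lambda>p. (p, p)) ` (?S \<inter> ?T))"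
      by (rule card_Un_le)
    also have "\<dots> \<le> card {(p, q). p \<in> A \<and> q \<in> B \<and> p \<noteq> q} + card (?S \<inter> ?T)"
      by (intro add_left_mono card_image_le) auto
    finally show ?thesis by (simp add: card_cartesian_product)
  qed
  let ?X = "{(p, q). p \<in> S2 \<and> q \<in> T2 \<and> p \<noteq> q}" and ?Y = "{(p, q). p \<in> S1 \<and> q \<in> T1 \<and> p \<noteq> q}"
  have X: "card ?X \<le> 2 * card W"
  proof (rule half[of _ "\<lambda>(p, q). (\<sigma> p, \<sigma> q)"])
    show "finite ?X" by (rule finite_subset[of _ "S2 \<times> T2"]) auto
    show "e \<in> W \<or> (\<lambda>(p, q). (\<sigma> p, \<sigma> q)) e \<in> W" if "e \<in> ?X" for e
      using that meet[of "fst e" "snd e"] bd by (auto simp: W_def S2_def T2_def)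
    show "inj_on (\<lambda>(p, q). (\<sigma> p, \<sigma> q)) ?X"
      by (auto simp: inj_on_def S2_def T2_def \<sigma>_inj bd)
  qed
  \<comment> \<open>Here \<open>\<sigma>\<close> exchanges the two neighbourhoods, so the
    coordinates must be exchanged as well to land in \<open>W\<close>.\<close>
  have Y: "card ?Y \<le> 2 * card W"
  proof (rule half[of _ "\<lambda>(p, q). (\<sigma> q, \<sigma> p)"])
    show "finite ?Y" by (rule finite_subset[of _ "S1 \<times> T1"]) auto
    show "e \<in> W \<or> (\<lambda>(p, q). (\<sigma> q, \<sigma> p)) e \<in> W" if "e \<in> ?Y" for e
      using that meet[of "fst e" "snd e"] bd sym by (auto simp: W_def S1_def T1_def)
    show "inj_on (\<lambda>(p, q). (\<sigma> q, \<sigma> p)) ?Y"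
      by (auto simp: inj_on_def S1_def T1_def \<sigma>_inj bd)
  qed
  \<comment> \<open>The product gives \<open>9 * n ^ 2 / 256 \<le> 2 * card W + n / 16\<close>; for
    \<open>n \<ge> 1000\<close> the linear term is small enough to leave
    \<open>card W \<ge> n ^ 2 / 64\<close>.\<close>
  have key: "real (n ^ 2) \<le> 64 * real (card W)"
    if "3 * real n / 16 \<le> real (card A)" "3 * real n / 16 \<le> real (card B)" "A \<subseteq> ?S" "B \<subseteq> ?T"
      "card {(p, q). p \<in> A \<and> q \<in> B \<and> p \<noteq> q} \<le> 2 * card W" for A B
  proof -
    have "(3 * real n / 16) * (3 * real n / 16) \<le> real (card A) * real (card B)"
      using that by (intro mult_mono) auto
    also have "\<dots> \<le> 2 * real (card W) + real (card (?S \<inter> ?T))"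
    proof -
      have "card A * card B \<le> 2 * card W + card (?S \<inter> ?T)"
        using diag[OF that(3,4)] that(5) by simp
      then have "real (card A * card B) \<le> real (2 * card W + card (?S \<inter> ?T))"
        by (rule of_nat_mono)
      then show ?thesis by simp
    qed
    also have "\<dots> \<le> 2 * real (card W) + real n / 16" using small by simp
    finally have "9 * (real n * real n) / 256 \<le> 2 * real (card W) + real n / 16" by simp
    moreover have "1000 * real n \<le> real n * real n" using n by (intro mult_right_mono) auto
    ultimately show ?thesis by (simp add: power2_eq_square)
  qed
  have "real (n ^ 2) \<le> 64 * real (card W)"
  proof (cases "3 * real n / 16 \<le> real (card S1)")
    case True
    then show ?thesis
      using ST1 Y by (intro key[of S1 T1]) (auto simp: S1_def T1_def)
  next
    case False
    \<comment> \<open>The complement of \<open>?S \<union> ?T\<close> has at most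
      \<open>n/16 + 1\<close> vertices, so \<open>S2\<close> and \<open>T2\<close> each keep at
      least \<open>(n - 1)/2 - 3 * n/16 - n/16 - 1 = n/4 - 3/2\<close> vertices.\<close>
    have "3 * real n / 16 \<le> real (card S2)" "3 * real n / 16 \<le> real (card T2)"
      using False ST1 cS cT out un small dS dT n by linarith+
    then show ?thesis
      using X by (intro key[of S2 T2]) (auto simp: S2_def T2_def)
  qed
  then show "n ^ 2 \<le> 64 * card W"
    by (metis of_nat_le_iff of_nat_mult of_nat_numeral)
qed

text \<open>
  The state of the auction that assigns the low vertices to other vertices: \<open>pr\<close> are the prices,
  \<open>mt v = z + 1\<close> and \<open>own z = v + 1\<close> say that \<open>z\<close> is assigned to \<open>v\<close>, and 0 stands for
  unassigned. The price of the virtual vertex \<open>n\<close> caps the bids.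
\<close>

definition auction_inv :: "(nat \<Rightarrow> nat) \<Rightarrow> (nat \<Rightarrow> nat) \<Rightarrow> (nat \<Rightarrow> nat) \<Rightarrow> bool" where
  "auction_inv pr mt own \<longleftrightarrow>
     (\<forall>v z. mt v = Suc z \<longrightarrow> low v \<and> E v z \<and> \<not> low z \<and> own z = Suc v) \<and>
     (\<forall>z v. own z = Suc v \<longrightarrow> mt v = Suc z) \<and>
     (\<forall>z<n. 0 < pr z \<longrightarrow> own z \<noteq> 0) \<and>
     (\<forall>v z w. mt v = Suc z \<longrightarrow> E v w \<longrightarrow> \<not> low w \<longrightarrow> pr z \<le> Suc (pr w)) \<and>
     (\<forall>z<n. pr z \<le> Suc n) \<and> pr n = Suc n"

lemma auction_invD:
  assumes "auction_inv pr mt own"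
  shows "mt v = Suc z \<Longrightarrow> low v \<and> E v z \<and> \<not> low z \<and> own z = Suc v"
    and "own z = Suc v \<Longrightarrow> mt v = Suc z"
    and "z < n \<Longrightarrow> 0 < pr z \<Longrightarrow> own z \<noteq> 0"
    and "mt v = Suc z \<Longrightarrow> E v w \<Longrightarrow> \<not> low w \<Longrightarrow> pr z \<le> Suc (pr w)"
    and "z < n \<Longrightarrow> pr z \<le> Suc n" and "pr n = Suc n"
  using assms unfolding auction_inv_def by blast+

lemma auction_inv_init: "auction_inv ((\<lambda>_. 0)(n := Suc n)) (\<lambda>_. 0) (\<lambda>_. 0)"
  by (auto simp: auction_inv_def)

text \<open>
  If all prices around an unassigned low vertex \<open>u\<close> were at the cap, then following
  \<open>v \<mapsto> owner of \<sigma> v\<close> from \<open>u\<close>, along which the price of \<open>\<sigma> v\<close> drops by at most one per step,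
  would give \<open>n + 1\<close> distinct vertices.
\<close>

lemma auction_progress:
  assumes inv: "auction_inv pr mt own" and u: "low u" "mt u = 0"
  shows "\<exists>z. E u z \<and> \<not> low z \<and> pr z < Suc n"
proof (rule ccontr)
  assume "\<not> ?thesis"
  then have cap: "Suc n \<le> pr z" if "E u z" "\<not> low z" for z
    using that by (auto simp: not_less)
  define f where "f v = own (\<sigma> v) - 1" for v
  define w where "w k = (f ^^ k) u" for k
  have w_Suc: "w (Suc k) = f (w k)" for k by (simp add: w_def)
  have w: "low (w k) \<and> Suc n - k \<le> pr (\<sigma> (w k))" if "k \<le> n" for k
    using that
  proof (induction k)
    case 0
    then show ?case using u low_\<sigma>[of u] cap by (simp add: w_def)
  next
    case (Suc k)
    then have IH: "low (w k)" "Suc n - k \<le> pr (\<sigma> (w k))" by auto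
    have "\<sigma> (w k) < n" using IH(1) by (simp add: low_def \<sigma>_lt)
    moreover have "0 < pr (\<sigma> (w k))" using IH(2) Suc.prems by simp
    ultimately have "own (\<sigma> (w k)) \<noteq> 0" by (rule auction_invD(3)[OF inv])
    then have "own (\<sigma> (w k)) = Suc (w (Suc k))" by (simp add: w_Suc f_def)
    then have mt: "mt (w (Suc k)) = Suc (\<sigma> (w k))" by (rule auction_invD(2)[OF inv])
    then have low: "low (w (Suc k))" using auction_invD(1)[OF inv] by blast
    then have "pr (\<sigma> (w k)) \<le> Suc (pr (\<sigma> (w (Suc k))))"
      using auction_invD(4)[OF inv mt] low_\<sigma>[of "w (Suc k)"] by blast
    with IH(2) low show ?case by simp
  qed
  have mt_w: "mt (w (Suc k)) = Suc (\<sigma> (w k))" if "k \<le> n" for k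
  proof -
    have "\<sigma> (w k) < n" using w[OF that] by (simp add: low_def \<sigma>_lt)
    moreover have "0 < pr (\<sigma> (w k))" using w[OF that] that by linarith
    ultimately have "own (\<sigma> (w k)) \<noteq> 0" by (rule auction_invD(3)[OF inv])
    then have "own (\<sigma> (w k)) = Suc (w (Suc k))" by (simp add: w_Suc f_def)
    then show ?thesis by (rule auction_invD(2)[OF inv])
  qed
  \<comment> \<open>A repetition can be pulled back along the chain, because \<open>mt\<close> and
    \<open>\<sigma>\<close> determine the predecessor, until it involves \<open>u\<close>. But
    \<open>u\<close> is unassigned, while every later vertex of the chain is assigned.\<close>
  have distinct: "w i \<noteq> w j" if "i < j" "j \<le> n" for i j
    using that
  proof (induction i arbitrary: j)
    case 0
    then obtain k where "j = Suc k" by (cases j) auto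
    with 0 mt_w[of k] u(2) show ?case by (auto simp: w_def)
  next
    case (Suc i)
    then obtain k where j: "j = Suc k" "i < k" by (cases j) auto
    show ?case
    proof
      assume "w (Suc i) = w j"
      then have "\<sigma> (w i) = \<sigma> (w k)" using mt_w[of i] mt_w[of k] j Suc.prems by simp
      then have "w i = w k"
        using w[of i] w[of k] j Suc.prems by (simp add: low_def \<sigma>_inj)
      with Suc.IH[of k] j Suc.prems show False by simp
    qed
  qed
  have "inj_on w {..n}"
    by (rule linorder_inj_onI) (use distinct in auto)
  then have "card (w ` {..n}) = Suc n" by (simp add: card_image)
  moreover have "w ` {..n} \<subseteq> {..<n}" using w by (auto simp: low_def)
  ultimately show False
    using card_mono[of "{..<n}" "w ` {..n}"] by simp
qed

text \<open>Prices only rise, so an assignment that stays in place remains within one of the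
  cheapest offer. The new assignment does as well, because a cheapest price is raised by exactly
  one. The previous owner of \<open>z\<close> becomes unassigned.\<close>

lemma auction_inv_bid:
  assumes inv: "auction_inv pr mt own" and u: "low u" "mt u = 0"
    and z: "E u z" "\<not> low z" "pr z < Suc n"
    and best: "\<And>w. E u w \<Longrightarrow> \<not> low w \<Longrightarrow> pr z \<le> pr w"
  shows "auction_inv (pr(z := Suc (pr z)))
           ((if 0 < own z then mt(own z - 1 := 0) else mt)(u := Suc z)) (own(z := Suc u))"
proof -
  have zn: "z < n" using sym[OF z(1)] bound by blast
  note D = auction_invD[OF inv]
  let ?mt = "(if 0 < own z then mt(own z - 1 := 0) else mt)(u := Suc z)"
  have mt': "?mt v = Suc y \<longleftrightarrow> (if v = u then y = z else mt v = Suc y \<and> y \<noteq> z)" for v y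
  proof (cases "v = u")
    case False
    show ?thesis
    proof (cases "own z")
      case 0
      then show ?thesis using False D(1)[of v z] by auto
    next
      case (Suc x)
      have "mt v = Suc z \<longleftrightarrow> v = x"
        using D(2)[OF Suc] D(1)[of v z] Suc by auto
      then show ?thesis using False Suc by auto
    qed
  qed auto
  show ?thesis
    unfolding auction_inv_def mt'
  proof (intro conjI allI impI)
    fix v y assume a: "if v = u then y = z else mt v = Suc y \<and> y \<noteq> z"
    show "low v" "E v y" "\<not> low y" "(own(z := Suc u)) y = Suc v"
      using a u z D(1)[of v y] by (auto split: if_splits)
    fix w assume w: "E v w" "\<not> low w"
    show "(pr(z := Suc (pr z))) y \<le> Suc ((pr(z := Suc (pr z))) w)"
      using a best[of w] D(4)[OF _ w, of y] w by (auto split: if_splits intro: le_SucI)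
  next
    fix y v assume a: "(own(z := Suc u)) y = Suc v"
    show "if v = u then y = z else mt v = Suc y \<and> y \<noteq> z"
      using a D(2)[of y v] u(2) by (auto split: if_splits)
  next
    fix y assume "y < n" "0 < (pr(z := Suc (pr z))) y"
    then show "(own(z := Suc u)) y \<noteq> 0" using D(3)[of y] by (auto split: if_splits)
  next
    fix y assume "y < n"
    then show "(pr(z := Suc (pr z))) y \<le> Suc n" using D(5)[of y] z(3) by auto
  next
    show "(pr(z := Suc (pr z))) n = Suc n" using D(6) zn by auto
  qed
qed

lemma auction_complete:
  assumes inv: "auction_inv pr mt own" and v: "\<And>v. low v \<Longrightarrow> mt v \<noteq> 0"
  shows "\<exists>\<mu>. (\<forall>v. mt v = (if low v then Suc (\<mu> v) else 0)) \<and>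
              (\<forall>v. low v \<longrightarrow> E v (\<mu> v) \<and> \<not> low (\<mu> v)) \<and> inj_on \<mu> {v. low v}"
proof (intro exI[of _ "\<lambda>v. mt v - 1"] conjI allI impI)
  fix v
  note 1 = auction_invD(1)[OF inv]
  show "mt v = (if low v then Suc (mt v - 1) else 0)"
    using v[of v] 1[of v "mt v - 1"] by (cases "mt v") auto
  show "E v (mt v - 1)" "\<not> low (mt v - 1)" if "low v"
    using v[OF that] 1[of v "mt v - 1"] by auto
  show "inj_on (\<lambda>v. mt v - 1) {v. low v}"
  proof (rule inj_onI)
    fix x y assume "x \<in> {v. low v}" "y \<in> {v. low v}" "mt x - 1 = mt y - 1"
    then show "x = y" using v[of x] v[of y] 1[of x "mt x - 1"] 1[of y "mt y - 1"] by auto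
  qed
qed

end

section \<open>The algorithm\<close>

definition EqT :: "expr \<Rightarrow> expr \<Rightarrow> test" where
  "EqT e1 e2 = Conj (Neg (Less e1 e2)) (Neg (Less e2 e1))"

lemma test_val_EqT [simp]: "test_val (EqT e1 e2) s \<longleftrightarrow> expr_val e1 s = expr_val e2 s"
  by (auto simp: EqT_def)

abbreviation Twice :: "expr \<Rightarrow> expr" where "Twice e \<equiv> Plus e e"

text \<open>Finds the least \<open>b\<close> with \<open>2 ^ b \<ge> 16 * n\<close>. A counting loop
  with an idle branch replaces the obvious \<open>While\<close>, so that the rules for running time
  apply.\<close>

definition bits_prog :: com where
  "bits_prog = Seq (Set ''pw'' (Const 1))
     (FOR ''i'' (Plus (V ''n'') (Const 4))
        (If (Less (V ''pw'') (Twice (Twice (Twice (Twice (V ''n''))))))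
           (Seq (Set ''pw'' (Twice (V ''pw''))) (Set ''b'' (Plus (V ''b'') (Const 1)))) Skip))"

definition deg_prog :: com where
  "deg_prog = FOR ''v'' (V ''n'') (FOR ''z'' (V ''n'')
     (If (Less (Const 0) (Cell ''adj'' (V ''v'') (V ''z'')))
        (Assign ''deg'' (V ''v'') (Const 0) (Plus (Cell ''deg'' (V ''v'') (Const 0)) (Const 1))) Skip))"

definition low_test :: "string \<Rightarrow> test" where
  "low_test x = Less (Plus (Twice (Cell ''deg'' (V x) (Const 0))) (Const 1)) (V ''n'')"

text \<open>The search starts at the virtual vertex \<open>n\<close>, whose price is the cap; as the
  comparison is strict, \<open>best = n\<close> at the end means that no high neighbour is below the
  cap.\<close>

definition best_prog :: com where
  "best_prog = Seq (Set ''best'' (V ''n'')) (FOR ''z'' (V ''n'')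
     (If (Conj (Less (Const 0) (Cell ''adj'' (V ''v'') (V ''z'')))
           (Conj (Neg (low_test ''z''))
              (Less (Cell ''pr'' (V ''z'') (Const 0)) (Cell ''pr'' (V ''best'') (Const 0)))))
        (Set ''best'' (V ''z'')) Skip))"

definition bid_prog :: com where
  "bid_prog = If (Less (V ''best'') (V ''n''))
     (Seq (If (Less (Const 0) (Cell ''own'' (V ''best'') (Const 0)))
             (Assign ''mt'' (Minus (Cell ''own'' (V ''best'') (Const 0)) (Const 1)) (Const 0) (Const 0)) Skip)
     (Seq (Assign ''own'' (V ''best'') (Const 0) (Plus (V ''v'') (Const 1)))
     (Seq (Assign ''mt'' (V ''v'') (Const 0) (Plus (V ''best'') (Const 1)))
        (Assign ''pr'' (V ''best'') (Const 0) (Plus (Cell ''pr'' (V ''best'') (Const 0)) (Const 1))))))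
     Skip"

definition pass_prog :: com where
  "pass_prog = FOR ''v'' (V ''n'')
     (If (Conj (low_test ''v'') (Less (Cell ''mt'' (V ''v'') (Const 0)) (Const 1)))
        (Seq best_prog bid_prog) Skip)"

definition auction_prog :: com where
  "auction_prog = Seq (Assign ''pr'' (V ''n'') (Const 0) (Plus (V ''n'') (Const 1)))
     (FOR ''i'' (V ''n'') (FOR ''j'' (Plus (V ''n'') (Const 2)) pass_prog))"

text \<open>The conjunction of \<open>e\<close> fair flips: a coin with bias \<open>2 ^ - e\<close>,
  the only kind of small probability that fair coins give directly.\<close>

definition coin_prog :: "expr \<Rightarrow> com" where
  "coin_prog e = Seq (Set ''coin'' (Const 1))
     (FOR ''j'' e (Seq (Flip ''c'') (If (Less (V ''c'') (Const 1)) (Set ''coin'' (Const 0)) Skip)))"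

definition out_row :: "nat \<Rightarrow> expr" where
  "out_row d = Plus (V ''rounds'') (Const d)"

definition join_prog :: "test \<Rightarrow> nat \<Rightarrow> com" where
  "join_prog b d = If (Conj (Conj (Less (Const 0) (V ''coin'')) b)
       (Conj (EqT (Cell ''out'' (out_row d) (V ''v'')) (V ''v'')) (EqT (Cell ''out'' (out_row d) (V ''z'')) (V ''z''))))
     (Seq (Assign ''out'' (out_row d) (V ''v'') (V ''z'')) (Assign ''out'' (out_row d) (V ''z'') (V ''v''))) Skip"

text \<open>Each ordered pair gets its own coin, even if it cannot be joined, so the tosses do not
  depend on the matching built so far. An edge of a symmetric relation is offered twice.\<close>

definition greedy_prog :: "expr \<Rightarrow> test \<Rightarrow> nat \<Rightarrow> com" where
  "greedy_prog e b d = FOR ''v'' (V ''n'') (FOR ''z'' (V ''n'') (Seq (coin_prog e) (join_prog b d)))"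

definition trial_prog :: com where
  "trial_prog =
     Seq (FOR ''v'' (V ''n'') (Seq (Assign ''out'' (out_row 0) (V ''v'') (V ''v'')) (Assign ''out'' (out_row 1) (V ''v'') (V ''v''))))
    (Seq (greedy_prog (Const 1) (EqT (Cell ''mt'' (V ''v'') (Const 0)) (Plus (V ''z'') (Const 1))) 0)
    (Seq (greedy_prog (V ''b'') (Less (Const 0) (Cell ''adj'' (V ''v'') (V ''z''))) 1)
    (Seq (FOR ''v'' (V ''n'')
            (Seq (Assign ''out'' (out_row 2) (V ''v'') (Cell ''out'' (out_row 1) (V ''v'')))
                 (Assign ''out'' (out_row 3) (V ''v'') (Cell ''out'' (out_row 0) (V ''v'')))))
       (Set ''rounds'' (out_row 4)))))"

text \<open>
  A trial acquaints a given pair with probability at least \<open>2^-19\<close>, so \<open>3 * 2^19 * log n\<close> trials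
  all fail with probability at most \<open>n^-3\<close>.
\<close>

definition trials :: nat where "trials = 3 * 2 ^ 19"

text \<open>Two nested loops perform \<open>b * trials\<close> trials, as the machine cannot
  multiply.\<close>

definition prog :: com where
  "prog = Seq bits_prog (Seq deg_prog (Seq auction_prog
     (FOR ''t'' (V ''b'') (FOR ''u'' (Const trials) trial_prog))))"

section \<open>Correctness of the preprocessing: number of flips, degrees and auction\<close>

lemma tr_bits:
  "tr (\<lambda>s. s ''n'' 0 0 = n \<and> s ''b'' 0 0 = 0) bits_prog 1
     (\<lambda>s. s ''n'' 0 0 = n \<and> s ''b'' 0 0 \<le> n + 4 \<and> 16 * n \<le> 2 ^ s ''b'' 0 0 \<and>
        (0 < n \<longrightarrow> 2 ^ s ''b'' 0 0 < 32 * n))"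
proof -
  let ?I = "\<lambda>k s. s ''n'' 0 0 = n \<and> s ''pw'' 0 0 = 2 ^ s ''b'' 0 0 \<and> s ''b'' 0 0 \<le> k \<and>
      (16 * n \<le> 2 ^ s ''b'' 0 0 \<or> s ''b'' 0 0 = k) \<and> (0 < n \<longrightarrow> 2 ^ s ''b'' 0 0 < 32 * n)"
  have 1: "tr (\<lambda>s. s ''n'' 0 0 = n \<and> s ''b'' 0 0 = 0) (Set ''pw'' (Const 1)) 1 (?I 0)"
    by (intro trI) (auto simp: update_simps)
  have 2: "tr (?I 0) (FOR ''i'' (Plus (V ''n'') (Const 4))
        (If (Less (V ''pw'') (Twice (Twice (Twice (Twice (V ''n''))))))
           (Seq (Set ''pw'' (Twice (V ''pw''))) (Set ''b'' (Plus (V ''b'') (Const 1)))) Skip)) 1 (?I (n + 4))"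
  proof (rule tr_FOR1[where I = ?I and m = "n + 4"])
    show "tr (\<lambda>s. ?I k s \<and> s ''i'' 0 0 = k) (If (Less (V ''pw'') (Twice (Twice (Twice (Twice (V ''n''))))))
           (Seq (Set ''pw'' (Twice (V ''pw''))) (Set ''b'' (Plus (V ''b'') (Const 1)))) Skip) 1 (?I (Suc k))"
      if "k < n + 4" for k
      by (intro trI) (auto simp: update_simps)
  qed (auto simp: update_simps)
  \<comment> \<open>If all \<open>n + 4\<close> iterations doubled \<open>pw\<close>, then it has
    reached \<open>2 ^ (n + 4)\<close>, which is at least \<open>16 * n\<close>.\<close>
  have "n < 2 ^ n" by (rule less_exp)
  then have "16 * n \<le> 2 ^ (n + 4)" by (simp add: power_add)
  then show ?thesis
    unfolding bits_prog_def by (intro tr_conseq[OF tr_Seq1[OF 1 2]]) auto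
qed

context one_round
begin

definition base :: "state \<Rightarrow> bool" where
  "base s \<longleftrightarrow> s ''n'' 0 0 = n \<and> (\<forall>u v. s ''adj'' u v = of_bool (E u v))"

lemma base_update [simp]:
  "x \<noteq> ''n'' \<Longrightarrow> x \<noteq> ''adj'' \<Longrightarrow> base (update s x i j k) = base s"
  by (simp add: base_def update_simps)

lemma bound2: "E u v \<Longrightarrow> v < n"
  using sym bound by blast

lemma nb_eq: "nb v = {u. u < n \<and> E v u}"
  using sym bound by (auto simp: nb_def)

definition deg_ok :: "state \<Rightarrow> bool" where
  "deg_ok s \<longleftrightarrow> (\<forall>v<n. s ''deg'' v 0 = card (nb v))"

lemma deg_ok_update [simp]: "x \<noteq> ''deg'' \<Longrightarrow> deg_ok (update s x i j k) = deg_ok s"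
  by (simp add: deg_ok_def update_simps)

lemma tr_deg: "tr (\<lambda>s. base s \<and> s ''deg'' = (\<lambda>_ _. 0)) deg_prog 1 (\<lambda>s. base s \<and> deg_ok s)"
proof -
  let ?c = "\<lambda>k j. card {u. u < j \<and> E k u}"
  let ?I = "\<lambda>k s. base s \<and> (\<forall>v. s ''deg'' v 0 = (if v < k then ?c v n else 0))"
  let ?J = "\<lambda>k j s. base s \<and> s ''v'' 0 0 = k \<and>
      (\<forall>v. s ''deg'' v 0 = (if v < k then ?c v n else if v = k then ?c v j else 0))"
  have c_Suc: "?c k (Suc j) = ?c k j + of_bool (E k j)" for k j
  proof -
    have "{u. u < Suc j \<and> E k u} = (if E k j then insert j {u. u < j \<and> E k u} else {u. u < j \<and> E k u})"
      by (auto simp: less_Suc_eq)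
    then show ?thesis by simp
  qed
  let ?b = "If (Less (Const 0) (Cell ''adj'' (V ''v'') (V ''z'')))
        (Assign ''deg'' (V ''v'') (Const 0) (Plus (Cell ''deg'' (V ''v'') (Const 0)) (Const 1))) Skip"
  have in_loop: "tr (?J k 0) (FOR ''z'' (V ''n'') ?b) 1 (?J k n)" for k
  proof (rule tr_FOR1[where I = "?J k" and m = n])
    show "tr (\<lambda>s. ?J k j s \<and> s ''z'' 0 0 = j) ?b 1 (?J k (Suc j))" for j
    proof (rule trI)
      fix s assume s: "?J k j s \<and> s ''z'' 0 0 = j"
      then have "s ''adj'' k j = of_bool (E k j)" by (simp add: base_def)
      with s show "ennreal 1 \<le> wp ?b (\<lambda>s'. of_bool (?J k (Suc j) s')) s"
        by (auto simp: update_simps c_Suc)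
    qed
  qed (auto simp: update_simps base_def)
  have "tr (?I 0) deg_prog 1 (?I n)"
    unfolding deg_prog_def
  proof (rule tr_FOR1[where I = ?I and m = n])
    show "tr (\<lambda>s. ?I k s \<and> s ''v'' 0 0 = k) (FOR ''z'' (V ''n'') ?b) 1 (?I (Suc k))" for k
      by (rule tr_conseq[OF in_loop[of k]]) (auto simp: less_Suc_eq)
  qed (auto simp: update_simps base_def)
  then show ?thesis
    by (rule tr_conseq) (auto simp: nb_eq deg_ok_def)
qed

lemma low_test:
  assumes "base s" "deg_ok s" "s x 0 0 < n"
  shows "test_val (low_test x) s \<longleftrightarrow> low (s x 0 0)"
  using assms by (simp add: low_test_def low_def base_def deg_ok_def mult_2)

text \<open>Column 0 of a two-dimensional array serves as a vector; an assignment becomes a function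
  update of it, the form used by \<open>auction_inv_bid\<close>.\<close>

lemma column_update [simp]: "(\<lambda>z. (f(i := (f i)(0 := k))) z 0) = (\<lambda>z. f z (0::nat))(i := k)"
  by auto

definition auct :: "state \<Rightarrow> bool" where
  "auct s \<longleftrightarrow> base s \<and> deg_ok s \<and>
     auction_inv (\<lambda>z. s ''pr'' z 0) (\<lambda>v. s ''mt'' v 0) (\<lambda>z. s ''own'' z 0)"

lemma auct_update [simp]:
  "x \<notin> {''n'', ''adj'', ''deg'', ''pr'', ''mt'', ''own''} \<Longrightarrow> auct (update s x i j k) = auct s"
  by (simp add: auct_def update_simps)

lemma auct_n: "auct s \<Longrightarrow> s ''n'' 0 0 = n"
  by (simp add: auct_def base_def)

text \<open>The potential function of the auction.\<close>

definition prices :: "state \<Rightarrow> nat" where "prices s = (\<Sum>z<n. s ''pr'' z 0)"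

lemma prices_update [simp]: "x \<noteq> ''pr'' \<Longrightarrow> prices (update s x i j k) = prices s"
  by (simp add: prices_def update_simps)

lemma tr_best:
  shows "tr (\<lambda>s. auct s \<and> s ''v'' 0 0 = v) best_prog 1
     (\<lambda>s. (auct s \<and> s ''v'' 0 0 = v) \<and>
       (let m = s ''best'' 0 0 in (m = n \<or> E v m \<and> \<not> low m) \<and> s ''pr'' m 0 \<le> Suc n \<and>
          (m \<noteq> n \<longrightarrow> s ''pr'' m 0 < Suc n) \<and> (\<forall>w<n. E v w \<longrightarrow> \<not> low w \<longrightarrow> s ''pr'' m 0 \<le> s ''pr'' w 0)))"
proof -
  let ?P = "\<lambda>s. auct s \<and> s ''v'' 0 0 = v"
  let ?I = "\<lambda>k s. ?P s \<and>
       (let m = s ''best'' 0 0 in (m = n \<or> E v m \<and> \<not> low m) \<and> s ''pr'' m 0 \<le> Suc n \<and>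
          (m \<noteq> n \<longrightarrow> s ''pr'' m 0 < Suc n) \<and> (\<forall>w<k. E v w \<longrightarrow> \<not> low w \<longrightarrow> s ''pr'' m 0 \<le> s ''pr'' w 0))"
  have 1: "tr ?P (Set ''best'' (V ''n'')) 1 (?I 0)"
  proof (rule trI)
    fix s assume s: "?P s"
    then have "s ''n'' 0 0 = n" "s ''pr'' n 0 = Suc n"
      using auction_invD(6) by (auto simp: auct_def base_def)
    with s show "ennreal 1 \<le> wp (Set ''best'' (V ''n'')) (\<lambda>s'. of_bool (?I 0 s')) s"
      by (simp add: update_simps Let_def)
  qed
  have 2: "tr (?I 0) (FOR ''z'' (V ''n'')
     (If (Conj (Less (Const 0) (Cell ''adj'' (V ''v'') (V ''z'')))
           (Conj (Neg (low_test ''z''))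
              (Less (Cell ''pr'' (V ''z'') (Const 0)) (Cell ''pr'' (V ''best'') (Const 0)))))
        (Set ''best'' (V ''z'')) Skip)) 1 (?I n)" (is "tr _ (FOR _ _ ?c) _ _")
  proof (rule tr_FOR1[where I = ?I and m = n])
    show "expr_val (V ''n'') s = n" if "?I k s" for k s
      using that by (simp add: auct_def base_def)
    show "tr (\<lambda>s. ?I k s \<and> s ''z'' 0 0 = k) ?c 1 (?I (Suc k))" if "k < n" for k
    proof (rule trI)
      fix s assume s: "?I k s \<and> s ''z'' 0 0 = k"
      then have "base s" "deg_ok s" by (auto simp: auct_def)
      then have l: "test_val (low_test ''z'') s \<longleftrightarrow> low k"
        using low_test[of s "''z''"] s that by simp
      have a: "s ''adj'' v k = of_bool (E v k)" using \<open>base s\<close> by (simp add: base_def)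
      let ?m = "s ''best'' 0 0"
      show "ennreal 1 \<le> wp ?c (\<lambda>s'. of_bool (?I (Suc k) s')) s"
      proof (cases "E v k \<and> \<not> low k \<and> s ''pr'' k 0 < s ''pr'' ?m 0")
        case True
        have "s ''pr'' k 0 \<le> s ''pr'' w 0" if "w < Suc k" "E v w" "\<not> low w" for w
        proof (cases "w = k")
          case False
          then have "s ''pr'' ?m 0 \<le> s ''pr'' w 0" using that s by (auto simp: Let_def)
          with True show ?thesis by simp
        qed simp
        moreover have "s ''pr'' k 0 < Suc n" using True s by (auto simp: Let_def)
        ultimately show ?thesis
          using True s a l by (simp add: update_simps Let_def)
      next
        case False
        then have "?I (Suc k) s"
          using s by (auto simp: Let_def less_Suc_eq)
        then show ?thesis
          using False s a l by (auto simp: Let_def)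
      qed
    qed
  qed (auto simp: update_simps Let_def)
  show ?thesis
    unfolding best_prog_def by (rule tr_Seq1[OF 1 2]) simp
qed

text \<open>\<open>auction_progress\<close> rules out \<open>best = n\<close>, so the bid is really
  placed and raises one price.\<close>

lemma tr_bid:
  assumes v: "low v"
  shows "tr (\<lambda>s. (auct s \<and> s ''v'' 0 0 = v) \<and> s ''mt'' v 0 = 0 \<and> prices s = p) (Seq best_prog bid_prog) 1
     (\<lambda>s. auct s \<and> prices s = Suc p)"
proof (rule tr_Seq1)
  show "tr (\<lambda>s. (auct s \<and> s ''v'' 0 0 = v) \<and> s ''mt'' v 0 = 0 \<and> prices s = p) best_prog 1
     (\<lambda>s. ((auct s \<and> s ''v'' 0 0 = v) \<and>
       (let m = s ''best'' 0 0 in (m = n \<or> E v m \<and> \<not> low m) \<and> s ''pr'' m 0 \<le> Suc n \<and>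
          (m \<noteq> n \<longrightarrow> s ''pr'' m 0 < Suc n) \<and> (\<forall>w<n. E v w \<longrightarrow> \<not> low w \<longrightarrow> s ''pr'' m 0 \<le> s ''pr'' w 0)))
        \<and> s ''mt'' v 0 = 0 \<and> prices s = p)" (is "tr _ _ _ ?R")
    by (rule tr_frame[OF tr_best]) (simp add: best_prog_def prices_def)
  show "tr ?R bid_prog 1 (\<lambda>s. auct s \<and> prices s = Suc p)"
  proof (rule trI)
    fix s assume s: "?R s"
    define m where "m = s ''best'' 0 0"
    from s have inv: "auction_inv (\<lambda>z. s ''pr'' z 0) (\<lambda>v. s ''mt'' v 0) (\<lambda>z. s ''own'' z 0)"
      and mt: "s ''mt'' v 0 = 0" and b: "base s" "deg_ok s" and sv: "s ''v'' 0 0 = v"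
      by (auto simp: auct_def)
    from auction_progress[OF inv v mt] obtain z where z: "E v z" "\<not> low z" "s ''pr'' z 0 < Suc n"
      by auto
    then have "z < n" using bound2 by blast
    then have "s ''pr'' m 0 \<le> s ''pr'' z 0" using s z by (auto simp: Let_def m_def)
    then have "m \<noteq> n" using z(3) auction_invD(6)[OF inv] by auto
    then have m: "E v m" "\<not> low m" "s ''pr'' m 0 < Suc n" using s by (auto simp: Let_def m_def)
    then have "m < n" using bound2 by blast
    have best: "s ''pr'' m 0 \<le> s ''pr'' w 0" if "E v w" "\<not> low w" for w
      using that s bound2[OF that(1)] by (simp add: Let_def m_def)
    have "auction_inv ((\<lambda>z. s ''pr'' z 0)(m := Suc (s ''pr'' m 0)))
           ((if 0 < s ''own'' m 0 then (\<lambda>v. s ''mt'' v 0)(s ''own'' m 0 - 1 := 0) else (\<lambda>v. s ''mt'' v 0))(v := Suc m))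
           ((\<lambda>z. s ''own'' z 0)(m := Suc v))"
      using best by (intro auction_inv_bid inv v mt m)
    moreover have "(\<Sum>z<n. ((s ''pr'')(m := (s ''pr'' m)(0 := Suc (s ''pr'' m 0)))) z 0) = Suc (\<Sum>z<n. s ''pr'' z 0)"
    proof -
      have f: "finite {..<n}" "m \<in> {..<n}" using \<open>m < n\<close> by auto
      show ?thesis
        by (subst (1 2) sum.remove[OF f]) (auto intro!: sum.cong)
    qed
    ultimately show "ennreal 1 \<le> wp bid_prog (\<lambda>s. of_bool (auct s \<and> prices s = Suc p)) s"
      using b sv s \<open>m < n\<close>
      by (auto simp: bid_prog_def update_simps auct_def prices_def m_def[symmetric] base_def deg_ok_def
          simp del: fun_upd_apply split: if_splits)
  qed
qed simp

definition all_assigned :: "state \<Rightarrow> bool" where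
  "all_assigned s \<longleftrightarrow> (\<forall>v. low v \<longrightarrow> s ''mt'' v 0 \<noteq> 0)"

lemma all_assigned_update [simp]: "x \<noteq> ''mt'' \<Longrightarrow> all_assigned (update s x i j k) = all_assigned s"
  by (simp add: all_assigned_def update_simps)

text \<open>If nobody bids during the pass, the assignment does not change and every low vertex has
  been seen assigned; otherwise some bid has raised the sum of the prices, which never
  falls.\<close>

lemma tr_pass:
  "tr (\<lambda>s. auct s \<and> (all_assigned s \<or> p \<le> prices s)) pass_prog 1
      (\<lambda>s. auct s \<and> (all_assigned s \<or> Suc p \<le> prices s))"
proof -
  let ?I = "\<lambda>k s. auct s \<and> (all_assigned s \<or> Suc p \<le> prices s \<or>
      p \<le> prices s \<and> (\<forall>u<k. low u \<longrightarrow> s ''mt'' u 0 \<noteq> 0))"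
  let ?c = "If (Conj (low_test ''v'') (Less (Cell ''mt'' (V ''v'') (Const 0)) (Const 1)))
        (Seq best_prog bid_prog) Skip"
  have "tr (?I 0) pass_prog 1 (?I n)"
    unfolding pass_prog_def
  proof (rule tr_FOR1[where I = ?I and m = n])
    show "tr (\<lambda>s. ?I k s \<and> s ''v'' 0 0 = k) ?c 1 (?I (Suc k))" if "k < n" for k
    proof (rule trI)
      fix s assume s: "?I k s \<and> s ''v'' 0 0 = k"
      then have l: "test_val (low_test ''v'') s \<longleftrightarrow> low k"
        using low_test[of s "''v''"] that by (simp add: auct_def)
      show "ennreal 1 \<le> wp ?c (\<lambda>s'. of_bool (?I (Suc k) s')) s"
      proof (cases "low k \<and> s ''mt'' k 0 = 0")
        case True
        then have "p \<le> prices s" using s by (auto simp: all_assigned_def)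
        have "ennreal 1 \<le> wp (Seq best_prog bid_prog) (\<lambda>s'. of_bool (auct s' \<and> prices s' = Suc (prices s))) s"
          by (rule trD[OF tr_bid[of k]]) (use True s in auto)
        also have "\<dots> \<le> wp (Seq best_prog bid_prog) (\<lambda>s'. of_bool (?I (Suc k) s')) s"
          using \<open>p \<le> prices s\<close> by (intro wp_mono) (auto simp: of_bool_def)
        finally show ?thesis using True s l by simp
      next
        case False
        then have "?I (Suc k) s" using s by (auto simp: less_Suc_eq)
        then show ?thesis using False s l by auto
      qed
    qed
  qed (auto simp: update_simps auct_n best_prog_def bid_prog_def)
  then show ?thesis
    by (rule tr_conseq) (auto simp: all_assigned_def low_def)
qed

lemma tr_auction:
  assumes "0 < n"
  shows "tr (\<lambda>s. base s \<and> deg_ok s \<and> s ''pr'' = (\<lambda>_ _. 0) \<and> s ''mt'' = (\<lambda>_ _. 0) \<and> s ''own'' = (\<lambda>_ _. 0))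
     auction_prog 1 (\<lambda>s. auct s \<and> all_assigned s)"
proof -
  let ?I = "\<lambda>k s. auct s \<and> (all_assigned s \<or> k * (n + 2) \<le> prices s)"
  let ?J = "\<lambda>k j s. auct s \<and> (all_assigned s \<or> k * (n + 2) + j \<le> prices s)"
  have 1: "tr (\<lambda>s. base s \<and> deg_ok s \<and> s ''pr'' = (\<lambda>_ _. 0) \<and> s ''mt'' = (\<lambda>_ _. 0) \<and> s ''own'' = (\<lambda>_ _. 0))
     (Assign ''pr'' (V ''n'') (Const 0) (Plus (V ''n'') (Const 1))) 1 (?I 0)"
  proof (rule trI)
    fix s assume s: "base s \<and> deg_ok s \<and> s ''pr'' = (\<lambda>_ _. 0) \<and> s ''mt'' = (\<lambda>_ _. 0) \<and> s ''own'' = (\<lambda>_ _. 0)"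
    then have "s ''n'' 0 0 = n" by (simp add: base_def)
    moreover have "(\<lambda>z. (((\<lambda>_ _. 0)(n := (\<lambda>_. 0)(0 := Suc n))) z (0::nat))) = (\<lambda>_. 0)(n := Suc n)"
      by auto
    ultimately show "ennreal 1 \<le> wp (Assign ''pr'' (V ''n'') (Const 0) (Plus (V ''n'') (Const 1))) (\<lambda>s'. of_bool (?I 0 s')) s"
      using s auction_inv_init by (simp add: auct_def update_simps del: fun_upd_apply)
  qed
  have in_loop: "tr (?J k 0) (FOR ''j'' (Plus (V ''n'') (Const 2)) pass_prog) 1 (?J k (n + 2))" for k
  proof (rule tr_FOR1[where I = "?J k" and m = "n + 2"])
    show "tr (\<lambda>s. ?J k j s \<and> s ''j'' 0 0 = j) pass_prog 1 (?J k (Suc j))" for j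
      by (rule tr_conseq[OF tr_pass[of "k * (n + 2) + j"]]) auto
  qed (auto simp: auct_n pass_prog_def best_prog_def bid_prog_def)
  have 2: "tr (?I 0) (FOR ''i'' (V ''n'') (FOR ''j'' (Plus (V ''n'') (Const 2)) pass_prog)) 1 (?I n)"
  proof (rule tr_FOR1[where I = ?I and m = n])
    show "tr (\<lambda>s. ?I k s \<and> s ''i'' 0 0 = k) (FOR ''j'' (Plus (V ''n'') (Const 2)) pass_prog) 1 (?I (Suc k))" for k
      by (rule tr_conseq[OF in_loop[of k]]) auto
  qed (auto simp: auct_n pass_prog_def best_prog_def bid_prog_def)
  \<comment> \<open>All prices are at most \<open>n + 1\<close>, so their sum is at most
    \<open>n * (n + 1)\<close>, less than the number \<open>n * (n + 2)\<close> of passes.\<close>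
  have "all_assigned s" if "?I n s" for s
  proof (rule ccontr)
    assume "\<not> all_assigned s"
    then have "n * (n + 2) \<le> prices s" using that by blast
    also have "prices s \<le> (\<Sum>z<n. Suc n)"
      unfolding prices_def using that by (intro sum_mono) (auto simp: auct_def dest: auction_invD(5))
    finally show False using assms by simp
  qed
  then show ?thesis
    unfolding auction_prog_def by (intro tr_conseq[OF tr_Seq1[OF 1 2]]) auto
qed

end

section \<open>Random greedy matchings\<close>

lemma expr_val_out_row [simp]: "expr_val (out_row d) s = s ''rounds'' 0 0 + d"
  by (simp add: out_row_def)

lemma wr_coin: "wr (coin_prog e) = {''coin'', ''j'', ''c''}"
  by (auto simp: coin_prog_def)

lemma wr_join: "wr (join_prog b d) = {''out''}"
  by (auto simp: join_prog_def)

lemma half_add_ennreal: "inverse (2::ennreal) + inverse 2 = 1"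
  using ennreal_plus[of "1/2" "1/2"] by simp

text \<open>\<open>coin\<close> drops to 0 at the first failing flip and stays there, so the bound
  for 0 is an instance of \<open>tr_FOR_eventually\<close>. The assumption keeps the number of flips
  fixed while the coins are tossed.\<close>

lemma
  assumes e: "\<And>s x k. x \<in> {''coin'', ''j'', ''c''} \<Longrightarrow> expr_val e (update s x 0 0 k) = expr_val e s"
  shows tr_coin_one: "tr (\<lambda>s. expr_val e s = m) (coin_prog e) ((1/2) ^ m) (\<lambda>s. s ''coin'' 0 0 = 1)"
    and tr_coin_zero: "tr (\<lambda>s. expr_val e s = m) (coin_prog e) (1 - (1/2) ^ m) (\<lambda>s. s ''coin'' 0 0 = 0)"
    and tr_coin_any: "tr (\<lambda>s. expr_val e s = m) (coin_prog e) 1 (\<lambda>s. True)"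
proof -
  let ?E = "\<lambda>s. expr_val e s = m"
  let ?b = "Seq (Flip ''c'') (If (Less (V ''c'') (Const 1)) (Set ''coin'' (Const 0)) Skip)"
  have start: "tr ?E (Set ''coin'' (Const 1)) 1 (\<lambda>s. ?E s \<and> s ''coin'' 0 0 = 1)"
    by (rule trI) (simp add: e update_simps)
  have "tr (\<lambda>s. ?E s \<and> s ''coin'' 0 0 = 1) (FOR ''j'' e ?b) (\<Prod>k<m. 1/2) (\<lambda>s. ?E s \<and> s ''coin'' 0 0 = 1)"
    by (rule tr_FOR[where I = "\<lambda>_ s. ?E s \<and> s ''coin'' 0 0 = 1" and m = m])
       (auto simp: e update_simps tr_def wp_Flip divide_ennreal_def)
  then have "tr (\<lambda>s. ?E s \<and> s ''coin'' 0 0 = 1) (FOR ''j'' e ?b) ((1/2) ^ m) (\<lambda>s. ?E s \<and> s ''coin'' 0 0 = 1)"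
    by simp
  then have "tr ?E (coin_prog e) ((1/2) ^ m) (\<lambda>s. ?E s \<and> s ''coin'' 0 0 = 1)"
    unfolding coin_prog_def by (rule tr_Seq1[OF start]) simp
  then show "tr ?E (coin_prog e) ((1/2) ^ m) (\<lambda>s. s ''coin'' 0 0 = 1)"
    by (rule tr_conseq) auto
  have "tr ?E (FOR ''j'' e ?b) (1 - (1 - 1/2) ^ m) (\<lambda>s. ?E s \<and> s ''coin'' 0 0 = 0)"
    by (rule tr_FOR_eventually[where J = "\<lambda>_ s. ?E s" and S = "\<lambda>s. s ''coin'' 0 0 = 0" and m = m])
       (auto simp: e update_simps tr_def wp_Flip divide_ennreal_def half_add_ennreal)
  then have "tr (\<lambda>s. ?E s \<and> s ''coin'' 0 0 = 1) (FOR ''j'' e ?b) (1 - (1/2) ^ m) (\<lambda>s. s ''coin'' 0 0 = 0)"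
    by (rule tr_conseq) auto
  then show "tr ?E (coin_prog e) (1 - (1/2) ^ m) (\<lambda>s. s ''coin'' 0 0 = 0)"
    unfolding coin_prog_def by (rule tr_Seq1[OF start]) (simp add: power_le_one)
  have "tr ?E (FOR ''j'' e ?b) 1 ?E"
    by (rule tr_FOR1[where I = "\<lambda>_ s. ?E s" and m = m])
       (auto simp: e update_simps tr_def wp_Flip divide_ennreal_def half_add_ennreal)
  then have "tr (\<lambda>s. ?E s \<and> s ''coin'' 0 0 = 1) (FOR ''j'' e ?b) 1 (\<lambda>s. True)"
    by (rule tr_conseq) auto
  then show "tr ?E (coin_prog e) 1 (\<lambda>s. True)"
    unfolding coin_prog_def by (rule tr_Seq1[OF start]) simp
qed

context one_round
begin

text \<open>A matching as an involution that sends a vertex to its partner and fixes unmatched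
  vertices.\<close>

definition mate :: "(nat \<Rightarrow> nat) \<Rightarrow> bool" where
  "mate f \<longleftrightarrow> (\<forall>v<n. f v < n \<and> f (f v) = v \<and> (f v \<noteq> v \<longrightarrow> E v (f v)))"

lemma mate_join:
  assumes "mate f" "E p q" "f p = p" "f q = q"
  shows "mate (f(p := q, q := p))"
proof -
  have "p \<noteq> q" "p < n" "q < n" "E q p" using assms(2) irrefl bound bound2 sym by auto
  moreover have "f v \<noteq> p" "f v \<noteq> q" if "v < n" "v \<noteq> p" "v \<noteq> q" for v
    using assms that by (metis mate_def)+
  ultimately show ?thesis
    using assms unfolding mate_def by auto
qed

text \<open>
  A run of the random greedy matching over the candidate pairs \<open>Rel\<close>, each kept with
  probability \<open>2^-m\<close>. The involution \<open>g\<close> with the candidate pairs \<open>K\<close> describes the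
  wanted matching near the vertices \<open>F\<close>; it is found if all pairs in \<open>K\<close> are kept and no other
  candidate pair that touches \<open>F\<close> is.
\<close>

definition wanted :: "(nat \<Rightarrow> nat) \<Rightarrow> (nat \<times> nat) set \<Rightarrow> nat set \<Rightarrow> (nat \<Rightarrow> nat) \<Rightarrow> bool" where
  "wanted g K F f \<longleftrightarrow> (\<forall>u\<in>F. f u = (if u \<in> fst ` K \<union> snd ` K then g u else u))"

definition touching :: "(nat \<Rightarrow> nat \<Rightarrow> bool) \<Rightarrow> (nat \<times> nat) set \<Rightarrow> nat set \<Rightarrow> (nat \<times> nat) set" where
  "touching Rel K F = {(p, q). p < n \<and> q < n \<and> Rel p q \<and> (p \<in> F \<or> q \<in> F) \<and> (p, q) \<notin> K}"

text \<open>The invariant says that, on \<open>F\<close>, the matching so far is exactly the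
  processed part of \<open>K\<close>. It prescribes the coins of pairs in \<open>K\<close> and of
  pairs touching \<open>F\<close> and leaves all others free, so a product bounds the probability
  although the matching elsewhere depends on its history. \<open>B\<close> is the ambient invariant,
  and \<open>o0\<close> freezes the other rows of \<open>out\<close>.\<close>

lemma tr_greedy:
  assumes e: "\<And>s x k. x \<in> {''coin'', ''j'', ''c''} \<Longrightarrow> expr_val e (update s x 0 0 k) = expr_val e s"
    and B: "\<And>s x i j k. x \<in> {''out'', ''v'', ''z'', ''coin'', ''j'', ''c''} \<Longrightarrow> B s \<Longrightarrow> B (update s x i j k)"
    and Bs: "\<And>s s'. B s \<Longrightarrow> (\<And>x. x \<notin> {''coin'', ''j'', ''c''} \<Longrightarrow> s' x = s x) \<Longrightarrow> B s'"
    and Bv: "\<And>s. B s \<Longrightarrow> expr_val e s = m \<and> s ''n'' 0 0 = n \<and> s ''rounds'' 0 0 + d = r"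
    and b: "\<And>s. B s \<Longrightarrow> s ''v'' 0 0 < n \<Longrightarrow> s ''z'' 0 0 < n \<Longrightarrow> test_val b s \<longleftrightarrow> Rel (s ''v'' 0 0) (s ''z'' 0 0)"
    and Rel: "\<And>p q. Rel p q \<Longrightarrow> E p q"
    and K: "\<And>p q. (p, q) \<in> K \<Longrightarrow> p < n \<and> q < n \<and> Rel p q \<and> p \<in> F \<and> q \<in> F \<and> g p = q \<and> g q = p \<and> (q, p) \<notin> K"
  shows "tr (\<lambda>s. B s \<and> (\<forall>i. i \<noteq> r \<longrightarrow> s ''out'' i = o0 i) \<and> (\<forall>v<n. s ''out'' r v = v))
     (greedy_prog e b d) ((1/2) ^ (m * card K) * (1 - (1/2) ^ m) ^ card (touching Rel K F))
     (\<lambda>s. B s \<and> (\<forall>i. i \<noteq> r \<longrightarrow> s ''out'' i = o0 i) \<and> mate (s ''out'' r) \<and> wanted g K (F \<inter> {..<n}) (s ''out'' r))"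
proof -
  \<comment> \<open>The pairs of \<open>K\<close> that precede \<open>(k, j)\<close> in the order of
    the two loops.\<close>
  define D where "D k j = {(p, q). (p, q) \<in> K \<and> (p < k \<or> p = k \<and> q < j)}" for k j :: nat
  let ?I = "\<lambda>A s. B s \<and> (\<forall>i. i \<noteq> r \<longrightarrow> s ''out'' i = o0 i) \<and> mate (s ''out'' r) \<and>
              wanted g A (F \<inter> {..<n}) (s ''out'' r)"
  \<comment> \<open>The contribution of one pair: its coin must be 1, must be 0, or is free.\<close>
  define pr :: "nat \<Rightarrow> nat \<Rightarrow> real" where
    "pr p q = (if (p, q) \<in> K then (1/2) ^ m else if (p, q) \<in> touching Rel K F then 1 - (1/2) ^ m else 1)" for p q
  have half: "(1/2::real) ^ m \<le> 1" by (simp add: power_le_one)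
  have pr0: "0 \<le> pr p q" for p q using half by (simp add: pr_def)
  have D_Suc: "D k (Suc j) = (if (k, j) \<in> K then insert (k, j) (D k j) else D k j)" for k j
    by (auto simp: D_def less_Suc_eq)
  have coin: "tr (\<lambda>s. ?I A s \<and> s ''v'' 0 0 = k \<and> s ''z'' 0 0 = j) (coin_prog e) q
        (\<lambda>s. (?I A s \<and> s ''v'' 0 0 = k \<and> s ''z'' 0 0 = j) \<and> Q s)"
    if "tr (\<lambda>s. expr_val e s = m) (coin_prog e) q Q" for A k j q Q
  proof -
    have "tr (\<lambda>s. expr_val e s = m \<and> (?I A s \<and> s ''v'' 0 0 = k \<and> s ''z'' 0 0 = j)) (coin_prog e) q
        (\<lambda>s. Q s \<and> (?I A s \<and> s ''v'' 0 0 = k \<and> s ''z'' 0 0 = j))"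
    proof (rule tr_frame[OF that])
      fix s s' assume I: "?I A s \<and> s ''v'' 0 0 = k \<and> s ''z'' 0 0 = j"
        and eq: "\<And>x. x \<notin> wr (coin_prog e) \<Longrightarrow> s' x = s x"
      from eq have "s' ''out'' = s ''out''" "s' ''v'' = s ''v''" "s' ''z'' = s ''z''"
        by (simp_all add: wr_coin)
      moreover have "B s'" using I eq by (intro Bs[of s s']) (auto simp: wr_coin)
      ultimately show "?I A s' \<and> s' ''v'' 0 0 = k \<and> s' ''z'' 0 0 = j" using I by simp
    qed
    then show ?thesis by (rule tr_conseq) (use Bv in auto)
  qed
  have step: "tr (\<lambda>s. ?I (D k j) s \<and> s ''v'' 0 0 = k \<and> s ''z'' 0 0 = j)
      (Seq (coin_prog e) (join_prog b d)) (pr k j) (?I (D k (Suc j)))"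
    if kj: "k < n" "j < n" for k j
  proof -
    have val: "wp (join_prog b d) f s =
        (if 0 < s ''coin'' 0 0 \<and> Rel k j \<and> s ''out'' r k = k \<and> s ''out'' r j = j
         then f (update (update s ''out'' r k j) ''out'' r j k) else f s)"
      if "?I A s \<and> s ''v'' 0 0 = k \<and> s ''z'' 0 0 = j" for A f s
      using that kj b[of s] Bv[of s] by (auto simp: join_prog_def update_simps)
    show ?thesis
    proof (cases "(k, j) \<in> K")
      case True
      note kjO = K[OF True]
      have "tr (\<lambda>s. (?I (D k j) s \<and> s ''v'' 0 0 = k \<and> s ''z'' 0 0 = j) \<and> s ''coin'' 0 0 = 1)
          (join_prog b d) 1 (?I (D k (Suc j)))"
      proof (rule trI)
        fix s assume s: "(?I (D k j) s \<and> s ''v'' 0 0 = k \<and> s ''z'' 0 0 = j) \<and> s ''coin'' 0 0 = 1"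
        \<comment> \<open>\<open>g\<close> makes \<open>K\<close> a matching, without reversed
          pairs, so no earlier pair of \<open>K\<close> contains \<open>k\<close>; as
          \<open>k\<close> is in \<open>F\<close>, the invariant says that it is still free.\<close>
        have nk: "k \<notin> fst ` D k j \<union> snd ` D k j"
        proof
          assume "k \<in> fst ` D k j \<union> snd ` D k j"
          then obtain p where "(k, p) \<in> D k j \<or> (p, k) \<in> D k j" by force
          then show False using kjO K[of k p] K[of p k] by (auto simp: D_def)
        qed
        have nj: "j \<notin> fst ` D k j \<union> snd ` D k j"
        proof
          assume "j \<in> fst ` D k j \<union> snd ` D k j"
          then obtain p where "(j, p) \<in> D k j \<or> (p, j) \<in> D k j" by force
          then show False using kjO K[of j p] K[of p j] by (auto simp: D_def)
        qed
        from s nk nj kjO kj have fix_kj: "s ''out'' r k = k" "s ''out'' r j = j"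
          unfolding wanted_def by auto
        have "mate ((s ''out'' r)(k := j, j := k))"
          using s fix_kj kjO Rel by (intro mate_join) auto
        moreover have "wanted g (D k (Suc j)) (F \<inter> {..<n}) ((s ''out'' r)(k := j, j := k))"
          using s kjO True unfolding wanted_def D_Suc by auto
        moreover have "B (update (update s ''out'' r k j) ''out'' r j k)"
          using s B by simp
        ultimately have "?I (D k (Suc j)) (update (update s ''out'' r k j) ''out'' r j k)"
          using s by (simp add: update_simps)
        then show "ennreal 1 \<le> wp (join_prog b d) (\<lambda>s. of_bool (?I (D k (Suc j)) s)) s"
          using s fix_kj kjO by (subst val[where A = "D k j"]) auto
      qed
      from tr_Seq[OF coin[OF tr_coin_one[OF e]] this] True show ?thesis
        by (simp add: pr_def)
    next
      case nO: False
      show ?thesis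
      proof (cases "(k, j) \<in> touching Rel K F")
        case True
        have "tr (\<lambda>s. (?I (D k j) s \<and> s ''v'' 0 0 = k \<and> s ''z'' 0 0 = j) \<and> s ''coin'' 0 0 = 0)
            (join_prog b d) 1 (?I (D k (Suc j)))"
        proof (rule trI)
          fix s assume s: "(?I (D k j) s \<and> s ''v'' 0 0 = k \<and> s ''z'' 0 0 = j) \<and> s ''coin'' 0 0 = 0"
          then show "ennreal 1 \<le> wp (join_prog b d) (\<lambda>s. of_bool (?I (D k (Suc j)) s)) s"
            using nO by (subst val[where A = "D k j"]) (auto simp: D_Suc)
        qed
        from tr_Seq[OF coin[OF tr_coin_zero[OF e]] this] True nO show ?thesis
          by (simp add: pr_def)
      next
        case False
        have "tr (\<lambda>s. (?I (D k j) s \<and> s ''v'' 0 0 = k \<and> s ''z'' 0 0 = j) \<and> True)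
            (join_prog b d) 1 (?I (D k (Suc j)))"
        proof (rule trI)
          fix s assume s: "(?I (D k j) s \<and> s ''v'' 0 0 = k \<and> s ''z'' 0 0 = j) \<and> True"
          \<comment> \<open>A free candidate pair has both ends outside \<open>F\<close>, so joining
            it does not disturb \<open>wanted\<close>.\<close>
          have "?I (D k (Suc j)) (update (update s ''out'' r k j) ''out'' r j k)"
            if "Rel k j" "s ''out'' r k = k" "s ''out'' r j = j"
          proof -
            have "mate ((s ''out'' r)(k := j, j := k))"
              using s that Rel by (intro mate_join) auto
            moreover have "k \<notin> F" "j \<notin> F" using False nO that(1) kj by (auto simp: touching_def)
            then have "wanted g (D k (Suc j)) (F \<inter> {..<n}) ((s ''out'' r)(k := j, j := k))"
              using s nO unfolding wanted_def D_Suc by auto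
            moreover have "B (update (update s ''out'' r k j) ''out'' r j k)"
              using s B by simp
            ultimately show ?thesis using s by (simp add: update_simps)
          qed
          then show "ennreal 1 \<le> wp (join_prog b d) (\<lambda>s. of_bool (?I (D k (Suc j)) s)) s"
            using s nO by (subst val[where A = "D k j"]) (auto simp: D_Suc)
        qed
        from tr_Seq[OF coin[OF tr_coin_any[OF e]] this] False nO show ?thesis
          by (simp add: pr_def)
      qed
    qed
  qed
  have inner: "tr (\<lambda>s. ?I (D k 0) s \<and> s ''v'' 0 0 = k) (FOR ''z'' (V ''n'') (Seq (coin_prog e) (join_prog b d)))
      (\<Prod>j<n. pr k j) (\<lambda>s. ?I (D k n) s \<and> s ''v'' 0 0 = k)" if "k < n" for k
  proof (rule tr_FOR[where I = "\<lambda>j s. ?I (D k j) s \<and> s ''v'' 0 0 = k" and m = n])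
    fix j assume j: "j < n"
    have "tr (\<lambda>s. (?I (D k j) s \<and> s ''v'' 0 0 = k \<and> s ''z'' 0 0 = j) \<and> s ''v'' 0 0 = k)
        (Seq (coin_prog e) (join_prog b d)) (pr k j) (\<lambda>s. ?I (D k (Suc j)) s \<and> s ''v'' 0 0 = k)"
      using step[OF that j] by (rule tr_frame) (simp add: wr_coin wr_join)
    then show "tr (\<lambda>s. (?I (D k j) s \<and> s ''v'' 0 0 = k) \<and> s ''z'' 0 0 = j)
        (Seq (coin_prog e) (join_prog b d)) (pr k j) (\<lambda>s. ?I (D k (Suc j)) s \<and> s ''v'' 0 0 = k)"
      by (rule tr_conseq) auto
  qed (use Bv B pr0 in \<open>auto simp: update_simps wr_coin wr_join\<close>)
  have next_row: "D k n = D (Suc k) 0" for k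
    using K by (auto simp: D_def less_Suc_eq)
  have "tr (?I (D 0 0)) (greedy_prog e b d) (\<Prod>k<n. \<Prod>j<n. pr k j) (?I (D n 0))"
    unfolding greedy_prog_def
  proof (rule tr_FOR[where I = "\<lambda>k. ?I (D k 0)" and m = n])
    fix k assume k: "k < n"
    show "tr (\<lambda>s. ?I (D k 0) s \<and> s ''v'' 0 0 = k) (FOR ''z'' (V ''n'') (Seq (coin_prog e) (join_prog b d)))
      (\<Prod>j<n. pr k j) (?I (D (Suc k) 0))"
      by (rule tr_conseq[OF inner[OF k]]) (auto simp: next_row)
  qed (use Bv B pr0 in \<open>auto simp: update_simps wr_coin wr_join intro: prod_nonneg\<close>)
  moreover have "D 0 0 = {}" "D n 0 = K" using K by (auto simp: D_def)
  moreover have "(\<Prod>k<n. \<Prod>j<n. pr k j) = (1/2) ^ (m * card K) * (1 - (1/2) ^ m) ^ card (touching Rel K F)"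
  proof -
    let ?N = "{..<n} \<times> {..<n}"
    have sub: "K \<subseteq> ?N" "touching Rel K F \<subseteq> ?N - K" using K by (auto simp: touching_def)
    have "(\<Prod>k<n. \<Prod>j<n. pr k j) = (\<Prod>e\<in>?N. case e of (p, q) \<Rightarrow> pr p q)"
      by (simp add: prod.cartesian_product)
    also have "\<dots> = (\<Prod>e\<in>K. case e of (p, q) \<Rightarrow> pr p q) * (\<Prod>e\<in>?N - K. case e of (p, q) \<Rightarrow> pr p q)"
      using sub(1) by (subst prod.subset_diff[of K ?N]) (auto simp: mult.commute)
    also have "(\<Prod>e\<in>?N - K. case e of (p, q) \<Rightarrow> pr p q) = (\<Prod>e\<in>touching Rel K F. case e of (p, q) \<Rightarrow> pr p q)"
      using sub(2) by (intro prod.mono_neutral_right) (auto simp: pr_def)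
    also have "(\<Prod>e\<in>K. case e of (p, q) \<Rightarrow> pr p q) = (\<Prod>e\<in>K. (1/2) ^ m)"
      by (intro prod.cong) (auto simp: pr_def)
    also have "(\<Prod>e\<in>touching Rel K F. case e of (p, q) \<Rightarrow> pr p q) = (\<Prod>e\<in>touching Rel K F. 1 - (1/2) ^ m)"
      by (intro prod.cong) (auto simp: pr_def touching_def)
    finally show ?thesis by (simp add: power_mult)
  qed
  ultimately have "tr (?I {}) (greedy_prog e b d) ((1/2) ^ (m * card K) * (1 - (1/2) ^ m) ^ card (touching Rel K F)) (?I K)"
    by simp
  then show ?thesis
    by (rule tr_conseq) (auto simp: mate_def wanted_def)
qed

end

section \<open>A trial\<close>

text \<open>Freezing the initial state lets invariants compare later rows of \<open>out\<close> with
  it.\<close>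

lemma tr_fix: "(\<And>s0. P s0 \<Longrightarrow> tr (\<lambda>s. s = s0) c q Q) \<Longrightarrow> tr P c q Q"
  by (simp add: tr_def)

text \<open>\<open>\<mu>\<close> is the outcome of the auction, and \<open>2 ^ - \<beta>\<close>,
  the edge probability of the second round, lies between \<open>1 / (32 * n)\<close> and
  \<open>1 / (16 * n)\<close>.\<close>

locale assigned = one_round +
  fixes \<mu> :: "nat \<Rightarrow> nat" and \<beta> :: nat
  assumes \<mu>: "low v \<Longrightarrow> E v (\<mu> v) \<and> \<not> low (\<mu> v)"
    and \<mu>_inj: "inj_on \<mu> {v. low v}"
    and \<beta>: "16 * n \<le> 2 ^ \<beta>" "2 ^ \<beta> < 32 * n"
    and n_large: "1000 \<le> n"
begin

definition ready :: "nat \<Rightarrow> state \<Rightarrow> bool" where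
  "ready r s \<longleftrightarrow> base s \<and> (\<forall>v. s ''mt'' v 0 = (if low v then Suc (\<mu> v) else 0)) \<and>
     s ''b'' 0 0 = \<beta> \<and> s ''rounds'' 0 0 = r"

lemma ready_update [simp]:
  "x \<notin> {''n'', ''adj'', ''mt'', ''b'', ''rounds''} \<Longrightarrow> ready r (update s x i j k) = ready r s"
  by (simp add: ready_def update_simps)

lemma ready_n: "ready r s \<Longrightarrow> s ''n'' 0 0 = n"
  by (simp add: ready_def base_def)

lemma ready_frame:
  "ready r s \<Longrightarrow> (\<And>x. x \<notin> {''coin'', ''j'', ''c''} \<Longrightarrow> s' x = s x) \<Longrightarrow> ready r s'"
  by (simp add: ready_def base_def)

definition up_prog :: com where
  "up_prog = greedy_prog (Const 1) (EqT (Cell ''mt'' (V ''v'') (Const 0)) (Plus (V ''z'') (Const 1))) 0"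

definition mix_prog :: com where
  "mix_prog = greedy_prog (V ''b'') (Less (Const 0) (Cell ''adj'' (V ''v'') (V ''z''))) 1"

definition up_pre :: "nat \<Rightarrow> (nat \<Rightarrow> nat \<Rightarrow> nat) \<Rightarrow> state \<Rightarrow> bool" where
  "up_pre r o0 s \<longleftrightarrow> ready r s \<and> (\<forall>i<r. s ''out'' i = o0 i) \<and>
     (\<forall>v<n. s ''out'' r v = v \<and> s ''out'' (Suc r) v = v)"

definition up_post :: "nat \<Rightarrow> (nat \<Rightarrow> nat \<Rightarrow> nat) \<Rightarrow> ((nat \<Rightarrow> nat) \<Rightarrow> bool) \<Rightarrow> state \<Rightarrow> bool" where
  "up_post r o0 X s \<longleftrightarrow> ready r s \<and> (\<forall>i<r. s ''out'' i = o0 i) \<and>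
     (\<forall>v<n. s ''out'' (Suc r) v = v) \<and> mate (s ''out'' r) \<and> X (s ''out'' r)"

definition mix_post ::
    "nat \<Rightarrow> (nat \<Rightarrow> nat \<Rightarrow> nat) \<Rightarrow> ((nat \<Rightarrow> nat) \<Rightarrow> (nat \<Rightarrow> nat) \<Rightarrow> bool) \<Rightarrow> state \<Rightarrow> bool" where
  "mix_post r o0 Y s \<longleftrightarrow> ready r s \<and> (\<forall>i<r. s ''out'' i = o0 i) \<and>
     mate (s ''out'' r) \<and> mate (s ''out'' (Suc r)) \<and> Y (s ''out'' r) (s ''out'' (Suc r))"

lemma tr_up:
  assumes K: "\<And>p q. (p, q) \<in> K \<Longrightarrow> low p \<and> q = \<mu> p \<and> p \<in> F \<and> q \<in> F \<and> g p = q \<and> g q = p"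
  shows "tr (up_pre r o0) up_prog
     ((1/2) ^ card K * (1/2) ^ card (touching (\<lambda>v z. low v \<and> z = \<mu> v) K F))
     (up_post r o0 (wanted g K (F \<inter> {..<n})))"
proof (rule tr_fix)
  fix s0 assume s0: "up_pre r o0 s0"
  have "tr (\<lambda>s. ready r s \<and> (\<forall>i. i \<noteq> r \<longrightarrow> s ''out'' i = s0 ''out'' i) \<and> (\<forall>v<n. s ''out'' r v = v))
     up_prog ((1/2) ^ (1 * card K) * (1 - (1/2) ^ 1) ^ card (touching (\<lambda>v z. low v \<and> z = \<mu> v) K F))
     (\<lambda>s. ready r s \<and> (\<forall>i. i \<noteq> r \<longrightarrow> s ''out'' i = s0 ''out'' i) \<and> mate (s ''out'' r) \<and>
        wanted g K (F \<inter> {..<n}) (s ''out'' r))"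
    unfolding up_prog_def
  proof (rule tr_greedy)
    show "p < n \<and> q < n \<and> (low p \<and> q = \<mu> p) \<and> p \<in> F \<and> q \<in> F \<and> g p = q \<and> g q = p \<and> (q, p) \<notin> K"
      if "(p, q) \<in> K" for p q
      using K[OF that] K[of q p] \<mu>[of p] bound bound2 by blast
    show "ready r s'" if "ready r s" "\<And>x. x \<notin> {''coin'', ''j'', ''c''} \<Longrightarrow> s' x = s x" for s s'
      using that by (rule ready_frame)
    show "E p q" if "low p \<and> q = \<mu> p" for p q using that \<mu> by blast
    show "ready r (update s x i j k)"
      if "x \<in> {''out'', ''v'', ''z'', ''coin'', ''j'', ''c''}" "ready r s" for s x i j k
      using that by (elim insertE emptyE) simp_all
    show "expr_val (Const 1) s = 1 \<and> s ''n'' 0 0 = n \<and> s ''rounds'' 0 0 + 0 = r" if "ready r s" for s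
      using that by (simp add: ready_def base_def)
    show "test_val (EqT (Cell ''mt'' (V ''v'') (Const 0)) (Plus (V ''z'') (Const 1))) s \<longleftrightarrow>
        low (s ''v'' 0 0) \<and> s ''z'' 0 0 = \<mu> (s ''v'' 0 0)" if "ready r s" for s
      using that by (auto simp: ready_def)
  qed simp
  then show "tr (\<lambda>s. s = s0) up_prog
     ((1/2) ^ card K * (1/2) ^ card (touching (\<lambda>v z. low v \<and> z = \<mu> v) K F))
     (up_post r o0 (wanted g K (F \<inter> {..<n})))"
    by (rule tr_conseq) (use s0 in \<open>auto simp: up_pre_def up_post_def\<close>)
qed

lemma tr_mix:
  assumes K: "\<And>p q. (p, q) \<in> K \<Longrightarrow> E p q \<and> p \<in> F \<and> q \<in> F \<and> g p = q \<and> g q = p \<and> (q, p) \<notin> K"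
  shows "tr (up_post r o0 X) mix_prog
     ((1/2) ^ (\<beta> * card K) * (1 - (1/2) ^ \<beta>) ^ card (touching E K F))
     (mix_post r o0 (\<lambda>f h. X f \<and> wanted g K (F \<inter> {..<n}) h))"
proof (rule tr_fix)
  fix s0 assume s0: "up_post r o0 X s0"
  have "tr (\<lambda>s. ready r s \<and> (\<forall>i. i \<noteq> Suc r \<longrightarrow> s ''out'' i = s0 ''out'' i) \<and> (\<forall>v<n. s ''out'' (Suc r) v = v))
     mix_prog ((1/2) ^ (\<beta> * card K) * (1 - (1/2) ^ \<beta>) ^ card (touching E K F))
     (\<lambda>s. ready r s \<and> (\<forall>i. i \<noteq> Suc r \<longrightarrow> s ''out'' i = s0 ''out'' i) \<and> mate (s ''out'' (Suc r)) \<and>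
        wanted g K (F \<inter> {..<n}) (s ''out'' (Suc r)))"
    unfolding mix_prog_def
  proof (rule tr_greedy)
    show "p < n \<and> q < n \<and> E p q \<and> p \<in> F \<and> q \<in> F \<and> g p = q \<and> g q = p \<and> (q, p) \<notin> K"
      if "(p, q) \<in> K" for p q
      using K[OF that] bound bound2 by blast
    show "ready r s'" if "ready r s" "\<And>x. x \<notin> {''coin'', ''j'', ''c''} \<Longrightarrow> s' x = s x" for s s'
      using that by (rule ready_frame)
    show "ready r (update s x i j k)"
      if "x \<in> {''out'', ''v'', ''z'', ''coin'', ''j'', ''c''}" "ready r s" for s x i j k
      using that by (elim insertE emptyE) simp_all
    show "expr_val (V ''b'') s = \<beta> \<and> s ''n'' 0 0 = n \<and> s ''rounds'' 0 0 + 1 = Suc r" if "ready r s" for s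
      using that by (simp add: ready_def base_def)
    show "test_val (Less (Const 0) (Cell ''adj'' (V ''v'') (V ''z''))) s \<longleftrightarrow> E (s ''v'' 0 0) (s ''z'' 0 0)"
      if "ready r s" for s
      using that by (simp add: ready_def base_def)
    show "expr_val (V ''b'') (update s x 0 0 k) = expr_val (V ''b'') s"
      if "x \<in> {''coin'', ''j'', ''c''}" for s x k
      using that by (elim insertE emptyE) (simp_all add: update_simps)
  qed
  then show "tr (\<lambda>s. s = s0) mix_prog
     ((1/2) ^ (\<beta> * card K) * (1 - (1/2) ^ \<beta>) ^ card (touching E K F))
     (mix_post r o0 (\<lambda>f h. X f \<and> wanted g K (F \<inter> {..<n}) h))"
    by (rule tr_conseq) (use s0 in \<open>auto simp: up_post_def mix_post_def\<close>)
qed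

definition lift :: "nat \<Rightarrow> nat" where
  "lift v = (if low v then \<mu> v else v)"

text \<open>
  The probability 1/4 comes from the fact that at most two assigned edges meet the vertices in question.
\<close>

lemma tr_up_pair:
  assumes xy: "x < n" "y < n" "x \<noteq> y" "\<not> E x y"
  shows "tr (up_pre r o0) up_prog (1/4) (up_post r o0 (\<lambda>f. f x = lift x \<and> f y = lift y))"
proof -
  define K where "K = (\<lambda>v. (v, \<mu> v)) ` {v \<in> {x, y}. low v}"
  define F where "F = {x, y, lift x, lift y}"
  \<comment> \<open>The default value serves \<open>\<mu> y\<close>; \<open>wanted\<close> consults
    \<open>g\<close> only on the endpoints of \<open>K\<close>.\<close>
  define g where "g v = (if v \<in> {x, y} \<and> low v then \<mu> v else if v = \<mu> x \<and> low x then x else y)" for v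
  let ?Rel = "\<lambda>v z. low v \<and> z = \<mu> v"
  have nE: "\<not> E y x" using xy sym by blast
  have \<mu>_eq: "\<mu> u = \<mu> v \<longleftrightarrow> u = v" if "low u" "low v" for u v
    using that \<mu>_inj by (auto simp: inj_on_def)
  have \<mu>_xy: "\<mu> v \<noteq> u" if "low v" "v \<in> {x, y}" "u \<in> {x, y}" for u v
    using that \<mu>[of v] xy nE irrefl by auto
  have K': "low p \<and> q = \<mu> p \<and> p \<in> F \<and> q \<in> F \<and> g p = q \<and> g q = p" if "(p, q) \<in> K" for p q
    using that \<mu>[of x] \<mu>[of y] xy(3) \<mu>_eq[of x y] by (auto simp: K_def F_def g_def lift_def)
  \<comment> \<open>An assigned edge at \<open>lift x\<close> or \<open>lift y\<close> already
    contains \<open>x\<close> or \<open>y\<close>, because \<open>\<mu>\<close> is injective and its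
    values are not low.\<close>
  have meets: "{(p, q). ?Rel p q \<and> (p \<in> F \<or> q \<in> F)}
      \<subseteq> {(p, q). ?Rel p q \<and> (p = x \<or> q = x)} \<union> {(p, q). ?Rel p q \<and> (p = y \<or> q = y)}"
    using \<mu>[of x] \<mu>[of y] \<mu>_eq by (auto simp: F_def lift_def split: if_splits)
  \<comment> \<open>A low vertex can only be the source and a high one only the target of an
    assigned edge, so there is at most one at \<open>u\<close>.\<close>
  have one: "finite {(p, q). ?Rel p q \<and> (p = u \<or> q = u)} \<and> card {(p, q). ?Rel p q \<and> (p = u \<or> q = u)} \<le> 1" for u
  proof -
    let ?A = "{(p, q). ?Rel p q \<and> (p = u \<or> q = u)}"
    have "finite ?A"
      by (rule finite_subset[of _ "{..<n} \<times> {..<n}"]) (use \<mu> bound bound2 in blast)+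
    moreover have "a = b" if "a \<in> ?A" "b \<in> ?A" for a b
      using that \<mu> \<mu>_eq by auto
    ultimately show ?thesis by (auto simp: card_le_Suc0_iff_eq)
  qed
  have "K \<union> touching ?Rel K F \<subseteq> {(p, q). ?Rel p q \<and> (p \<in> F \<or> q \<in> F)}"
    by (auto simp: K_def touching_def F_def)
  with meets have sub: "K \<union> touching ?Rel K F
      \<subseteq> {(p, q). ?Rel p q \<and> (p = x \<or> q = x)} \<union> {(p, q). ?Rel p q \<and> (p = y \<or> q = y)}" (is "_ \<subseteq> ?A \<union> ?B")
    by (rule subset_trans[rotated])
  have finAB: "finite (?A \<union> ?B)" using one by blast
  have "card K + card (touching ?Rel K F) = card (K \<union> touching ?Rel K F)"
    using sub finAB by (subst card_Un_disjoint) (auto simp: touching_def intro: finite_subset)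
  also have "\<dots> \<le> card (?A \<union> ?B)" by (rule card_mono[OF finAB sub])
  also have "\<dots> \<le> card ?A + card ?B" by (rule card_Un_le)
  also have "\<dots> \<le> 1 + 1" using one by (intro add_mono) blast+
  finally have "card K + card (touching ?Rel K F) \<le> 2" by simp
  then have "(1/2::real) ^ 2 \<le> (1/2) ^ (card K + card (touching ?Rel K F))"
    by (intro power_decreasing) auto
  then have q: "1/4 \<le> (1/2::real) ^ card K * (1/2) ^ card (touching ?Rel K F)"
    by (simp add: power_add power2_eq_square)
  have w: "f x = lift x \<and> f y = lift y" if "wanted g K (F \<inter> {..<n}) f" for f
  proof -
    have "f u = lift u" if u: "u \<in> {x, y}" for u
    proof -
      have "u \<in> F \<inter> {..<n}" using u xy by (auto simp: F_def)
      then have f: "f u = (if u \<in> fst ` K \<union> snd ` K then g u else u)"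
        using \<open>wanted g K (F \<inter> {..<n}) f\<close> by (simp add: wanted_def)
      have "u \<in> fst ` K \<union> snd ` K \<longleftrightarrow> low u"
        using u \<mu>_xy unfolding K_def image_Un[symmetric] image_image by auto
      then show ?thesis using f u by (auto simp: g_def lift_def)
    qed
    then show ?thesis by simp
  qed
  show ?thesis
    by (rule tr_conseq[OF tr_up[of K F g r o0, OF K'] _ _ q]) (auto simp: up_post_def dest: w)
qed

lemma lift_high: "v < n \<Longrightarrow> lift v < n \<and> \<not> low (lift v)"
  using \<mu>[of v] bound2 by (auto simp: lift_def)

text \<open>Injectivity of \<open>\<mu>\<close> settles two low vertices; if just one is low, a
  collision would make the assigned edge join \<open>x\<close> and \<open>y\<close>.\<close>

lemma lift_inj: "x \<noteq> y \<Longrightarrow> \<not> E x y \<Longrightarrow> lift x \<noteq> lift y"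
  using \<mu>[of x] \<mu>[of y] \<mu>_inj sym[of y x] by (auto simp: lift_def inj_on_def)

text \<open>At most \<open>8 * n\<close> ordered pairs touch the at most four vertices in
  \<open>F\<close>, each kept with probability at most \<open>1 / (16 * n)\<close>, so by
  Bernoulli's inequality all unwanted ones are refused with probability at least 1/2. This explains
  the 16 in \<open>bits_prog\<close>. For \<open>w = y\<close> the second agent stays put.\<close>

lemma tr_mix_pair:
  assumes xy: "x < n" "y < n" "x \<noteq> y" "\<not> E x y"
    and z: "E x z" and w: "w = y \<or> E y w" and zw: "E z w"
  shows "tr (up_post r o0 X) mix_prog ((1/2) ^ (if w = y then \<beta> else 2 * \<beta>) / 2)
     (mix_post r o0 (\<lambda>f h. X f \<and> h x = z \<and> h y = w))"
proof -
  define K where "K = (if w = y then {(x, z)} else {(x, z), (y, w)})"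
  define F where "F = {x, z, y, w}"
  define g where "g v = (if v = x then z else if v = z then x else if v = y then w else y)" for v
  have d: "z \<noteq> x" "w \<noteq> x" "z \<noteq> y" "z \<noteq> w"
    using xy z w zw irrefl sym by blast+
  have K': "E p q \<and> p \<in> F \<and> q \<in> F \<and> g p = q \<and> g q = p \<and> (q, p) \<notin> K" if "(p, q) \<in> K" for p q
  proof -
    consider "p = x" "q = z" | "p = y" "q = w" "w \<noteq> y"
      using \<open>(p, q) \<in> K\<close> by (auto simp: K_def split: if_splits)
    then show ?thesis
      using d xy(3) z w by cases (simp_all add: K_def F_def g_def)
  qed
  have cK: "card K = (if w = y then 1 else 2)"
    using xy by (auto simp: K_def)
  have "touching E K F \<subseteq> F \<times> {..<n} \<union> {..<n} \<times> F"
    by (auto simp: touching_def)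
  then have "card (touching E K F) \<le> card (F \<times> {..<n} \<union> {..<n} \<times> F)"
    by (intro card_mono) (auto simp: F_def)
  also have "\<dots> \<le> card (F \<times> {..<n}) + card ({..<n} \<times> F)" by (rule card_Un_le)
  also have "\<dots> = 2 * n * card F" by (simp add: card_cartesian_product)
  also have "\<dots> \<le> 2 * n * 4"
    unfolding F_def by (intro mult_left_mono) (auto simp: card_insert_if)
  finally have t: "card (touching E K F) \<le> 8 * n" by simp
  have b: "(1/2::real) ^ \<beta> \<le> 1 / (16 * real n)"
  proof -
    have "16 * real n \<le> 2 ^ \<beta>"
      using \<beta>(1) by (metis of_nat_le_iff of_nat_mult of_nat_numeral of_nat_power)
    then have "1 / 2 ^ \<beta> \<le> 1 / (16 * real n)" using n_large by (intro divide_left_mono) auto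
    then show ?thesis by (simp add: power_one_over)
  qed
  have "1/2 \<le> 1 - 8 * real n * (1/2) ^ \<beta>"
    using mult_left_mono[OF b, of "8 * real n"] n_large by simp
  also have "\<dots> \<le> 1 + real (card (touching E K F)) * (- ((1/2) ^ \<beta>))"
  proof -
    have "real (card (touching E K F)) \<le> 8 * real n"
      using t by (metis of_nat_le_iff of_nat_mult of_nat_numeral)
    then have "real (card (touching E K F)) * (1/2) ^ \<beta> \<le> 8 * real n * (1/2) ^ \<beta>"
      by (intro mult_right_mono) auto
    then show ?thesis by simp
  qed
  also have "\<dots> \<le> (1 + - ((1/2) ^ \<beta>)) ^ card (touching E K F)"
    by (rule Bernoulli_inequality) (simp add: power_le_one)
  finally have "1/2 \<le> (1 - (1/2::real) ^ \<beta>) ^ card (touching E K F)" by simp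
  then have "(1/2) ^ (\<beta> * card K) * (1/2::real) \<le> (1/2) ^ (\<beta> * card K) * (1 - (1/2) ^ \<beta>) ^ card (touching E K F)"
    by (intro mult_left_mono) auto
  then have q: "(1/2) ^ (if w = y then \<beta> else 2 * \<beta>) / 2
      \<le> (1/2::real) ^ (\<beta> * card K) * (1 - (1/2) ^ \<beta>) ^ card (touching E K F)"
    by (auto simp: cK mult.commute)
  have wd: "h x = z \<and> h y = w" if "wanted g K (F \<inter> {..<n}) h" for h
    using that xy d by (auto simp: wanted_def F_def K_def g_def split: if_splits)
  show ?thesis
    by (rule tr_conseq[OF tr_mix[of K F g r o0 X, OF K'] _ _ q]) (auto simp: mix_post_def dest: wd)
qed

text \<open>Events for different targets \<open>(z, w)\<close> are disjoint, so their bounds add. In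
  the dense case there are \<open>n ^ 2 / 64\<close> targets, each of probability at least
  \<open>(1 / (32 * n)) ^ 2 / 2\<close>, in total \<open>2 ^ - 17\<close>. Otherwise
  \<open>y\<close> stays and \<open>x\<close> moves to one of \<open>n / 16\<close> common
  neighbours, each with probability at least \<open>1 / (64 * n)\<close>.\<close>

lemma tr_mix_good:
  assumes xy: "x < n" "y < n" "x \<noteq> y" "\<not> E x y" "\<not> low x" "\<not> low y"
  shows "tr (up_post r o0 X) mix_prog (1 / 2 ^ 17) (mix_post r o0 (\<lambda>f h. X f \<and> E (h x) (h y)))"
proof -
  have b: "1 / (32 * real n) \<le> (1/2::real) ^ \<beta>"
  proof -
    have "2 ^ \<beta> \<le> 32 * real n"
      using \<beta>(2) by (metis less_imp_le of_nat_le_iff of_nat_mult of_nat_numeral of_nat_power)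
    then have "1 / (32 * real n) \<le> 1 / 2 ^ \<beta>" using n_large by (intro divide_left_mono) auto
    then show ?thesis by (simp add: power_one_over)
  qed
  have sum: "tr (up_post r o0 X) mix_prog (1 / 2 ^ 17) (mix_post r o0 (\<lambda>f h. X f \<and> E (h x) (h y)))"
    if I: "finite I" "\<And>z w. (z, w) \<in> I \<Longrightarrow> E x z \<and> E z w \<and> (w = y \<or> E y w)"
      "\<And>z w. (z, w) \<in> I \<Longrightarrow> q \<le> (1/2) ^ (if w = y then \<beta> else 2 * \<beta>) / 2"
      and q: "0 \<le> q" "1 / 2 ^ 17 \<le> real (card I) * q" for I q
  proof -
    let ?Q = "\<lambda>e. mix_post r o0 (\<lambda>f h. X f \<and> h x = fst e \<and> h y = snd e)"
    have "tr (up_post r o0 X) mix_prog (\<Sum>e\<in>I. q) (\<lambda>s. \<exists>e\<in>I. ?Q e s)"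
    proof (rule tr_disjoint[OF I(1)])
      fix e assume "e \<in> I"
      then have e: "(fst e, snd e) \<in> I" by simp
      show "tr (up_post r o0 X) mix_prog q (?Q e)"
        by (rule tr_conseq[OF tr_mix_pair[OF xy(1-4)]]) (use I(2,3)[OF e] in auto)
    qed (use q in \<open>auto simp: mix_post_def prod_eq_iff\<close>)
    then show ?thesis
      by (rule tr_conseq) (use q(2) I(2) in \<open>auto simp: mix_post_def\<close>)
  qed
  consider "n ^ 2 \<le> 64 * card {(z, w). z \<in> nb x \<and> w \<in> nb y \<and> E z w}" | "n \<le> 16 * card (nb x \<inter> nb y)"
    using close_or_dense[of x y] xy n_large by blast
  then show ?thesis
  proof cases
    case 1
    let ?I = "{(z, w). z \<in> nb x \<and> w \<in> nb y \<and> E z w}"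
    show ?thesis
    proof (rule sum[of ?I "1 / (2048 * real n ^ 2)"])
      show "finite ?I" by (rule finite_subset[of _ "nb x \<times> nb y"]) auto
      show "E x z \<and> E z w \<and> (w = y \<or> E y w)" if "(z, w) \<in> ?I" for z w
        using that by (auto simp: nb_def)
      have "(1 / (32 * real n)) ^ 2 \<le> ((1/2::real) ^ \<beta>) ^ 2"
        using b by (intro power_mono) auto
      then have "1 / (2048 * real n ^ 2) \<le> (1/2) ^ (2 * \<beta>) / 2"
        by (simp add: power_divide power_mult_distrib power_mult[symmetric] mult.commute)
      then show "1 / (2048 * real n ^ 2) \<le> (1/2) ^ (if w = y then \<beta> else 2 * \<beta>) / 2"
        if "(z, w) \<in> ?I" for z w
        using that irrefl by (auto simp: nb_def)
      have "real (n ^ 2) \<le> real (64 * card ?I)" using 1 by (rule of_nat_mono)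
      then show "1 / 2 ^ 17 \<le> real (card ?I) * (1 / (2048 * real n ^ 2))"
        using n_large by (simp add: field_simps)
    qed simp
  next
    case 2
    let ?I = "(\<lambda>z. (z, y)) ` (nb x \<inter> nb y)"
    have card: "card ?I = card (nb x \<inter> nb y)" by (intro card_image) (auto simp: inj_on_def)
    show ?thesis
    proof (rule sum[of ?I "1 / (64 * real n)"])
      show "E x z \<and> E z w \<and> (w = y \<or> E y w)" if "(z, w) \<in> ?I" for z w
        using that sym by (auto simp: nb_def)
      show "1 / (64 * real n) \<le> (1/2) ^ (if w = y then \<beta> else 2 * \<beta>) / 2" if "(z, w) \<in> ?I" for z w
        using that b by auto
      have "real n \<le> real (16 * card (nb x \<inter> nb y))" using 2 by (rule of_nat_mono)
      then show "1 / 2 ^ 17 \<le> real (card ?I) * (1 / (64 * real n))"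
        unfolding card using n_large by (simp add: field_simps)
    qed auto
  qed
qed

text \<open>Involutions are their own inverses, so repeating the two rows in reverse order brings
  everybody home. The copies agree only below \<open>n\<close>, where the loop has written
  them.\<close>

definition block :: "state \<Rightarrow> nat \<Rightarrow> bool" where
  "block s r \<longleftrightarrow> mate (s ''out'' r) \<and> mate (s ''out'' (Suc r)) \<and>
     (\<forall>v<n. s ''out'' (r + 2) v = s ''out'' (Suc r) v \<and> s ''out'' (r + 3) v = s ''out'' r v)"

definition meets :: "nat \<Rightarrow> nat \<Rightarrow> (nat \<Rightarrow> nat) \<Rightarrow> (nat \<Rightarrow> nat) \<Rightarrow> bool" where
  "meets x y f h \<longleftrightarrow> E (f x) (f y) \<or> E (h (f x)) (h (f y))"

lemma trial_prog_eq:
  "trial_prog =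
     Seq (FOR ''v'' (V ''n'') (Seq (Assign ''out'' (out_row 0) (V ''v'') (V ''v'')) (Assign ''out'' (out_row 1) (V ''v'') (V ''v''))))
    (Seq up_prog (Seq mix_prog
    (Seq (FOR ''v'' (V ''n'')
            (Seq (Assign ''out'' (out_row 2) (V ''v'') (Cell ''out'' (out_row 1) (V ''v'')))
                 (Assign ''out'' (out_row 3) (V ''v'') (Cell ''out'' (out_row 0) (V ''v'')))))
       (Set ''rounds'' (out_row 4)))))"
  by (simp add: trial_prog_def up_prog_def mix_prog_def)

lemma tr_trial:
  assumes up: "tr (up_pre r o0) up_prog qa (up_post r o0 X)"
    and mix: "tr (up_post r o0 X) mix_prog qb (mix_post r o0 Y)" and q: "0 \<le> qa" "0 \<le> qb"
  shows "tr (\<lambda>s. ready r s \<and> (\<forall>i<r. s ''out'' i = o0 i)) trial_prog (qa * qb)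
     (\<lambda>s. ready (r + 4) s \<and> (\<forall>i<r. s ''out'' i = o0 i) \<and> block s r \<and> Y (s ''out'' r) (s ''out'' (Suc r)))"
proof -
  let ?init = "FOR ''v'' (V ''n'') (Seq (Assign ''out'' (out_row 0) (V ''v'') (V ''v'')) (Assign ''out'' (out_row 1) (V ''v'') (V ''v'')))"
  let ?copy = "FOR ''v'' (V ''n'')
            (Seq (Assign ''out'' (out_row 2) (V ''v'') (Cell ''out'' (out_row 1) (V ''v'')))
                 (Assign ''out'' (out_row 3) (V ''v'') (Cell ''out'' (out_row 0) (V ''v''))))"
  let ?I = "\<lambda>k s. ready r s \<and> (\<forall>i<r. s ''out'' i = o0 i) \<and> (\<forall>v<k. s ''out'' r v = v \<and> s ''out'' (Suc r) v = v)"
  let ?J = "\<lambda>k s. mix_post r o0 Y s \<and>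
      (\<forall>v<k. s ''out'' (r + 2) v = s ''out'' (Suc r) v \<and> s ''out'' (r + 3) v = s ''out'' r v)"
  have rr: "ready r s \<Longrightarrow> s ''rounds'' 0 0 = r" for s by (simp add: ready_def)
  have "tr (?I 0) ?init 1 (?I n)"
  proof (rule tr_FOR1[where I = ?I and m = n])
    show "tr (\<lambda>s. ?I k s \<and> s ''v'' 0 0 = k)
        (Seq (Assign ''out'' (out_row 0) (V ''v'') (V ''v'')) (Assign ''out'' (out_row 1) (V ''v'') (V ''v''))) 1 (?I (Suc k))" for k
    proof (rule trI)
      fix s assume s: "?I k s \<and> s ''v'' 0 0 = k"
      then have "s ''rounds'' 0 0 = r" by (simp add: rr)
      with s show "ennreal 1 \<le> wp (Seq (Assign ''out'' (out_row 0) (V ''v'') (V ''v'')) (Assign ''out'' (out_row 1) (V ''v'') (V ''v'')))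
          (\<lambda>s'. of_bool (?I (Suc k) s')) s"
        by (simp add: update_simps less_Suc_eq)
    qed
  qed (auto simp: ready_n update_simps)
  then have 1: "tr (\<lambda>s. ready r s \<and> (\<forall>i<r. s ''out'' i = o0 i)) ?init 1 (up_pre r o0)"
    by (rule tr_conseq) (auto simp: up_pre_def)
  have "tr (?J 0) ?copy 1 (?J n)"
  proof (rule tr_FOR1[where I = ?J and m = n])
    show "tr (\<lambda>s. ?J k s \<and> s ''v'' 0 0 = k)
        (Seq (Assign ''out'' (out_row 2) (V ''v'') (Cell ''out'' (out_row 1) (V ''v'')))
             (Assign ''out'' (out_row 3) (V ''v'') (Cell ''out'' (out_row 0) (V ''v'')))) 1 (?J (Suc k))" for k
    proof (rule trI)
      fix s assume s: "?J k s \<and> s ''v'' 0 0 = k"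
      then have "s ''rounds'' 0 0 = r" by (simp add: rr mix_post_def)
      with s show "ennreal 1 \<le> wp (Seq (Assign ''out'' (out_row 2) (V ''v'') (Cell ''out'' (out_row 1) (V ''v'')))
             (Assign ''out'' (out_row 3) (V ''v'') (Cell ''out'' (out_row 0) (V ''v''))))
          (\<lambda>s'. of_bool (?J (Suc k) s')) s"
        by (simp add: update_simps less_Suc_eq mix_post_def)
    qed
  qed (auto simp: ready_n update_simps mix_post_def)
  then have 2: "tr (mix_post r o0 Y) ?copy 1 (?J n)"
    by (rule tr_conseq) auto
  have 3: "tr (?J n) (Set ''rounds'' (out_row 4)) 1
     (\<lambda>s. ready (r + 4) s \<and> (\<forall>i<r. s ''out'' i = o0 i) \<and> block s r \<and> Y (s ''out'' r) (s ''out'' (Suc r)))"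
    by (intro trI) (auto simp: update_simps mix_post_def block_def ready_def)
  have "tr (up_post r o0 X) (Seq mix_prog (Seq ?copy (Set ''rounds'' (out_row 4)))) (qb * (1 * 1))
     (\<lambda>s. ready (r + 4) s \<and> (\<forall>i<r. s ''out'' i = o0 i) \<and> block s r \<and> Y (s ''out'' r) (s ''out'' (Suc r)))"
    by (rule tr_Seq[OF mix tr_Seq[OF 2 3]]) auto
  then have "tr (\<lambda>s. ready r s \<and> (\<forall>i<r. s ''out'' i = o0 i)) trial_prog (1 * (qa * (qb * (1 * 1))))
     (\<lambda>s. ready (r + 4) s \<and> (\<forall>i<r. s ''out'' i = o0 i) \<and> block s r \<and> Y (s ''out'' r) (s ''out'' (Suc r)))"
    unfolding trial_prog_eq by (rule tr_Seq[OF 1 tr_Seq[OF up]]) (use q in simp_all)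
  then show ?thesis by simp
qed

text \<open>With \<open>K = {}\<close> and \<open>F = {}\<close> no coin is prescribed, so both
  bounds become 1: this is what a trial guarantees for all coins.\<close>

lemma tr_trial_any:
  "tr (\<lambda>s. ready r s \<and> (\<forall>i<r. s ''out'' i = o0 i)) trial_prog 1
     (\<lambda>s. ready (r + 4) s \<and> (\<forall>i<r. s ''out'' i = o0 i) \<and> block s r)"
proof -
  have "tr (up_pre r o0) up_prog 1 (up_post r o0 (wanted id {} ({} \<inter> {..<n})))"
    using tr_up[of "{}" "{}" id r o0] by (simp add: touching_def)
  moreover have "tr (up_post r o0 (wanted id {} ({} \<inter> {..<n}))) mix_prog 1
      (mix_post r o0 (\<lambda>f h. wanted id {} ({} \<inter> {..<n}) f \<and> wanted id {} ({} \<inter> {..<n}) h))"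
    using tr_mix[of "{}" "{}" id r o0] by (simp add: touching_def)
  ultimately show ?thesis
    by (intro tr_conseq[OF tr_trial]) auto
qed

text \<open>The probability is 1/4 for the first round times \<open>2 ^ - 17\<close> for the
  second.\<close>

lemma tr_trial_good:
  assumes xy: "x < n" "y < n" "x \<noteq> y" "\<not> E x y"
  shows "tr (\<lambda>s. ready r s \<and> (\<forall>i<r. s ''out'' i = o0 i)) trial_prog (1 / 2 ^ 19)
     (\<lambda>s. ready (r + 4) s \<and> (\<forall>i<r. s ''out'' i = o0 i) \<and> block s r \<and>
        meets x y (s ''out'' r) (s ''out'' (Suc r)))"
proof -
  let ?X = "\<lambda>f. f x = lift x \<and> f y = lift y"
  have "tr (up_post r o0 ?X) mix_prog (1 / 2 ^ 17) (mix_post r o0 (\<lambda>f h. meets x y f h))"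
  \<comment> \<open>If the lifted positions are adjacent, the agents meet after the first round and
    nothing is asked of the second.\<close>
  proof (cases "E (lift x) (lift y)")
    case True
    have "tr (up_post r o0 ?X) mix_prog 1 (mix_post r o0 (\<lambda>f h. ?X f \<and> wanted id {} ({} \<inter> {..<n}) h))"
      using tr_mix[of "{}" "{}" id r o0 ?X] by (simp add: touching_def)
    then show ?thesis
      by (rule tr_conseq) (use True in \<open>auto simp: mix_post_def meets_def\<close>)
  next
    case False
    then show ?thesis
      using xy lift_inj lift_high
      by (intro tr_conseq[OF tr_mix_good[of "lift x" "lift y" r o0 ?X]])
         (auto simp: mix_post_def meets_def)
  qed
  from tr_trial[OF tr_up_pair[OF xy] this] show ?thesis
    by (rule tr_conseq) auto
qed

section \<open>Iterating the trials\<close>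

definition progress :: "nat \<Rightarrow> state \<Rightarrow> bool" where
  "progress k s \<longleftrightarrow> ready (4 * k) s \<and> (\<forall>i<k. block s (4 * i))"

text \<open>Equal and adjacent vertices count as met, so that \<open>tr_progress_meet\<close> covers
  all pairs; the bound on \<open>4 * i + 4\<close> restricts \<open>i\<close> to finished
  trials.\<close>

definition met :: "nat \<Rightarrow> nat \<Rightarrow> state \<Rightarrow> bool" where
  "met x y s \<longleftrightarrow> x = y \<or> E x y \<or>
     (\<exists>i. 4 * i + 4 \<le> s ''rounds'' 0 0 \<and> meets x y (s ''out'' (4 * i)) (s ''out'' (4 * i + 1)))"

lemma block_cong:
  "(\<And>i. i < r + 4 \<Longrightarrow> s' ''out'' i = s ''out'' i) \<Longrightarrow> block s' r = block s r"
  by (simp add: block_def)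

lemma progress_step:
  assumes "progress k s0" "ready (4 * k + 4) s" "\<forall>i<4 * k. s ''out'' i = s0 ''out'' i" "block s (4 * k)"
  shows "progress (Suc k) s"
proof -
  have "block s (4 * i)" if "i < Suc k" for i
  proof (cases "i = k")
    case False
    with that have "block s (4 * i) = block s0 (4 * i)"
      using assms(3) by (intro block_cong) auto
    then show ?thesis using assms(1) that False by (simp add: progress_def)
  qed (use assms(4) in simp)
  then show ?thesis using assms(2) by (simp add: progress_def add.commute)
qed

lemma met_step:
  assumes "progress k s0" "ready (4 * k + 4) s" "\<forall>i<4 * k. s ''out'' i = s0 ''out'' i" "met x y s0"
  shows "met x y s"
proof -
  have r: "s0 ''rounds'' 0 0 = 4 * k" "s ''rounds'' 0 0 = 4 * k + 4"
    using assms(1,2) by (auto simp: progress_def ready_def)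
  from assms(4) consider "x = y \<or> E x y"
    | i where "4 * i + 4 \<le> s0 ''rounds'' 0 0" "meets x y (s0 ''out'' (4 * i)) (s0 ''out'' (4 * i + 1))"
    unfolding met_def by blast
  then show ?thesis
  proof cases
    case 1
    then show ?thesis by (auto simp: met_def)
  next
    case (2 i)
    then have "4 * i < 4 * k" "4 * i + 1 < 4 * k" using r by auto
    then have "s ''out'' (4 * i) = s0 ''out'' (4 * i)" "s ''out'' (4 * i + 1) = s0 ''out'' (4 * i + 1)"
      using assms(3) by blast+
    moreover have "4 * i + 4 \<le> s ''rounds'' 0 0" using 2(1) r by simp
    ultimately show ?thesis
      unfolding met_def using 2(2) by (intro disjI2 exI[of _ i]) simp
  qed
qed

lemma tr_progress: "tr (progress k) trial_prog 1 (progress (Suc k))"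
proof (rule tr_fix)
  fix s0 assume s0: "progress k s0"
  show "tr (\<lambda>s. s = s0) trial_prog 1 (progress (Suc k))"
    by (rule tr_conseq[OF tr_trial_any[of "4 * k" "s0 ''out''"]])
       (use s0 progress_step[OF s0] in \<open>auto simp: progress_def\<close>)
qed

lemma tr_progress_met:
  "tr (\<lambda>s. progress k s \<and> met x y s) trial_prog 1 (\<lambda>s. progress (Suc k) s \<and> met x y s)"
proof (rule tr_fix)
  fix s0 assume s0: "progress k s0 \<and> met x y s0"
  show "tr (\<lambda>s. s = s0) trial_prog 1 (\<lambda>s. progress (Suc k) s \<and> met x y s)"
    by (rule tr_conseq[OF tr_trial_any[of "4 * k" "s0 ''out''"]])
       (use s0 progress_step[of k s0] met_step[of k s0] in \<open>auto simp: progress_def\<close>)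
qed

lemma tr_progress_meet:
  assumes "x < n" "y < n"
  shows "tr (progress k) trial_prog (1 / 2 ^ 19) (\<lambda>s. progress (Suc k) s \<and> met x y s)"
proof (cases "x = y \<or> E x y")
  case True
  then show ?thesis
    by (intro tr_conseq[OF tr_progress]) (auto simp: met_def)
next
  case False
  show ?thesis
  proof (rule tr_fix)
    fix s0 assume s0: "progress k s0"
    have "met x y s" if "ready (4 * k + 4) s" "meets x y (s ''out'' (4 * k)) (s ''out'' (Suc (4 * k)))" for s
      using that by (auto simp: met_def ready_def intro!: exI[of _ k])
    then show "tr (\<lambda>s. s = s0) trial_prog (1 / 2 ^ 19) (\<lambda>s. progress (Suc k) s \<and> met x y s)"
      by (intro tr_conseq[OF tr_trial_good[of x y "4 * k" "s0 ''out''"]])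
         (use assms False s0 progress_step[OF s0] in \<open>auto simp: progress_def\<close>)
  qed
qed

lemma progress_update [simp]:
  "x \<in> {''t'', ''u''} \<Longrightarrow> progress k (update s x i j l) = progress k s"
  by (auto simp: progress_def block_def update_simps)

lemma met_update [simp]: "z \<in> {''t'', ''u''} \<Longrightarrow> met x y (update s z i j l) = met x y s"
  by (auto simp: met_def update_simps)

lemma wr_trial: "''t'' \<notin> wr trial_prog" "''u'' \<notin> wr trial_prog"
  by (simp_all add: trial_prog_def greedy_prog_def wr_coin wr_join)

text \<open>\<open>tr_FOR_eventually\<close> is used for the inner loop and again for the outer one,
  whose iterations succeed with probability \<open>?p\<close>.\<close>

lemma tr_trials:
  assumes "x < n" "y < n"
  shows "tr (progress 0) (FOR ''t'' (V ''b'') (FOR ''u'' (Const trials) trial_prog))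
     (1 - ((1 - 1 / 2 ^ 19) ^ trials) ^ \<beta>) (\<lambda>s. progress (\<beta> * trials) s \<and> met x y s)"
proof -
  let ?loop = "FOR ''u'' (Const trials) trial_prog"
  let ?p = "1 - (1 - 1 / 2 ^ 19) ^ trials :: real"
  have win: "tr (progress (k * trials + 0)) ?loop ?p (\<lambda>s. progress (k * trials + trials) s \<and> met x y s)" for k
    by (rule tr_FOR_eventually[where J = "\<lambda>j. progress (k * trials + j)" and S = "met x y" and m = trials])
       (auto intro: tr_conseq[OF tr_progress] tr_conseq[OF tr_progress_met] tr_conseq[OF tr_progress_meet[OF assms]]
         simp: wr_trial)
  have inv: "tr (progress (k * trials + 0)) ?loop 1 (progress (k * trials + trials))" for k
    by (rule tr_FOR1[where I = "\<lambda>j. progress (k * trials + j)" and m = trials])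
       (auto intro: tr_conseq[OF tr_progress] simp: wr_trial)
  have keep: "tr (\<lambda>s. progress (k * trials + 0) s \<and> met x y s) ?loop 1
      (\<lambda>s. progress (k * trials + trials) s \<and> met x y s)" for k
    by (rule tr_FOR1[where I = "\<lambda>j s. progress (k * trials + j) s \<and> met x y s" and m = trials])
       (auto intro: tr_conseq[OF tr_progress_met] simp: wr_trial)
  have "tr (progress (0 * trials)) (FOR ''t'' (V ''b'') ?loop) (1 - (1 - ?p) ^ \<beta>)
      (\<lambda>s. progress (\<beta> * trials) s \<and> met x y s)"
  proof (rule tr_FOR_eventually[where J = "\<lambda>k. progress (k * trials)" and S = "met x y" and m = \<beta>])
    show "expr_val (V ''b'') s = \<beta>" if "progress (k * trials) s" for k s
      using that by (simp add: progress_def ready_def)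
    show "tr (\<lambda>s. progress (k * trials) s \<and> s ''t'' 0 0 = k) ?loop 1 (progress (Suc k * trials))" for k
      by (rule tr_conseq[OF inv[of k]]) (auto simp: add.commute)
    show "tr (\<lambda>s. progress (k * trials) s \<and> met x y s \<and> s ''t'' 0 0 = k) ?loop 1
        (\<lambda>s. progress (Suc k * trials) s \<and> met x y s)" for k
      by (rule tr_conseq[OF keep[of k]]) (auto simp: add.commute)
    show "tr (\<lambda>s. progress (k * trials) s \<and> s ''t'' 0 0 = k) ?loop ?p
        (\<lambda>s. progress (Suc k * trials) s \<and> met x y s)" for k
      by (rule tr_conseq[OF win[of k]]) (auto simp: add.commute)
    show "0 \<le> ?p" "?p \<le> 1" by (simp_all add: power_le_one)
  qed (auto simp: wr_trial)
  then show ?thesis by simp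
qed

text \<open>By \<open>1 - x \<le> exp (- x)\<close>, a run of the inner loop fails with probability
  at most \<open>exp (- 3) \<le> 2 ^ - 3\<close>, so \<open>\<beta>\<close> runs fail with
  probability at most \<open>(2 ^ - \<beta>) ^ 3\<close>.\<close>

lemma trials_failure: "((1 - 1 / 2 ^ 19) ^ trials) ^ \<beta> \<le> 1 / real n ^ 3"
proof -
  have "((1 - 1 / 2 ^ 19) ^ trials :: real) \<le> exp (- 1 / 2 ^ 19) ^ trials"
    using exp_ge_add_one_self[of "- 1 / 2 ^ 19 :: real"] by (intro power_mono) auto
  also have "\<dots> = exp (- 3)"
    by (simp add: exp_of_nat_mult[symmetric] trials_def)
  also have "\<dots> = exp (- 1) ^ 3"
    by (simp add: exp_of_nat_mult[symmetric])
  also have "\<dots> \<le> (1 / 2) ^ 3"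
  proof (intro power_mono)
    have "2 \<le> exp (1::real)" using exp_ge_add_one_self[of 1] by simp
    then show "exp (- 1) \<le> (1 / 2 :: real)" by (simp add: exp_minus field_simps)
  qed simp
  finally have "((1 - 1 / 2 ^ 19) ^ trials) ^ \<beta> \<le> ((1 / 2 :: real) ^ 3) ^ \<beta>"
    by (intro power_mono) auto
  also have "\<dots> = ((1 / 2) ^ \<beta>) ^ 3"
    by (simp only: power_mult[symmetric] mult.commute)
  also have "\<dots> = (1 / 2 ^ \<beta>) ^ 3"
    by (simp add: power_one_over)
  also have "\<dots> \<le> (1 / real n) ^ 3"
  proof (intro power_mono divide_left_mono)
    have "n \<le> 2 ^ \<beta>" using \<beta>(1) by simp
    then show "real n \<le> 2 ^ \<beta>"
      by (metis of_nat_le_iff of_nat_numeral of_nat_power)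
  qed (use n_large in auto)
  finally show ?thesis by (simp add: power_one_over)
qed

end

section \<open>Running time\<close>

lemma halts_within_Suc:
  "halts_within (Suc t) c s \<longleftrightarrow> (\<forall>p\<in>set_pmf (step c s). halts_within t (fst p) (snd p))"
  by (auto simp: halts_within_def split_beta)

lemma halts_within_0: "halts_within 0 c s \<longleftrightarrow> c = Skip"
  by (simp add: halts_within_def)

lemma halts_within_Skip [simp]: "halts_within t Skip s"
  by (induction t) (simp_all add: halts_within_0 halts_within_Suc)

lemma halts_within_mono: "halts_within t c s \<Longrightarrow> t \<le> t' \<Longrightarrow> halts_within t' c s"
proof (induction t arbitrary: t' c s)
  case (Suc t)
  then obtain t'' where "t' = Suc t''" "t \<le> t''" by (cases t') auto
  with Suc show ?case by (auto simp: halts_within_Suc)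
qed (simp add: halts_within_0)

lemma halts_within_Seq:
  assumes "halts_within t1 c1 s" "\<And>p. p \<in> set_pmf (run t1 c1 s) \<Longrightarrow> halts_within t2 c2 (snd p)"
  shows "halts_within (Suc (t1 + t2)) (Seq c1 c2) s"
  using assms
proof (induction t1 arbitrary: c1 s)
  case 0
  then show ?case by (simp add: halts_within_0 halts_within_Suc)
next
  case (Suc t1)
  show ?case
  proof (cases "c1 = Skip")
    case True
    have "set_pmf (run (Suc t1) Skip s) = {(Skip, s)}"
      by (induction t1) auto
    with True Suc.prems(2)[of "(Skip, s)"] have "halts_within t2 c2 s" by simp
    then show ?thesis
      using True halts_within_mono[of t2 c2 s "Suc (t1 + t2)"] by (simp add: halts_within_Suc[of "Suc (t1 + t2)"])
  next
    case False
    have "halts_within (Suc (t1 + t2)) (Seq (fst p) c2) (snd p)" if "p \<in> set_pmf (step c1 s)" for p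
    proof (rule Suc.IH)
      show "halts_within t1 (fst p) (snd p)" using Suc.prems(1) that by (simp add: halts_within_Suc)
      show "halts_within t2 c2 (snd q)" if "q \<in> set_pmf (run t1 (fst p) (snd p))" for q
        using Suc.prems(2)[of q] that \<open>p \<in> set_pmf (step c1 s)\<close> by (force simp: split_beta)
    qed
    then show ?thesis
      using False by (auto simp: halts_within_Suc[of "Suc (t1 + t2)"] split_beta)
  qed
qed

lemma run_after_halt: "halts_within t c s \<Longrightarrow> run (t + k) c s = run t c s"
proof (induction t arbitrary: c s)
  case 0
  then have "c = Skip" by (simp add: halts_within_0)
  moreover have "run k Skip s = return_pmf (Skip, s)" by (induction k) (simp_all add: bind_return_pmf)
  ultimately show ?case by simp
next
  case (Suc t)
  have "run (t + k) (fst p) (snd p) = run t (fst p) (snd p)" if "p \<in> set_pmf (step c s)" for p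
    using Suc.prems that by (intro Suc.IH) (simp add: halts_within_Suc)
  then show ?case by (auto simp: split_beta intro!: bind_pmf_cong)
qed

text \<open>Once every run has halted, more time changes nothing, so the supremum in
  \<open>wp\<close> is attained at \<open>t\<close>.\<close>

lemma prob_final_state:
  assumes "halts_within t c s"
  shows "wp c (\<lambda>s. of_bool (Q s)) s = ennreal (measure_pmf.prob (final_state t c s) {s. Q s})"
proof -
  have "wpt t' c (\<lambda>s. of_bool (Q s)) s \<le> wpt t c (\<lambda>s. of_bool (Q s)) s" for t'
  proof (cases "t' \<le> t")
    case False
    then have "run t' c s = run t c s" using run_after_halt[OF assms, of "t' - t"] by simp
    then show ?thesis by (simp add: wpt_def)
  qed (rule wpt_mono_time)
  then have "wp c (\<lambda>s. of_bool (Q s)) s = wpt t c (\<lambda>s. of_bool (Q s)) s"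
    unfolding wp_def by (intro antisym SUP_least) (auto intro: SUP_upper)
  also have "\<dots> = (\<integral>\<^sup>+p. indicator {s. Q s} (snd p) \<partial>measure_pmf (run t c s))"
    unfolding wpt_def using assms
    by (intro nn_integral_cong_AE) (auto simp: AE_measure_pmf_iff halts_within_def indicator_def of_bool_def)
  also have "\<dots> = (\<integral>\<^sup>+s. indicator {s. Q s} s \<partial>measure_pmf (final_state t c s))"
    by (simp add: final_state_def)
  also have "\<dots> = ennreal (measure_pmf.prob (final_state t c s) {s. Q s})"
    by (simp add: measure_pmf.emeasure_eq_measure)
  finally show ?thesis .
qed

lemma tr_prob:
  assumes "tr P c q Q" "P s" "halts_within t c s"
  shows "q \<le> measure_pmf.prob (final_state t c s) {s. Q s}"
proof -
  have "ennreal q \<le> ennreal (measure_pmf.prob (final_state t c s) {s. Q s})"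
    using trD[OF assms(1), OF assms(2)] unfolding prob_final_state[OF assms(3)] .
  then show ?thesis by (simp add: ennreal_le_iff)
qed

text \<open>A property of probability 1 holds on the whole support. This carries facts proved by
  triples over to running times.\<close>

lemma tr_run:
  assumes "tr P c 1 Q" "P s" "halts_within t c s" "p \<in> set_pmf (run t c s)"
  shows "Q (snd p)"
proof -
  have "measure_pmf.prob (final_state t c s) {s. Q s} = 1"
    using tr_prob[OF assms(1-3)] by (simp add: antisym)
  then have "AE s in measure_pmf (final_state t c s). Q s"
    by (subst (asm) measure_pmf.prob_eq_1) auto
  then show ?thesis
    using assms(4) by (auto simp: AE_measure_pmf_iff final_state_def)
qed

text \<open>The loop bounds are expressions in the variables \<open>X\<close>, which the loops do not change.\<close>

definition bounded_by :: "string set \<Rightarrow> nat \<Rightarrow> state \<Rightarrow> bool" where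
  "bounded_by X N s \<longleftrightarrow> (\<forall>x\<in>X. s x 0 0 \<le> N)"

text \<open>Worst case over all coin outcomes and over arbitrary contents of the remaining
  cells.\<close>

definition poly_time :: "string set \<Rightarrow> com \<Rightarrow> bool" where
  "poly_time X c \<longleftrightarrow> (\<exists>p :: nat poly. \<forall>N s. bounded_by X N s \<longrightarrow> halts_within (poly p N) c s)"

definition poly_bound :: "string set \<Rightarrow> expr \<Rightarrow> bool" where
  "poly_bound X e \<longleftrightarrow> (\<exists>p :: nat poly. \<forall>N s. bounded_by X N s \<longrightarrow> expr_val e s \<le> poly p N) \<and>
     (\<forall>s s'. (\<forall>x\<in>X. s' x = s x) \<longrightarrow> expr_val e s' = expr_val e s)"

lemma bounded_by_frame: "bounded_by X N s \<Longrightarrow> (\<And>x. x \<in> X \<Longrightarrow> s' x = s x) \<Longrightarrow> bounded_by X N s'"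
  by (simp add: bounded_by_def)

lemma poly_bound_Const: "poly_bound X (Const k)"
  unfolding poly_bound_def by (auto intro!: exI[of _ "[:k:]"])

lemma poly_bound_V: "x \<in> X \<Longrightarrow> poly_bound X (V x)"
  unfolding poly_bound_def by (auto simp: bounded_by_def intro!: exI[of _ "[:0, 1:]"])

lemma poly_bound_Plus: "poly_bound X e1 \<Longrightarrow> poly_bound X e2 \<Longrightarrow> poly_bound X (Plus e1 e2)"
proof -
  assume "poly_bound X e1" "poly_bound X e2"
  moreover from this obtain p q :: "nat poly" where
    "\<And>N s. bounded_by X N s \<Longrightarrow> expr_val e1 s \<le> poly p N"
    "\<And>N s. bounded_by X N s \<Longrightarrow> expr_val e2 s \<le> poly q N"
    unfolding poly_bound_def by blast
  ultimately show ?thesis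
    unfolding poly_bound_def
    by (intro conjI exI[of _ "p + q"]) (simp_all add: add_mono, metis)
qed

lemma poly_time_Skip: "poly_time X Skip"
  by (auto simp: poly_time_def)

lemma poly_time_Assign: "poly_time X (Assign x e1 e2 e)"
  unfolding poly_time_def by (intro exI[of _ "[:1:]"]) (simp add: halts_within_Suc)

lemma poly_time_Flip: "poly_time X (Flip x)"
  unfolding poly_time_def by (intro exI[of _ "[:1:]"]) (simp add: halts_within_Suc)

lemma poly_time_If:
  assumes "poly_time X c1" "poly_time X c2"
  shows "poly_time X (If b c1 c2)"
proof -
  from assms obtain p q :: "nat poly" where
    "\<And>N s. bounded_by X N s \<Longrightarrow> halts_within (poly p N) c1 s"
    "\<And>N s. bounded_by X N s \<Longrightarrow> halts_within (poly q N) c2 s"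
    unfolding poly_time_def by blast
  then show ?thesis
    unfolding poly_time_def
    by (intro exI[of _ "p + q + 1"])
       (auto simp: halts_within_Suc intro: halts_within_mono[OF _ le_add1] halts_within_mono[OF _ le_add2])
qed

lemma poly_time_Seq:
  assumes "poly_time X c1" "poly_time X c2" "X \<inter> wr c1 = {}"
  shows "poly_time X (Seq c1 c2)"
proof -
  from assms(1,2) obtain p q :: "nat poly" where pq:
    "\<And>N s. bounded_by X N s \<Longrightarrow> halts_within (poly p N) c1 s"
    "\<And>N s. bounded_by X N s \<Longrightarrow> halts_within (poly q N) c2 s"
    unfolding poly_time_def by blast
  have "halts_within (Suc (poly p N + poly q N)) (Seq c1 c2) s" if s: "bounded_by X N s" for N s
  proof (rule halts_within_Seq[OF pq(1)[OF s]])
    fix r assume "r \<in> set_pmf (run (poly p N) c1 s)"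
    then have "snd r x = s x" if "x \<in> X" for x
      using run_frame[of r _ c1 s x] that assms(3) by blast
    then show "halts_within (poly q N) c2 (snd r)"
      by (intro pq(2) bounded_by_frame[OF s])
  qed
  then show ?thesis
    unfolding poly_time_def by (intro exI[of _ "p + q + 1"]) simp
qed

lemma poly_time_FOR:
  assumes c: "poly_time X c" and e: "poly_bound X e" and x: "x \<notin> wr c" "x \<notin> X" and X: "X \<inter> wr c = {}"
  shows "poly_time X (FOR x e c)"
proof -
  from c obtain p :: "nat poly" where p: "\<And>N s. bounded_by X N s \<Longrightarrow> halts_within (poly p N) c s"
    unfolding poly_time_def by blast
  from e obtain q :: "nat poly" where q: "\<And>N s. bounded_by X N s \<Longrightarrow> expr_val e s \<le> poly q N"
    unfolding poly_bound_def by blast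
  have e_eq: "expr_val e s' = expr_val e s" if "\<forall>x\<in>X. s' x = s x" for s s'
    using e that unfolding poly_bound_def by blast
  let ?inc = "Set x (Plus (V x) (Const 1))"
  \<comment> \<open>\<open>k\<close> bounds the remaining iterations. Each costs at most
    \<open>poly p N + 4\<close> steps: body, increment, test and the removal of two finished
    commands.\<close>
  have loop: "halts_within (k * (poly p N + 5) + 2) (FOR_from x e c) s"
    if "bounded_by X N s" "expr_val e s \<le> s x 0 0 + k" for N s k
    using that
  proof (induction k arbitrary: s)
    case 0
    then show ?case by (simp add: FOR_from_def halts_within_Suc numeral_2_eq_2)
  next
    case (Suc k)
    let ?T = "k * (poly p N + 5) + 2"
    show ?case
    proof (cases "s x 0 0 < expr_val e s")
      case True
      have inc: "halts_within (Suc (poly p N + 1)) (Seq c ?inc) s"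
        by (rule halts_within_Seq[OF p[OF Suc.prems(1)]]) (simp add: halts_within_Suc)
      have "halts_within ?T (FOR_from x e c) (snd r)" if r: "r \<in> set_pmf (run (Suc (poly p N + 1)) (Seq c ?inc) s)" for r
      proof (rule Suc.IH)
        have fr: "snd r y = s y" if "y \<in> X" for y
          using run_frame[OF r, of y] that x X by auto
        then show "bounded_by X N (snd r)" by (intro bounded_by_frame[OF Suc.prems(1)])
        \<comment> \<open>Halting gives a triple of probability 1 for the trivial postcondition; the
          frame rule then adds that the body keeps the counter.\<close>
        have "tr (\<lambda>s'. s' = s) (Seq c ?inc) 1 (\<lambda>s'. s' x 0 0 = Suc (s x 0 0))"
        proof (rule tr_Seq1[of _ _ "\<lambda>s'. s' x 0 0 = s x 0 0"])
          have "tr (\<lambda>s'. s' = s) c 1 (\<lambda>_. True)"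
          proof (rule trI)
            fix s' assume "s' = s"
            have "measure_pmf.prob (final_state (poly p N) c s) {s. True} = 1" by simp
            then show "ennreal 1 \<le> wp c (\<lambda>s'. of_bool True) s'"
              using prob_final_state[OF p[OF Suc.prems(1)], of "\<lambda>_. True"] \<open>s' = s\<close> by simp
          qed
          then have "tr (\<lambda>s'. s' = s \<and> s' x 0 0 = s x 0 0) c 1 (\<lambda>s'. True \<and> s' x 0 0 = s x 0 0)"
            by (rule tr_frame) (use x in simp)
          then show "tr (\<lambda>s'. s' = s) c 1 (\<lambda>s'. s' x 0 0 = s x 0 0)"
            by (rule tr_conseq) simp_all
        qed (auto simp: update_simps intro!: trI)
        from tr_run[OF this refl inc r] have "snd r x 0 0 = Suc (s x 0 0)" .
        moreover have "expr_val e (snd r) = expr_val e s" using fr by (intro e_eq) auto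
        ultimately show "expr_val e (snd r) \<le> snd r x 0 0 + k" using Suc.prems(2) by simp
      qed
      from halts_within_Seq[OF inc this]
      have "halts_within (Suc (Suc (Suc (poly p N + 1) + ?T))) (FOR_from x e c) s"
        using True unfolding FOR_from_def by (simp add: halts_within_Suc[of "Suc _"])
      then show ?thesis by (rule halts_within_mono) simp
    next
      case False
      then have "halts_within 2 (FOR_from x e c) s"
        by (simp add: FOR_from_def halts_within_Suc numeral_2_eq_2)
      then show ?thesis by (rule halts_within_mono) simp
    qed
  qed
  have "halts_within (Suc (1 + (poly q N * (poly p N + 5) + 2))) (FOR x e c) s"
    if s: "bounded_by X N s" for N s
    unfolding FOR_def
  proof (rule halts_within_Seq)
    show "halts_within 1 (Set x (Const 0)) s" by (simp add: halts_within_Suc)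
    fix r assume "r \<in> set_pmf (run 1 (Set x (Const 0)) s)"
    then have "snd r = update s x 0 0 0" by simp
    then have b: "bounded_by X N (snd r)"
      using x(2) by (intro bounded_by_frame[OF s]) (metis update_simps(1))
    show "halts_within (poly q N * (poly p N + 5) + 2) (FOR_from x e c) (snd r)"
      using q[OF b] by (intro loop[OF b]) simp
  qed
  then show ?thesis
    unfolding poly_time_def by (intro exI[of _ "q * (p + [:5:]) + [:4:]"]) (simp add: eval_nat_numeral)
qed

lemmas poly_time_intros =
  poly_time_Skip poly_time_Assign poly_time_Flip poly_time_If poly_time_Seq poly_time_FOR
  poly_bound_Const poly_bound_V poly_bound_Plus

lemma poly_time_bits: "poly_time {''n''} bits_prog"
  unfolding bits_prog_def by (intro poly_time_intros) auto

lemma poly_time_rest: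
  "poly_time {''n'', ''b''} (Seq deg_prog (Seq auction_prog
     (FOR ''t'' (V ''b'') (FOR ''u'' (Const trials) trial_prog))))"
  unfolding deg_prog_def auction_prog_def pass_prog_def best_prog_def bid_prog_def trial_prog_def
    greedy_prog_def coin_prog_def join_prog_def
  by (intro poly_time_intros) auto

text \<open>The loop bound \<open>b\<close> is computed by the program; \<open>tr_bits\<close>
  limits it to \<open>n + 4\<close> in every run, hence the composition with
  \<open>[:4, 1:]\<close>.\<close>

lemma prog_poly_time:
  "\<exists>p :: nat poly. \<forall>n G. card (pverts G) = n \<longrightarrow> halts_within (poly p n) prog (input_state G)"
proof -
  let ?rest = "Seq deg_prog (Seq auction_prog (FOR ''t'' (V ''b'') (FOR ''u'' (Const trials) trial_prog)))"
  from poly_time_bits obtain p :: "nat poly" where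
    p: "\<And>N s. bounded_by {''n''} N s \<Longrightarrow> halts_within (poly p N) bits_prog s"
    unfolding poly_time_def by blast
  from poly_time_rest obtain q :: "nat poly" where
    q: "\<And>N s. bounded_by {''n'', ''b''} N s \<Longrightarrow> halts_within (poly q N) ?rest s"
    unfolding poly_time_def by blast
  have "halts_within (Suc (poly p n + poly q (n + 4))) prog (input_state G)"
    if G: "card (pverts G) = n" for n G
    unfolding prog_def
  proof (rule halts_within_Seq)
    let ?s = "input_state G"
    have s: "?s ''n'' 0 0 = n" "?s ''b'' 0 0 = 0" using G by (simp_all add: input_state_def)
    then show h: "halts_within (poly p n) bits_prog ?s" by (intro p) (simp add: bounded_by_def)
    fix r assume r: "r \<in> set_pmf (run (poly p n) bits_prog ?s)"
    have "snd r ''n'' 0 0 = n \<and> snd r ''b'' 0 0 \<le> n + 4"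
      using tr_run[OF tr_bits[of n] _ h r] s by simp
    then show "halts_within (poly q (n + 4)) ?rest (snd r)"
      by (intro q) (simp add: bounded_by_def)
  qed
  then show ?thesis
    by (intro exI[of _ "p + pcompose q [:4, 1:] + 1"]) (auto simp: poly_pcompose add.commute)
qed

section \<open>Matchings and strategies\<close>

lemma swap_eq:
  assumes "matching G M" "{v, w} \<in> M" "w \<noteq> v"
  shows "swap M v = w"
proof -
  have "w' = w" if "w' \<noteq> v" "{v, w'} \<in> M" for w'
  proof (rule ccontr)
    assume "w' \<noteq> w"
    then have "{v, w'} \<noteq> {v, w}" using that(1) assms(3) by (auto simp: doubleton_eq_iff)
    then have "disjnt {v, w'} {v, w}"
      using assms(1,2) that(2) unfolding matching_def by (blast dest: pairwiseD)
    then show False by simp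
  qed
  then have "(THE w. w \<noteq> v \<and> {v, w} \<in> M) = w"
    using assms(2,3) by (intro the_equality) blast+
  moreover have "\<exists>w. w \<noteq> v \<and> {v, w} \<in> M" using assms(2,3) by blast
  ultimately show ?thesis by (simp add: swap_def)
qed

lemma swap_idle: "(\<And>w. w \<noteq> v \<Longrightarrow> {v, w} \<notin> M) \<Longrightarrow> swap M v = v"
  by (auto simp: swap_def)

lemma position_Suc:
  "k < length Ms \<Longrightarrow> position (take (Suc k) Ms) a = swap (Ms ! k) (position (take k Ms) a)"
  by (simp add: position_def take_Suc_conv_app_nth)

lemma connected_graphD:
  assumes "connected_graph G"
  shows "(u, v) \<in> parcs G \<Longrightarrow> (v, u) \<in> parcs G" "(v, v) \<notin> parcs G"
    "(u, v) \<in> parcs G \<Longrightarrow> u \<in> pverts G"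
proof -
  interpret pair_graph G using assms by (simp add: connected_graph_def)
  show "(u, v) \<in> parcs G \<Longrightarrow> (v, u) \<in> parcs G" by (rule arcs_symmetric)
  show "(v, v) \<notin> parcs G" using no_loops' by blast
  show "(u, v) \<in> parcs G \<Longrightarrow> u \<in> pverts G" using arc_fst_in_verts[of "(u, v)"] by simp
qed

text \<open>An infimum in \<open>enat\<close> over a nonempty set is attained, and over the empty
  set it is infinite. So some one-round strategy \<open>[M]\<close> exists, and
  \<open>swap M\<close> serves as \<open>\<sigma>\<close>.\<close>

lemma one_round_if_AC_1:
  assumes G: "connected_graph G" "pverts G = {..<n}" and AC: "AC G = 1"
  shows "\<exists>\<sigma>. one_round n (\<lambda>u v. (u, v) \<in> parcs G) \<sigma>"
proof -
  let ?A = "(\<lambda>Ms. enat (length Ms)) ` {Ms. acquaintance_strategy G Ms}"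
  have "?A \<noteq> {}"
  proof
    assume "?A = {}"
    then have "AC G = \<infinity>" by (simp only: AC_def Inf_enat_def simp_thms if_True)
    with AC show False by simp
  qed
  then have "Inf ?A \<in> ?A" unfolding Inf_enat_def by (auto intro: LeastI)
  then have "1 \<in> ?A" using AC by (simp add: AC_def)
  then obtain Ms where Ms: "acquaintance_strategy G Ms" "length Ms = 1"
    by (auto simp: one_enat_def)
  then obtain M where M: "Ms = [M]" by (auto simp: length_Suc_conv)
  have m: "matching G M" using Ms(1) M by (simp add: acquaintance_strategy_def)
  have arc: "(v, w) \<in> parcs G" if "{v, w} \<in> M" for v w
  proof -
    have "{v, w} \<in> edges G" using that m unfolding matching_def by blast
    then obtain a b where "{v, w} = {a, b}" "(a, b) \<in> parcs G" unfolding edges_def by blast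
    then show ?thesis using connected_graphD(1)[OF G(1)] by (auto simp: doubleton_eq_iff)
  qed
  have swap_M: "{v, swap M v} \<in> M" if "swap M v \<noteq> v" for v
    using that swap_idle[of v M] swap_eq[OF m, of v] by metis
  have vert: "u < n \<and> v < n" if "(u, v) \<in> parcs G" for u v
    using that connected_graphD(1,3)[OF G(1)] G(2) by blast
  have "one_round n (\<lambda>u v. (u, v) \<in> parcs G) (swap M)"
  proof
    fix u v
    show "(u, v) \<in> parcs G \<Longrightarrow> (v, u) \<in> parcs G" "(v, v) \<notin> parcs G"
      using connected_graphD[OF G(1)] by blast+
    show "(u, v) \<in> parcs G \<Longrightarrow> u < n" using vert by blast
    show "v < n \<Longrightarrow> swap M v \<noteq> v \<Longrightarrow> (v, swap M v) \<in> parcs G" using swap_M arc by blast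
    show "v < n \<Longrightarrow> swap M v < n" using swap_M arc vert by metis
    show "v < n \<Longrightarrow> swap M (swap M v) = v"
      using swap_M[of v] swap_eq[OF m, of "swap M v" v] by (metis insert_commute)
    assume "u < n" "v < n" "u \<noteq> v"
    then have "acquainted G [M] u v" using Ms(1) M G(2) by (simp add: acquaintance_strategy_def)
    then obtain k where "k \<le> 1" "(position (take k [M]) u, position (take k [M]) v) \<in> parcs G"
      by (auto simp: acquainted_def)
    then show "(u, v) \<in> parcs G \<or> (swap M u, swap M v) \<in> parcs G"
      by (cases k) (auto simp: position_def)
  qed
  then show ?thesis by blast
qed

definition round_of :: "nat \<Rightarrow> (nat \<Rightarrow> nat) \<Rightarrow> nat set set" where
  "round_of n f = {{v, f v} | v. v < n \<and> f v \<noteq> v}"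

lemma output_strategy_eq: "output_strategy n s = map (\<lambda>i. round_of n (s ''out'' i)) [0..<s ''rounds'' 0 0]"
  by (simp add: output_strategy_def round_of_def)

context one_round
begin

lemma matching_round_of:
  assumes E: "\<And>u v. E u v \<longleftrightarrow> (u, v) \<in> parcs G" and f: "mate f"
  shows "matching G (round_of n f)"
  unfolding matching_def
proof
  show "round_of n f \<subseteq> edges G"
    using f by (auto simp: round_of_def edges_def mate_def E)
  show "pairwise disjnt (round_of n f)"
  proof (rule pairwiseI)
    fix A B assume "A \<in> round_of n f" "B \<in> round_of n f" "A \<noteq> B"
    then obtain u v where uv: "A = {u, f u}" "B = {v, f v}" "u < n" "v < n"
      by (auto simp: round_of_def)
    moreover have "f (f u) = u" "f (f v) = v" using uv(3,4) f by (auto simp: mate_def)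
    ultimately show "disjnt A B" using \<open>A \<noteq> B\<close> by (auto simp: disjnt_def)
  qed
qed

lemma swap_round_of:
  fixes G :: "nat pair_pre_digraph"
  assumes E: "\<And>u v. E u v \<longleftrightarrow> (u, v) \<in> parcs G" and f: "mate f" and v: "v < n"
  shows "swap (round_of n f) v = f v"
proof (cases "f v = v")
  case True
  have "{v, w} \<notin> round_of n f" if "w \<noteq> v" for w
  proof
    assume "{v, w} \<in> round_of n f"
    then obtain u where u: "{v, w} = {u, f u}" "u < n" "f u \<noteq> u" by (auto simp: round_of_def)
    then have "v = u \<or> v = f u" by blast
    then show False using u True f by (auto simp: mate_def)
  qed
  then show ?thesis using True by (simp add: swap_idle)
next
  case False
  then have "{v, f v} \<in> round_of n f" using v by (auto simp: round_of_def)
  then show ?thesis using False by (intro swap_eq[OF matching_round_of[OF E f]])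
qed

end

section \<open>Positions of the agents under the output strategy\<close>

context assigned
begin

context
  fixes G :: "nat pair_pre_digraph"
  assumes EG: "\<And>u v. E u v \<longleftrightarrow> (u, v) \<in> parcs G" and verts: "pverts G = {..<n}"
begin

lemma block_mate:
  assumes "block s r" "v < n" "j < 4"
  shows "matching G (round_of n (s ''out'' (r + j))) \<and>
    swap (round_of n (s ''out'' (r + j))) v = s ''out'' (if j = 0 \<or> j = 3 then r else Suc r) v"
proof -
  \<comment> \<open>\<open>round_of n\<close> looks only at arguments below \<open>n\<close>, where
    the copied rows agree with the originals.\<close>
  have same: "round_of n (s ''out'' (r + 2)) = round_of n (s ''out'' (Suc r))"
    "round_of n (s ''out'' (r + 3)) = round_of n (s ''out'' r)"
    using assms(1) unfolding round_of_def block_def by (metis (no_types, lifting))+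
  have "mate (s ''out'' r)" "mate (s ''out'' (Suc r))" using assms(1) by (auto simp: block_def)
  moreover have "j = 0 \<or> j = 1 \<or> j = 2 \<or> j = 3" using assms(3) by auto
  ultimately show ?thesis
    using same assms(2) by (auto simp: matching_round_of[OF EG] swap_round_of[OF EG])
qed

text \<open>A trial applies involutions in the order \<open>f\<close>, \<open>h\<close>,
  \<open>h\<close>, \<open>f\<close>, which composes to the identity. So every trial starts with all
  agents at home, and positions inside it are read off its own two rows.\<close>

lemma progress_output:
  assumes p: "progress k s"
  shows "length (output_strategy n s) = 4 * k"
    and "M \<in> set (output_strategy n s) \<Longrightarrow> matching G M"
    and "i \<le> k \<Longrightarrow> v < n \<Longrightarrow> position (take (4 * i) (output_strategy n s)) v = v"
    and "i < k \<Longrightarrow> v < n \<Longrightarrow> position (take (4 * i + 1) (output_strategy n s)) v = s ''out'' (4 * i) v"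
    and "i < k \<Longrightarrow> v < n \<Longrightarrow> position (take (4 * i + 2) (output_strategy n s)) v
           = s ''out'' (4 * i + 1) (s ''out'' (4 * i) v)"
proof -
  let ?Ms = "output_strategy n s"
  have r: "s ''rounds'' 0 0 = 4 * k" using p by (simp add: progress_def ready_def)
  then show len: "length ?Ms = 4 * k" by (simp add: output_strategy_eq)
  have nth: "?Ms ! i = round_of n (s ''out'' i)" if "i < 4 * k" for i
    using that r by (simp add: output_strategy_eq)
  have b: "block s (4 * i)" if "i < k" for i using p that by (simp add: progress_def)
  have n0: "0 < n" using n_large by simp
  show "matching G M" if "M \<in> set ?Ms" for M
  proof -
    from that obtain i where i: "i < 4 * k" "M = ?Ms ! i" by (auto simp: in_set_conv_nth len)
    have "i = 4 * (i div 4) + i mod 4" "i div 4 < k" "i mod 4 < 4" using i(1) by auto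
    with block_mate[OF b[of "i div 4"] n0, of "i mod 4"] nth[OF i(1)] i(2) show ?thesis by simp
  qed
  have step: "position (take (Suc (4 * i + j)) ?Ms) v =
      s ''out'' (if j = 0 \<or> j = 3 then 4 * i else Suc (4 * i)) (position (take (4 * i + j) ?Ms) v)"
    if "i < k" "j < 4" "position (take (4 * i + j) ?Ms) v < n" for i j v
    using that block_mate[OF b[OF that(1)] that(3,2)] nth[of "4 * i + j"] len
    by (simp add: position_Suc)
  have m: "mate (s ''out'' (4 * i))" "mate (s ''out'' (Suc (4 * i)))" if "i < k" for i
    using b[OF that] by (auto simp: block_def)
  have four: "position (take (4 * i + 1) ?Ms) v = s ''out'' (4 * i) v"
     "position (take (4 * i + 2) ?Ms) v = s ''out'' (4 * i + 1) (s ''out'' (4 * i) v)"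
     "position (take (4 * i + 4) ?Ms) v = v"
    if i: "i < k" and v: "v < n" and pos: "position (take (4 * i) ?Ms) v = v" for i v
  proof -
    let ?f = "s ''out'' (4 * i)" and ?h = "s ''out'' (Suc (4 * i))"
    have fv: "?f v < n" "?f (?f v) = v" using m[OF i] v by (auto simp: mate_def)
    then have hf: "?h (?f v) < n" "?h (?h (?f v)) = ?f v" using m[OF i] by (auto simp: mate_def)
    have 1: "position (take (4 * i + 1) ?Ms) v = ?f v" using step[OF i, of 0 v] pos v by simp
    have 2: "position (take (4 * i + 2) ?Ms) v = ?h (?f v)" using step[OF i, of 1 v] 1 fv by simp
    have 3: "position (take (4 * i + 3) ?Ms) v = ?f v"
      using step[OF i, of 2 v] 2 hf by (simp add: eval_nat_numeral)
    have 4: "position (take (4 * i + 4) ?Ms) v = v"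
      using step[OF i, of 3 v] 3 fv by (simp add: eval_nat_numeral)
    show "position (take (4 * i + 1) ?Ms) v = ?f v"
      "position (take (4 * i + 2) ?Ms) v = s ''out'' (4 * i + 1) (?f v)"
      "position (take (4 * i + 4) ?Ms) v = v" using 1 2 4 by simp_all
  qed
  have home: "position (take (4 * i) ?Ms) v = v" if "i \<le> k" "v < n" for i v
    using that
  proof (induction i)
    case 0
    then show ?case by (simp add: position_def)
  next
    case (Suc i)
    then show ?case using four(3)[of i v] by (simp add: add.commute)
  qed
  show "position (take (4 * i) ?Ms) v = v" if "i \<le> k" "v < n" for i v using home[OF that] .
  show "position (take (4 * i + 1) ?Ms) v = s ''out'' (4 * i) v" if "i < k" "v < n" for i v
    using four(1) home that by simp
  show "position (take (4 * i + 2) ?Ms) v = s ''out'' (4 * i + 1) (s ''out'' (4 * i) v)"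
    if "i < k" "v < n" for i v
    using four(2) home that by simp
qed

lemma met_acquainted:
  assumes p: "progress k s" and met: "met x y s" and xy: "x < n" "y < n" "x \<noteq> y"
  shows "acquainted G (output_strategy n s) x y"
proof -
  let ?Ms = "output_strategy n s"
  have r: "s ''rounds'' 0 0 = 4 * k" using p by (simp add: progress_def ready_def)
  note len = progress_output(1)[OF p]
  have acq: "acquainted G ?Ms x y"
    if "j \<le> 4 * k" "E (position (take j ?Ms) x) (position (take j ?Ms) y)" for j
    using that len by (auto simp: acquainted_def EG)
  have less: "i < k" if "4 * i + 4 \<le> 4 * k" for i
    using that by simp
  from met xy(3) consider "E x y"
    | i where "i < k" "meets x y (s ''out'' (4 * i)) (s ''out'' (4 * i + 1))"
    unfolding met_def r using less by blast
  then show ?thesis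
  proof cases
    case 1
    then show ?thesis by (intro acq[of 0]) (simp_all add: position_def)
  next
    case (2 i)
    from 2(2) show ?thesis
      unfolding meets_def
    proof
      assume "E (s ''out'' (4 * i) x) (s ''out'' (4 * i) y)"
      then show ?thesis
        using 2(1) xy progress_output(4)[OF p 2(1)] by (intro acq[of "4 * i + 1"]) simp_all
    next
      assume "E (s ''out'' (4 * i + 1) (s ''out'' (4 * i) x)) (s ''out'' (4 * i + 1) (s ''out'' (4 * i) y))"
      then show ?thesis
        using 2(1) xy progress_output(5)[OF p 2(1)] by (intro acq[of "4 * i + 2"]) simp_all
    qed
  qed
qed

text \<open>As \<open>32 \<le> n\<close>, the bound on \<open>\<beta>\<close> gives
  \<open>2 ^ \<beta> < n ^ 2\<close>.\<close>

lemma \<beta>_le_ln: "real \<beta> \<le> 2 / ln 2 * ln (real n)"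
proof -
  have "2 ^ \<beta> < real (32 * n)"
    using \<beta>(2) by (metis of_nat_less_iff of_nat_numeral of_nat_power)
  then have "ln (2 ^ \<beta>) \<le> ln (real (32 * n))" using n_large by (intro ln_mono) auto
  also have "\<dots> = ln 32 + ln (real n)" using n_large by (simp add: ln_mult)
  also have "ln 32 \<le> ln (real n)" using n_large by (intro ln_mono) auto
  finally have "real \<beta> * ln 2 \<le> 2 * ln (real n)" by (simp add: ln_realpow)
  then show ?thesis by (simp add: field_simps)
qed

end

end

text \<open>One pair at a time, with the demands on matchings and length in the same event, so that
  \<open>prob_prog\<close> can take a union bound over pairs.\<close>

lemma tr_prog:
  assumes G: "connected_graph G" "pverts G = {..<n}" and AC: "AC G = 1" and n: "1000 \<le> n"
    and xy: "x < n" "y < n"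
  shows "tr (\<lambda>s. s = input_state G) prog (1 - 1 / real n ^ 3)
    (\<lambda>s. (\<forall>M\<in>set (output_strategy n s). matching G M) \<and>
       (x \<noteq> y \<longrightarrow> acquainted G (output_strategy n s) x y) \<and>
       real (length (output_strategy n s)) \<le> 8 * real trials / ln 2 * ln (real n))"
    (is "tr _ _ ?q ?Q")
proof -
  let ?E = "\<lambda>u v. (u, v) \<in> parcs G"
  from one_round_if_AC_1[OF G AC] obtain \<sigma> where "one_round n ?E \<sigma>" by blast
  then interpret one_round n ?E \<sigma> .
  define adj where "adj s \<longleftrightarrow> (\<forall>u v. s ''adj'' u v = of_bool (?E u v))" for s :: state
  define bits_ok where "bits_ok s \<longleftrightarrow> 16 * n \<le> 2 ^ s ''b'' 0 0 \<and> 2 ^ s ''b'' 0 0 < 32 * n" for s :: state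
  define zero where "zero X s \<longleftrightarrow> (\<forall>x\<in>X. s x = (\<lambda>_ _. 0))" for X and s :: state
  let ?I = "{''pr'', ''mt'', ''own'', ''rounds''}"
  have q: "0 \<le> ?q" using n by (simp add: field_simps)
  have 1: "tr (\<lambda>s. s = input_state G) bits_prog 1
     (\<lambda>s. (base s \<and> zero {''deg''} s) \<and> (bits_ok s \<and> zero ?I s))"
  proof -
    have "tr (\<lambda>s. (s ''n'' 0 0 = n \<and> s ''b'' 0 0 = 0) \<and> (adj s \<and> zero {''deg''} s \<and> zero ?I s)) bits_prog 1
       (\<lambda>s. (s ''n'' 0 0 = n \<and> s ''b'' 0 0 \<le> n + 4 \<and> 16 * n \<le> 2 ^ s ''b'' 0 0 \<and>
        (0 < n \<longrightarrow> 2 ^ s ''b'' 0 0 < 32 * n)) \<and> (adj s \<and> zero {''deg''} s \<and> zero ?I s))"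
      by (rule tr_frame[OF tr_bits]) (simp add: bits_prog_def adj_def zero_def)
    then show ?thesis
      by (rule tr_conseq)
         (use G(2) n in \<open>auto simp: input_state_def adj_def zero_def base_def bits_ok_def fun_eq_iff\<close>)
  qed
  have 2: "tr (\<lambda>s. (base s \<and> zero {''deg''} s) \<and> (bits_ok s \<and> zero ?I s)) deg_prog 1
     (\<lambda>s. (base s \<and> deg_ok s) \<and> (bits_ok s \<and> zero ?I s))"
  proof (rule tr_frame)
    show "tr (\<lambda>s. base s \<and> zero {''deg''} s) deg_prog 1 (\<lambda>s. base s \<and> deg_ok s)"
      by (rule tr_conseq[OF tr_deg]) (auto simp: zero_def)
  qed (simp add: deg_prog_def bits_ok_def zero_def)
  have 3: "tr (\<lambda>s. (base s \<and> deg_ok s) \<and> (bits_ok s \<and> zero ?I s)) auction_prog 1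
     (\<lambda>s. (auct s \<and> all_assigned s) \<and> (bits_ok s \<and> zero {''rounds''} s))"
  proof -
    have "tr (\<lambda>s. (base s \<and> deg_ok s \<and> s ''pr'' = (\<lambda>_ _. 0) \<and> s ''mt'' = (\<lambda>_ _. 0) \<and> s ''own'' = (\<lambda>_ _. 0))
        \<and> (bits_ok s \<and> zero {''rounds''} s)) auction_prog 1
     (\<lambda>s. (auct s \<and> all_assigned s) \<and> (bits_ok s \<and> zero {''rounds''} s))"
      by (rule tr_frame[OF tr_auction])
         (use n in \<open>simp_all add: auction_prog_def pass_prog_def best_prog_def bid_prog_def bits_ok_def zero_def\<close>)
    then show ?thesis by (rule tr_conseq) (auto simp: zero_def)
  qed
  have 4: "tr (\<lambda>s. (auct s \<and> all_assigned s) \<and> (bits_ok s \<and> zero {''rounds''} s))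
     (FOR ''t'' (V ''b'') (FOR ''u'' (Const trials) trial_prog)) ?q ?Q"
  proof (rule tr_fix)
    fix s0 assume s0: "(auct s0 \<and> all_assigned s0) \<and> (bits_ok s0 \<and> zero {''rounds''} s0)"
    then have inv: "auction_inv (\<lambda>z. s0 ''pr'' z 0) (\<lambda>v. s0 ''mt'' v 0) (\<lambda>z. s0 ''own'' z 0)"
      by (simp add: auct_def)
    have "s0 ''mt'' v 0 \<noteq> 0" if "low v" for v
      using s0 that by (simp add: all_assigned_def)
    from auction_complete[OF inv this] obtain \<mu> where
      asg: "\<And>v. s0 ''mt'' v 0 = (if low v then Suc (\<mu> v) else 0)"
      "\<And>v. low v \<Longrightarrow> ?E v (\<mu> v) \<and> \<not> low (\<mu> v)" "inj_on \<mu> {v. low v}" by blast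
    define \<beta> where "\<beta> = s0 ''b'' 0 0"
    \<comment> \<open>\<open>\<mu>\<close> and \<open>\<beta>\<close> are read off the state in
      which the auction ends, which is why that state had to be fixed.\<close>
    interpret assigned n ?E \<sigma> \<mu> \<beta>
      using asg(2,3) s0 n by unfold_locales (auto simp: bits_ok_def \<beta>_def)
    have "progress 0 s0"
      unfolding progress_def ready_def
    proof (intro conjI)
      show "\<forall>v. s0 ''mt'' v 0 = (if low v then Suc (\<mu> v) else 0)" using asg(1) by blast
    qed (use s0 in \<open>simp_all add: auct_def \<beta>_def zero_def\<close>)
    have Q: "?Q s" if s: "progress (\<beta> * trials) s \<and> met x y s" for s
    proof -
      from s have p: "progress (\<beta> * trials) s" and m: "met x y s" by auto
      have len: "length (output_strategy n s) = 4 * (\<beta> * trials)"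
        by (rule progress_output(1)[OF _ G(2) p]) simp
      have "real (length (output_strategy n s)) = 4 * real trials * real \<beta>"
        by (simp add: len)
      also have "\<dots> \<le> 4 * real trials * (2 / ln 2 * ln (real n))"
        by (intro mult_left_mono \<beta>_le_ln[OF _ G(2)]) auto
      finally have "real (length (output_strategy n s)) \<le> 8 * real trials / ln 2 * ln (real n)" by simp
      then show ?thesis
        using progress_output(2)[OF _ G(2) p] met_acquainted[OF _ G(2) p m xy] by blast
    qed
    show "tr (\<lambda>s. s = s0) (FOR ''t'' (V ''b'') (FOR ''u'' (Const trials) trial_prog)) ?q ?Q"
    proof (rule tr_conseq[OF tr_trials[OF xy]])
      show "progress 0 s" if "s = s0" for s using that \<open>progress 0 s0\<close> by simp
      show "?q \<le> 1 - ((1 - 1 / 2 ^ 19) ^ trials) ^ \<beta>" using trials_failure by simp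
    qed (rule Q)
  qed
  show ?thesis
    unfolding prog_def by (intro tr_Seq1[OF 1] tr_Seq1[OF 2] tr_Seq1[OF 3] 4 q)
qed

text \<open>Each of \<open>n ^ 2\<close> pairs fails with probability at most
  \<open>n ^ - 3\<close>, in total \<open>1/n\<close>.\<close>

lemma prob_prog:
  assumes G: "connected_graph G" "pverts G = {..<n}" and AC: "AC G = 1" and n: "1000 \<le> n"
    and halts: "halts_within t prog (input_state G)"
  shows "1 - 1 / real n \<le> measure_pmf.prob (final_state t prog (input_state G))
    {s. acquaintance_strategy G (output_strategy n s) \<and>
        real (length (output_strategy n s)) \<le> 8 * real trials / ln 2 * ln (real n)}"
proof -
  let ?D = "final_state t prog (input_state G)"
  define A where "A e = {s. (\<forall>M\<in>set (output_strategy n s). matching G M) \<and>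
       (fst e \<noteq> snd e \<longrightarrow> acquainted G (output_strategy n s) (fst e) (snd e)) \<and>
       real (length (output_strategy n s)) \<le> 8 * real trials / ln 2 * ln (real n)}" for e
  let ?N = "{..<n} \<times> {..<n}"
  have A: "measure_pmf.prob ?D (- A e) \<le> 1 / real n ^ 3" if "e \<in> ?N" for e
  proof -
    have "1 - 1 / real n ^ 3 \<le> measure_pmf.prob ?D (A e)"
      unfolding A_def using that
      by (intro tr_prob[OF tr_prog[OF G AC n] refl halts]) auto
    then show ?thesis
      using measure_pmf.prob_compl[of "A e" ?D] by (simp add: Compl_eq_Diff_UNIV)
  qed
  have "measure_pmf.prob ?D (\<Union>e\<in>?N. - A e) \<le> (\<Sum>e\<in>?N. measure_pmf.prob ?D (- A e))"
    by (rule measure_pmf.finite_measure_subadditive_finite) auto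
  also have "\<dots> \<le> (\<Sum>e\<in>?N. 1 / real n ^ 3)" by (intro sum_mono A)
  also have "\<dots> = 1 / real n"
    using n by (simp add: card_cartesian_product power3_eq_cube)
  finally have "1 - 1 / real n \<le> measure_pmf.prob ?D (- (\<Union>e\<in>?N. - A e))"
    using measure_pmf.prob_compl[of "\<Union>e\<in>?N. - A e" ?D] by (simp add: Compl_eq_Diff_UNIV)
  also have "- (\<Union>e\<in>?N. - A e) = {s. acquaintance_strategy G (output_strategy n s) \<and>
        real (length (output_strategy n s)) \<le> 8 * real trials / ln 2 * ln (real n)}"
  proof -
    \<comment> \<open>The conditions on matchings and length are read off any single pair, so there
      must be one.\<close>
    have "0 < n" using n by simp
    then show ?thesis
      unfolding A_def acquaintance_strategy_def G(2) by auto
  qed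
  finally show ?thesis .
qed

theorem theorem7p7:
  shows "\<exists>(prog :: com) (p :: nat poly) (C :: real) (\<epsilon> :: nat \<Rightarrow> real).
    (\<forall>n G. connected_graph G \<and> pverts G = {..<n} \<longrightarrow>
       halts_within (poly p n) prog (input_state G)) \<and>
    \<epsilon> \<longlonglongrightarrow> 0 \<and>
    (\<forall>n G. connected_graph G \<and> pverts G = {..<n} \<and> AC G = 1 \<longrightarrow>
       measure_pmf.prob (final_state (poly p n) prog (input_state G))
         {s. acquaintance_strategy G (output_strategy n s) \<and>
             real (length (output_strategy n s)) \<le> C * ln (real n)} \<ge> 1 - \<epsilon> n)"
proof -
  from prog_poly_time obtain p :: "nat poly" where
    p: "\<And>n G. card (pverts G) = n \<Longrightarrow> halts_within (poly p n) prog (input_state G)" by blast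
  \<comment> \<open>The value 1 makes the claim trivial for the small \<open>n\<close> that
    \<open>close_or_dense\<close> does not cover.\<close>
  define \<epsilon> where "\<epsilon> n = (if n < 1000 then 1 else 1 / real n)" for n
  have "\<epsilon> \<longlonglongrightarrow> 0"
  proof (rule Lim_transform_eventually[OF lim_1_over_n])
    show "\<forall>\<^sub>F n in sequentially. 1 / real n = \<epsilon> n"
      using eventually_ge_at_top[of "1000::nat"] by eventually_elim (simp add: \<epsilon>_def)
  qed
  moreover have "1 - \<epsilon> n \<le> measure_pmf.prob (final_state (poly p n) prog (input_state G))
       {s. acquaintance_strategy G (output_strategy n s) \<and>
           real (length (output_strategy n s)) \<le> 8 * real trials / ln 2 * ln (real n)}"
    if "connected_graph G" "pverts G = {..<n}" "AC G = 1" for n G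
  proof (cases "n < 1000")
    case False
    then show ?thesis
      using prob_prog[OF that _ p] that(2) by (simp add: \<epsilon>_def)
  qed (simp add: \<epsilon>_def)
  moreover have "halts_within (poly p n) prog (input_state G)" if "pverts G = {..<n}" for n G
    using that by (intro p) simp
  ultimately show ?thesis
    by (intro exI[of _ prog] exI[of _ p] exI[of _ "8 * real trials / ln 2"] exI[of _ \<epsilon>]) blast
qed

end
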